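(* Let $\mathsf D=e_1\wedge e_2\wedge e_3$, $\mathsf W=e_{112}+e_{121}+e_{211}$ and $\mathcal U_4=\{\,e_{113}+e_{122}+e_{131}+e_{212}+e_{221}+e_{311},\ e_{113}+e_{131}+e_{311}+e_{222},\ \mathsf W,\ e_{111}+e_{222},\ e_{111},\ 0\,\}$ in $\mathbb{C}^3\otimes\mathbb{C}^3\otimes\mathbb{C}^3$. For any $\alpha\in\mathbb{C}\setminus\{0\}$ and $T_{\mathrm u}\in\mathcal U_4$ we have $\Delta(\alpha\mathsf D+T_{\mathrm u})=\Delta(\mathsf D+T_{\mathrm u})$. Moreover, $$\Delta(\mathsf D)\subsetneq\Delta(\mathsf D+e_{111})\subsetneq\Delta(\mathsf D+\mathsf W)\subsetneq\Delta(\mathbb{C}^3\otimes\mathbb{C}^3\otimes\mathbb{C}^3),$$ and $\Delta(\mathsf D+T_{\mathrm u})=\Delta(\mathbb{C}^3\otimes\mathbb{C}^3\otimes\mathbb{C}^3)$ for all $T_{\mathrm u}\in\mathcal U_4\setminus\{0,e_{111},\mathsf W\}$.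
   Context: Write $e_{ijk}=e_i\otimes e_j\otimes e_k$; $e_1\wedge e_2\wedge e_3=e_{123}+e_{231}+e_{312}-e_{132}-e_{213}-e_{321}$. Moment polytope: let $\mathrm{GL}=\mathrm{GL}_3\times\mathrm{GL}_3\times\mathrm{GL}_3$ (complex matrices) act on $V=\mathbb{C}^3\otimes\mathbb{C}^3\otimes\mathbb{C}^3$ by $(A,B,C)\cdot T=(A\otimes B\otimes C)T$. For $T\ne0$ let $T_1,T_2,T_3$ be the three flattenings of $T$, viewed as linear maps from one tensor factor to the tensor product of the other two, and $\mu(T)=(T_1^*T_1,T_2^*T_2,T_3^*T_3)/\|T\|^2$. Let $\operatorname{spec}(\mu(T))\in\mathbb{R}^{9}$ be the triple of eigenvalue vectors, each sorted non-increasingly. Then $\Delta(T)=\{\operatorname{spec}(\mu(T'))\mid T'\in\overline{\mathrm{GL}\cdot T}\setminus\{0\}\}$ (Euclidean closure), and the Kronecker polytope is $\Delta(V)=\{\operatorname{spec}(\mu(T))\mid T\in V\setminus\{0\}\}$. *)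

theory Defs
  imports "HOL-Analysis.Analysis" "HOL-Computational_Algebra.Polynomial"
begin

text \<open>
  An element of \<open>\<complex>\<^sup>3 \<otimes> \<complex>\<^sup>3 \<otimes> \<complex>\<^sup>3\<close> is represented by its coordinates \<open>T $ i $ j $ k\<close>. The library
  norm and topology on this type are the Euclidean ones on \<open>\<complex>\<^sup>2\<^sup>7\<close>.
\<close>

type_synonym tensor = "complex ^ 3 ^ 3 ^ 3"

definition tensor_prod :: "complex ^ 3 \<Rightarrow> complex ^ 3 \<Rightarrow> complex ^ 3 \<Rightarrow> tensor" where
  "tensor_prod u v w = (\<chi> i j k. u $ i * v $ j * w $ k)"

text \<open>This is \<open>e\<^sub>i\<^sub>j\<^sub>k\<close>. The indices are the elements 1, 2, 3 of the three-element index type (where \<open>3 = 0\<close>).\<close>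

definition ee :: "3 \<Rightarrow> 3 \<Rightarrow> 3 \<Rightarrow> tensor" where
  "ee i j k = tensor_prod (axis i 1) (axis j 1) (axis k 1)"

text \<open>
  Scalar multiplication by complex numbers; the library's operator \<open>*s\<close> only scales by elements of
  the outermost component type, and \<open>*\<^sub>R\<close> only by reals.
\<close>

definition tensor_scale :: "complex \<Rightarrow> tensor \<Rightarrow> tensor" (infixr "\<cdot>\<^sub>T" 75) where
  "\<alpha> \<cdot>\<^sub>T T = (\<chi> i j k. \<alpha> * T $ i $ j $ k)"

definition tensor_act ::
  "complex ^ 3 ^ 3 \<Rightarrow> complex ^ 3 ^ 3 \<Rightarrow> complex ^ 3 ^ 3 \<Rightarrow> tensor \<Rightarrow> tensor" where
  "tensor_act A B C T =
     (\<chi> i j k. \<Sum>a\<in>UNIV. \<Sum>b\<in>UNIV. \<Sum>c\<in>UNIV. A $ i $ a * B $ j $ b * C $ k $ c * T $ a $ b $ c)"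

lemma tensor_act_tensor_prod:
  "tensor_act A B C (tensor_prod u v w) = tensor_prod (A *v u) (B *v v) (C *v w)"
proof -
  have factor: "(\<Sum>a\<in>UNIV. \<Sum>b\<in>UNIV. \<Sum>c\<in>UNIV. f a * (g b * h c)) =
      (\<Sum>a\<in>UNIV. f a) * ((\<Sum>b\<in>UNIV. g b) * (\<Sum>c\<in>UNIV. h c))"
    for f g h :: "3 \<Rightarrow> complex"
    by (simp flip: sum_distrib_left sum_distrib_right)
  have arrange: "x * y * z * (p * q * r) = (x * p) * ((y * q) * (z * r))" for x y z p q r :: complex
    by (simp add: mult_ac)
  show ?thesis
    unfolding tensor_act_def tensor_prod_def matrix_vector_mult_def vec_lambda_beta arrange factor
    by (simp only: mult.assoc)
qed

definition GL_orbit :: "tensor \<Rightarrow> tensor set" where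
  "GL_orbit T = {tensor_act A B C T | A B C. invertible A \<and> invertible B \<and> invertible C}"

text \<open>
  The flattenings as \<open>9 \<times> 3\<close> matrices: the columns are indexed by one tensor factor and the rows by
  pairs of indices of the other two.
\<close>

definition flattening1 :: "tensor \<Rightarrow> complex ^ 3 ^ (3 \<times> 3)" where
  "flattening1 T = (\<chi> p i. T $ i $ fst p $ snd p)"

definition flattening2 :: "tensor \<Rightarrow> complex ^ 3 ^ (3 \<times> 3)" where
  "flattening2 T = (\<chi> p j. T $ fst p $ j $ snd p)"

definition flattening3 :: "tensor \<Rightarrow> complex ^ 3 ^ (3 \<times> 3)" where
  "flattening3 T = (\<chi> p k. T $ fst p $ snd p $ k)"

definition conj_transpose :: "complex ^ 'n ^ 'm \<Rightarrow> complex ^ 'm ^ 'n" where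
  "conj_transpose M = map_matrix cnj (transpose M)"

definition moment_map ::
  "tensor \<Rightarrow> (complex ^ 3 ^ 3) \<times> (complex ^ 3 ^ 3) \<times> (complex ^ 3 ^ 3)" where
  "moment_map T =
     (1 / (norm T)\<^sup>2) *\<^sub>R
       (conj_transpose (flattening1 T) ** flattening1 T,
        conj_transpose (flattening2 T) ** flattening2 T,
        conj_transpose (flattening3 T) ** flattening3 T)"

definition charpoly :: "complex ^ 'n ^ 'n \<Rightarrow> complex poly" where
  "charpoly M = det (mat [:0, 1:] - map_matrix (\<lambda>x. [:x:]) M)"

text \<open>
  Eigenvalues with multiplicity, in non-increasing order. This is only used for Hermitian matrices,
  all of whose eigenvalues are real, so taking real parts loses nothing. The root multiset has
  exactly three elements, and \<^const>\<open>vector\<close> turns the list of them into a vector.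
\<close>

definition eigenvalue_vector :: "complex ^ 3 ^ 3 \<Rightarrow> real ^ 3" where
  "eigenvalue_vector M =
     vector (rev (sorted_list_of_multiset (image_mset Re (proots (charpoly M)))))"

text \<open>\<open>\<real>\<^sup>9\<close> is represented as \<open>\<real>\<^sup>3 \<times> \<real>\<^sup>3 \<times> \<real>\<^sup>3\<close>.\<close>

definition spec ::
  "(complex ^ 3 ^ 3) \<times> (complex ^ 3 ^ 3) \<times> (complex ^ 3 ^ 3) \<Rightarrow> (real ^ 3) \<times> (real ^ 3) \<times> (real ^ 3)"
  where
  "spec = (\<lambda>(M1, M2, M3). (eigenvalue_vector M1, eigenvalue_vector M2, eigenvalue_vector M3))"

definition moment_polytope :: "tensor \<Rightarrow> ((real ^ 3) \<times> (real ^ 3) \<times> (real ^ 3)) set" where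
  "moment_polytope T = {spec (moment_map T') | T'. T' \<in> closure (GL_orbit T) - {0}}"

definition kronecker_polytope :: "((real ^ 3) \<times> (real ^ 3) \<times> (real ^ 3)) set" where
  "kronecker_polytope = {spec (moment_map T) | T. T \<noteq> 0}"

definition tensor_D :: tensor where
  "tensor_D = ee 1 2 3 + ee 2 3 1 + ee 3 1 2 - ee 1 3 2 - ee 2 1 3 - ee 3 2 1"

definition tensor_W :: tensor where
  "tensor_W = ee 1 1 2 + ee 1 2 1 + ee 2 1 1"

definition U4 :: "tensor set" where
  "U4 = {ee 1 1 3 + ee 1 2 2 + ee 1 3 1 + ee 2 1 2 + ee 2 2 1 + ee 3 1 1,
         ee 1 1 3 + ee 1 3 1 + ee 3 1 1 + ee 2 2 2,
         tensor_W,
         ee 1 1 1 + ee 2 2 2,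
         ee 1 1 1,
         0}"

end

theory Submission
  imports Defs
begin

text \<open>
  All inclusions are orbit closure inclusions, because \<open>SL\<^sub>3\<close> embedded diagonally fixes \<open>D\<close> while it
  degenerates the symmetric tensors added to \<open>D\<close>. It remains to show that \<open>D + e\<^sub>1\<^sub>1\<^sub>1 + e\<^sub>2\<^sub>2\<^sub>2\<close> already
  has the full polytope, and to separate the smaller ones.

  For the full polytope, a point \<open>p\<close> lies in the moment polytope of \<open>T\<close> as soon as
  \<open>ln \<parallel>b \<cdot> T\<parallel> - \<langle>p, ln \<bar>diag b\<bar>\<rangle>\<close> is bounded below on triples \<open>b\<close> of lower triangular matrices: a limit of
  normalised minimising translates has diagonal marginals \<open>p\<close>. The set of such \<open>p\<close> is convex, and it
  contains the weight of every highest weight covariant not vanishing at \<open>T\<close>. On the other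
  hand, the spectra of an arbitrary tensor satisfy the linear inequalities of Higuchi and Franz, proved by
  choosing orthonormal bases in which enough coefficients vanish. The cone cut out by these
  inequalities is generated by the weights of eleven explicit covariants and their images under permutations
  of the factors, and none of them vanishes at a suitable point of the orbit of \<open>D + e\<^sub>1\<^sub>1\<^sub>1 + e\<^sub>2\<^sub>2\<^sub>2\<close>.

  The smaller polytopes are separated by points whose second and third spectra are flat, using the
  determinant of the slices of \<open>T\<close>: it is a ternary cubic that vanishes on the orbit of
  \<open>D\<close>, is a cube of a linear form for \<open>D + e\<^sub>1\<^sub>1\<^sub>1\<close>, and has a double linear factor for \<open>D + W\<close>.
\<close>

section \<open>The action of three matrices on tensors\<close>

text \<open>Triangular matrices make real weights usable: their diagonal entries are multiplicative,
  and stationarity in the diagonal and strictly lower directions already determines a Hermitian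
  marginal. As domination estimates for one fixed tensor add up and scale, no tensor with prescribed
  spectra has to be constructed: it is enough that finitely many polynomials do not vanish at a
  single point. All of them must be tested at the same point. A permutation of the factors maps D to
  D or -D, so the tensors with both signs of D are carried through together.

  The cone lives in a space of dimension 7. Each face given by one of the seven spectral
  inequalities is simplicial, with coordinates that are again facet functionals. The walls of the
  Weyl chamber are the obstacle; they are handled by subtracting rays chosen so that each wall met
  lies on a smaller class of points.

  For the separating points, two flat marginals tie the determinant of the slices to the first
  spectrum: a multiple zero on the pencil of the first two slices limits how evenly that spectrum
  can be spread.\<close>

definition act1 :: "complex^3^3 \<Rightarrow> tensor \<Rightarrow> tensor" where
  "act1 A T = (\<chi> i j k. \<Sum>a\<in>UNIV. A$i$a * T$a$j$k)"

text \<open>The transpositions \<open>swap12\<close> and \<open>swap13\<close> generate all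
  permutations of the factors, so a fact about the first factor is carried to the others by
  conjugation.\<close>

definition swap12 :: "tensor \<Rightarrow> tensor" where
  "swap12 T = (\<chi> i j k. T$j$i$k)"

definition swap13 :: "tensor \<Rightarrow> tensor" where
  "swap13 T = (\<chi> i j k. T$k$j$i)"

lemma swap_nth [simp]: "swap12 T$i$j$k = T$j$i$k" "swap13 T$i$j$k = T$k$j$i"
  by (simp_all add: swap12_def swap13_def)

lemma act1_nth: "act1 A T$i$j$k = (\<Sum>a\<in>UNIV. A$i$a * T$a$j$k)"
  by (simp add: act1_def)

lemma tensor_eqI: "(\<And>i j k. S$i$j$k = T$i$j$k) \<Longrightarrow> S = (T::tensor)"
  by (simp add: vec_eq_iff)

lemma swap_swap [simp]: "swap12 (swap12 T) = T" "swap13 (swap13 T) = T"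
  by (auto intro!: tensor_eqI)

lemma swap_braid: "swap12 (swap13 (swap12 T)) = swap13 (swap12 (swap13 T))"
  by (auto intro!: tensor_eqI)

lemma act1_act1: "act1 A (act1 B T) = act1 (A ** B) T"
proof (rule tensor_eqI)
  fix i j k
  have "(\<Sum>a\<in>UNIV. \<Sum>b\<in>UNIV. A$i$a * (B$a$b * T$b$j$k)) = (\<Sum>b\<in>UNIV. \<Sum>a\<in>UNIV. A$i$a * (B$a$b * T$b$j$k))"
    by (rule sum.swap)
  then show "act1 A (act1 B T)$i$j$k = act1 (A ** B) T$i$j$k"
    by (simp add: act1_nth matrix_matrix_mult_def sum_distrib_left sum_distrib_right mult.assoc)
qed

lemma act1_mat1 [simp]: "act1 (mat 1) T = T"
  by (rule tensor_eqI) (simp add: act1_nth mat_def if_distrib if_distribR sum.delta cong: if_cong)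

lemma act1_swap12_commute:
  "act1 A (swap12 (act1 B (swap12 T))) = swap12 (act1 B (swap12 (act1 A T)))"
  by (rule tensor_eqI) (simp add: act1_nth sum_distrib_left mult_ac,
      subst sum.swap, simp add: act1_nth sum_distrib_left mult_ac)

lemma act1_swap13_commute:
  "act1 A (swap13 (act1 B (swap13 T))) = swap13 (act1 B (swap13 (act1 A T)))"
  by (rule tensor_eqI) (simp add: act1_nth sum_distrib_left mult_ac,
      subst sum.swap, simp add: act1_nth sum_distrib_left mult_ac)

lemma tensor_act_nth:
  "tensor_act A B C T$i$j$k =
    (\<Sum>a\<in>UNIV. A$i$a * (\<Sum>b\<in>UNIV. B$j$b * (\<Sum>c\<in>UNIV. C$k$c * T$a$b$c)))"
  by (simp add: tensor_act_def sum_distrib_left mult.assoc)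

lemma tensor_act_eq_act1:
  "tensor_act A B C T = act1 A (swap12 (act1 B (swap12 (swap13 (act1 C (swap13 T))))))"
  by (rule tensor_eqI) (simp add: tensor_act_nth act1_nth)

lemma tensor_act_swap12: "tensor_act A B C (swap12 T) = swap12 (tensor_act B A C T)"
  by (rule tensor_eqI) (simp add: tensor_act_nth sum_distrib_left mult_ac,
      subst sum.swap, simp add: mult_ac)

lemma tensor_act_swap13: "tensor_act A B C (swap13 T) = swap13 (tensor_act C B A T)"
proof -
  have s: "swap13 (swap12 (swap13 S)) = swap12 (swap13 (swap12 S))" for S
    by (simp add: swap_braid)
  have 1: "tensor_act A B C T = act1 A (tensor_act (mat 1) B C T)" for A B C T
    by (simp add: tensor_act_eq_act1)
  have 2: "swap13 (tensor_act (mat 1) B C T) = tensor_act C B (mat 1) (swap13 T)" for B C T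
    by (rule tensor_eqI)
      (simp add: tensor_act_nth mat_def if_distrib if_distribR sum.delta sum_distrib_left mult_ac cong: if_cong,
      subst sum.swap, simp add: mult_ac)
  have 3: "tensor_act A B (mat 1) T = act1 A (swap12 (act1 B (swap12 T)))" for A B T
    by (simp add: tensor_act_eq_act1)
  have "swap13 (tensor_act C B A T) = swap13 (tensor_act C B (mat 1) (swap13 (act1 A (swap13 T))))"
    by (simp add: tensor_act_eq_act1)
  also have "\<dots> = tensor_act (mat 1) B C (act1 A (swap13 T))"
    by (metis 2 swap_swap(2))
  also have "\<dots> = tensor_act A B C (swap13 T)"
    by (simp add: tensor_act_eq_act1 act1_swap12_commute act1_swap13_commute)
  finally show ?thesis ..
qed

text \<open>The action is a product of three commuting one-factor actions; once they are moved past
  each other, each factor composes by \<open>act1_act1\<close>.\<close>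

lemma tensor_act_compose:
  "tensor_act A B C (tensor_act A' B' C' T) = tensor_act (A ** A') (B ** B') (C ** C') T"
proof -
  have 1: "tensor_act A B C T = act1 A (tensor_act (mat 1) B C T)" for A B C T
    by (simp add: tensor_act_eq_act1)
  have c1: "act1 A (tensor_act (mat 1) B C T) = tensor_act (mat 1) B C (act1 A T)" for A B C T
    by (simp add: tensor_act_eq_act1 act1_swap12_commute act1_swap13_commute)
  have c2: "tensor_act (mat 1) B C (tensor_act (mat 1) B' C' T) = tensor_act (mat 1) (B ** B') (C ** C') T"
    for B C B' C' T
  proof -
    have a: "tensor_act (mat 1) B (mat 1) T = swap12 (act1 B (swap12 T))" for B T
      by (simp add: tensor_act_eq_act1)
    have b: "tensor_act (mat 1) (mat 1) C T = swap13 (act1 C (swap13 T))" for C T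
      by (simp add: tensor_act_eq_act1)
    have d: "tensor_act (mat 1) B C T = tensor_act (mat 1) B (mat 1) (tensor_act (mat 1) (mat 1) C T)" for B C T
      by (simp add: tensor_act_eq_act1)
    have e: "tensor_act (mat 1) B (mat 1) (tensor_act (mat 1) (mat 1) C T) = tensor_act (mat 1) (mat 1) C (tensor_act (mat 1) B (mat 1) T)" for B C T
    proof -
      have "swap12 (tensor_act (mat 1) B (mat 1) (tensor_act (mat 1) (mat 1) C T))
         = swap12 (tensor_act (mat 1) (mat 1) C (tensor_act (mat 1) B (mat 1) T))"
        by (simp flip: tensor_act_swap12) (simp add: tensor_act_eq_act1 act1_swap13_commute)
      then show ?thesis by (metis swap_swap(1))
    qed
    show ?thesis
      unfolding d[of B C] d[of B' C'] d[of "B ** B'" "C ** C'"]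
      unfolding e[of B' C'] 
      unfolding a b by (simp add: act1_act1) (simp add: e[unfolded a b] act1_act1)
  qed
  show ?thesis
    unfolding 1[of A B C] 1[of A' B' C'] 1[of "A**A'"]
    by (simp add: c1[symmetric] act1_act1 c2)
qed

section \<open>Unitary matrices and marginals\<close>

definition unitary :: "complex^3^3 \<Rightarrow> bool" where
  "unitary U \<longleftrightarrow> U ** conj_transpose U = mat 1"

lemma conj_transpose_nth [simp]: "conj_transpose M$i$j = cnj (M$j$i)"
  by (simp add: conj_transpose_def map_matrix_def transpose_def)

lemma map_matrix_nth [simp]: "map_matrix f M$i$j = f (M$i$j)"
  by (simp add: map_matrix_def)

lemma matrix_eqI: "(\<And>i j. A$i$j = B$i$j) \<Longrightarrow> A = (B::'a^'n^'m)"
  by (simp add: vec_eq_iff)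

lemma unitary_left: "unitary U \<Longrightarrow> conj_transpose U ** U = mat 1"
  by (simp add: unitary_def matrix_left_right_inverse)

lemma unitary_rows:
  "unitary U \<longleftrightarrow> (\<forall>i j. (\<Sum>a\<in>UNIV. U$i$a * cnj (U$j$a)) = (if i = j then 1 else 0))"
  by (simp add: unitary_def vec_eq_iff matrix_matrix_mult_def mat_def)

lemma unitary_columns:
  "unitary U \<Longrightarrow> (\<Sum>i\<in>UNIV. cnj (U$i$a) * U$i$b) = (if a = b then 1 else 0)"
  by (drule unitary_left) (simp add: vec_eq_iff matrix_matrix_mult_def mat_def)

lemma unitary_mat1 [simp]: "unitary (mat 1)"
proof -
  have "conj_transpose (mat 1) = (mat 1 :: complex^3^3)"
    by (rule matrix_eqI) (simp add: mat_def)
  then show ?thesis by (simp add: unitary_def)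
qed

lemma unitary_invertible: "unitary A \<Longrightarrow> invertible A"
  by (metis invertible_def unitary_def unitary_left)

lemma unitary_cnj: "unitary A \<Longrightarrow> unitary (map_matrix cnj A)"
  unfolding unitary_rows
proof (intro allI)
  fix i j
  assume "\<forall>i j. (\<Sum>a\<in>UNIV. A$i$a * cnj (A$j$a)) = (if i = j then 1 else 0)"
  then have "cnj (\<Sum>a\<in>UNIV. A$i$a * cnj (A$j$a)) = (if i = j then 1 else 0)"
    by (simp only: split: if_split) simp
  then show "(\<Sum>a\<in>UNIV. map_matrix cnj A$i$a * cnj (map_matrix cnj A$j$a)) = (if i = j then 1 else 0)"
    by (simp only: map_matrix_nth cnj_sum complex_cnj_mult)
qed

lemma unitary_isometry:
  fixes x y :: "3 \<Rightarrow> complex"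
  assumes "unitary U"
  shows "(\<Sum>i\<in>UNIV. cnj (\<Sum>a\<in>UNIV. U$i$a * x a) * (\<Sum>b\<in>UNIV. U$i$b * y b)) = (\<Sum>a\<in>UNIV. cnj (x a) * y a)"
proof -
  have "(\<Sum>i\<in>UNIV. cnj (\<Sum>a\<in>UNIV. U$i$a * x a) * (\<Sum>b\<in>UNIV. U$i$b * y b))
      = (\<Sum>i\<in>UNIV. \<Sum>a\<in>UNIV. \<Sum>b\<in>UNIV. cnj (x a) * y b * (cnj (U$i$a) * U$i$b))"
    by (simp only: cnj_sum complex_cnj_mult sum_product) (simp only: mult_ac)
  also have "\<dots> = (\<Sum>a\<in>UNIV. \<Sum>b\<in>UNIV. cnj (x a) * y b * (\<Sum>i\<in>UNIV. cnj (U$i$a) * U$i$b))"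
    unfolding sum_distrib_left by (subst sum.swap, rule sum.cong, simp, rule sum.swap)
  also have "\<dots> = (\<Sum>a\<in>UNIV. cnj (x a) * y a)"
    by (simp add: unitary_columns[OF assms] mult_delta_right sum.delta)
  finally show ?thesis .
qed

text \<open>The conjugate sits on the first index, as in T_1^* T_1. Hence \<open>act1 A\<close>
  turns a marginal M into conj(A) M A^T and not into A M A^*.\<close>

definition marg1 :: "tensor \<Rightarrow> complex^3^3" where
  "marg1 T = (\<chi> i i'. \<Sum>j\<in>UNIV. \<Sum>k\<in>UNIV. cnj (T$i$j$k) * T$i'$j$k)"

abbreviation "marg2 T \<equiv> marg1 (swap12 T)"
abbreviation "marg3 T \<equiv> marg1 (swap13 T)"

lemma marg1_nth: "marg1 T$i$i' = (\<Sum>j\<in>UNIV. \<Sum>k\<in>UNIV. cnj (T$i$j$k) * T$i'$j$k)"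
  by (simp add: marg1_def)

lemma marg1_hermitian: "cnj (marg1 T$i$j) = marg1 T$j$i"
  by (simp add: marg1_nth mult.commute)

lemma flattening_marg:
  "conj_transpose (flattening1 T) ** flattening1 T = marg1 T"
  "conj_transpose (flattening2 T) ** flattening2 T = marg2 T"
  "conj_transpose (flattening3 T) ** flattening3 T = marg3 T"
proof -
  have s: "(\<Sum>p\<in>UNIV. f p) = (\<Sum>j\<in>UNIV. \<Sum>k\<in>UNIV. f (j, k))" for f :: "3 \<times> 3 \<Rightarrow> complex"
    by (simp add: sum.cartesian_product)
  show "conj_transpose (flattening1 T) ** flattening1 T = marg1 T"
    "conj_transpose (flattening2 T) ** flattening2 T = marg2 T"
    by (auto intro!: matrix_eqI simp: matrix_matrix_mult_def s marg1_nth flattening1_def flattening2_def)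
  show "conj_transpose (flattening3 T) ** flattening3 T = marg3 T"
    by (rule matrix_eqI) (simp add: matrix_matrix_mult_def s marg1_nth flattening3_def, rule sum.swap)
qed

lemma moment_map_marg:
  "moment_map T = (1 / (norm T)\<^sup>2) *\<^sub>R (marg1 T, marg2 T, marg3 T)"
  by (simp add: moment_map_def flattening_marg)

lemma norm_tensor: "(norm (T::tensor))\<^sup>2 = (\<Sum>i\<in>UNIV. \<Sum>j\<in>UNIV. \<Sum>k\<in>UNIV. (cmod (T$i$j$k))\<^sup>2)"
  by (simp add: norm_vec_def L2_set_def sum_nonneg)

lemma norm_marg: "complex_of_real ((norm T)\<^sup>2) = (\<Sum>i\<in>UNIV. marg1 T$i$i)"
  by (simp add: norm_tensor marg1_nth complex_norm_square mult.commute del: of_real_power)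

lemma norm_swap [simp]: "norm (swap12 T) = norm T" "norm (swap13 T) = norm T"
proof -
  have "(norm (swap12 T))\<^sup>2 = (norm T)\<^sup>2"
    unfolding norm_tensor by (simp, rule sum.swap)
  then show "norm (swap12 T) = norm T" by simp
  have "(\<Sum>i\<in>UNIV. \<Sum>j\<in>UNIV. \<Sum>k\<in>UNIV. f k j i) = (\<Sum>i\<in>UNIV. \<Sum>j\<in>UNIV. \<Sum>k\<in>UNIV. f i j k)"
    for f :: "3 \<Rightarrow> 3 \<Rightarrow> 3 \<Rightarrow> real"
    by (simp add: sum_3)
  then have "(norm (swap13 T))\<^sup>2 = (norm T)\<^sup>2"
    unfolding norm_tensor swap_nth .
  then show "norm (swap13 T) = norm T" by simp
qed

lemma sum_swap_right:
  "(\<Sum>k\<in>K. \<Sum>a\<in>A. \<Sum>b\<in>B. f k a b) = (\<Sum>a\<in>A. \<Sum>b\<in>B. \<Sum>k\<in>K. f k a b)"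
  by (subst sum.swap, rule sum.cong[OF refl], rule sum.swap)

lemma sum_swap_pairs:
  "(\<Sum>j\<in>J. \<Sum>k\<in>K. \<Sum>a\<in>A. \<Sum>b\<in>B. f j k a b) = (\<Sum>a\<in>A. \<Sum>b\<in>B. \<Sum>j\<in>J. \<Sum>k\<in>K. f j k a b)"
proof -
  have "(\<Sum>j\<in>J. \<Sum>k\<in>K. \<Sum>a\<in>A. \<Sum>b\<in>B. f j k a b) = (\<Sum>j\<in>J. \<Sum>a\<in>A. \<Sum>b\<in>B. \<Sum>k\<in>K. f j k a b)"
    by (rule sum.cong[OF refl], rule sum_swap_right)
  also have "\<dots> = (\<Sum>a\<in>A. \<Sum>b\<in>B. \<Sum>j\<in>J. \<Sum>k\<in>K. f j k a b)"
    by (rule sum_swap_right)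
  finally show ?thesis .
qed

lemma marg1_act1: "marg1 (act1 A T) = map_matrix cnj A ** marg1 T ** transpose A"
proof (rule matrix_eqI)
  fix i i'
  have "marg1 (act1 A T)$i$i' = (\<Sum>j\<in>UNIV. \<Sum>k\<in>UNIV. \<Sum>a\<in>UNIV. \<Sum>b\<in>UNIV. cnj (A$i$a) * A$i'$b * (cnj (T$a$j$k) * T$b$j$k))"
    unfolding marg1_nth act1_nth cnj_sum complex_cnj_mult sum_product by (simp only: mult_ac)
  also have "\<dots> = (\<Sum>a\<in>UNIV. \<Sum>b\<in>UNIV. cnj (A$i$a) * A$i'$b * marg1 T$a$b)"
    unfolding marg1_nth sum_distrib_left by (rule sum_swap_pairs)
  also have "\<dots> = (map_matrix cnj A ** marg1 T ** transpose A)$i$i'"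
    by (subst sum.swap) (simp add: matrix_matrix_mult_def transpose_def sum_distrib_left sum_distrib_right mult_ac)
  finally show "marg1 (act1 A T)$i$i' = (map_matrix cnj A ** marg1 T ** transpose A)$i$i'" .
qed

lemma marg1_act2: "unitary B \<Longrightarrow> marg1 (swap12 (act1 B (swap12 T))) = marg1 T"
proof (rule matrix_eqI)
  fix i i' assume B: "unitary B"
  have "marg1 (swap12 (act1 B (swap12 T)))$i$i' = (\<Sum>k\<in>UNIV. \<Sum>j\<in>UNIV.
      cnj (\<Sum>b\<in>UNIV. B$j$b * T$i$b$k) * (\<Sum>b\<in>UNIV. B$j$b * T$i'$b$k))"
    unfolding marg1_nth by (simp add: act1_nth, rule sum.swap)
  also have "\<dots> = marg1 T$i$i'"
    unfolding unitary_isometry[OF B] marg1_nth by (rule sum.swap)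
  finally show "marg1 (swap12 (act1 B (swap12 T)))$i$i' = marg1 T$i$i'" .
qed

lemma marg1_act3: "unitary B \<Longrightarrow> marg1 (swap13 (act1 B (swap13 T))) = marg1 T"
proof (rule matrix_eqI)
  fix i i' assume B: "unitary B"
  have "marg1 (swap13 (act1 B (swap13 T)))$i$i' = (\<Sum>j\<in>UNIV. \<Sum>k\<in>UNIV.
      cnj (\<Sum>b\<in>UNIV. B$k$b * T$i$j$b) * (\<Sum>b\<in>UNIV. B$k$b * T$i'$j$b))"
    unfolding marg1_nth by (simp add: act1_nth)
  also have "\<dots> = marg1 T$i$i'"
    unfolding unitary_isometry[OF B] marg1_nth ..
  finally show "marg1 (swap13 (act1 B (swap13 T)))$i$i' = marg1 T$i$i'" .
qed

lemma marg1_tensor_act: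
  assumes "unitary B" "unitary C"
  shows "marg1 (tensor_act A B C T) = map_matrix cnj A ** marg1 T ** transpose A"
  using assms by (simp add: tensor_act_eq_act1 marg1_act1 marg1_act2 marg1_act3)

lemma marg2_tensor_act:
  assumes "unitary A" "unitary C"
  shows "marg2 (tensor_act A B C T) = map_matrix cnj B ** marg2 T ** transpose B"
  using assms by (simp flip: tensor_act_swap12 add: marg1_tensor_act)

lemma marg3_tensor_act:
  assumes "unitary A" "unitary B"
  shows "marg3 (tensor_act A B C T) = map_matrix cnj C ** marg3 T ** transpose C"
  using assms by (simp flip: tensor_act_swap13 add: marg1_tensor_act)

lemma norm_act1: "unitary A \<Longrightarrow> norm (act1 A T) = norm T"
proof -
  assume A: "unitary A"
  have "complex_of_real ((norm (act1 A T))\<^sup>2) = complex_of_real ((norm (swap12 (act1 A (swap12 (swap12 T)))))\<^sup>2)"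
    by (simp only: norm_swap swap_swap)
  also have "\<dots> = complex_of_real ((norm (swap12 T))\<^sup>2)"
    unfolding norm_marg by (simp only: marg1_act2[OF A])
  finally have "(norm (act1 A T))\<^sup>2 = (norm T)\<^sup>2"
    by (simp only: of_real_eq_iff norm_swap)
  then show ?thesis by simp
qed

lemma norm_tensor_act_unitary:
  "unitary A \<Longrightarrow> unitary B \<Longrightarrow> unitary C \<Longrightarrow> norm (tensor_act A B C T) = norm T"
  by (simp add: tensor_act_eq_act1 norm_act1)

section \<open>Sorted diagonal matrices and the spectral theorem\<close>

definition diag :: "real^3 \<Rightarrow> complex^3^3" where
  "diag d = (\<chi> i j. if i = j then complex_of_real (d$i) else 0)"

lemma diag_nth: "diag d$i$j = (if i = j then complex_of_real (d$i) else 0)"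
  by (simp add: diag_def)

definition descending :: "real^3 \<Rightarrow> bool" where
  "descending d \<longleftrightarrow> d$1 \<ge> d$2 \<and> d$2 \<ge> d$3"

text \<open>Conjugation is lifted to matrices over the polynomial ring, where the scalar matrix
  \<open>X\<close> is central and constants embed multiplicatively.\<close>

lemma charpoly_unitary:
  assumes "unitary U"
  shows "charpoly (U ** M ** conj_transpose U) = charpoly M"
proof -
  define c :: "complex^3^3 \<Rightarrow> complex poly^3^3" where "c = map_matrix (\<lambda>x. [:x:])"
  have mult: "c (A ** B) = c A ** c B" for A B
    by (rule matrix_eqI) (simp add: c_def matrix_matrix_mult_def sum_3)
  have one: "c (mat 1) = mat 1"
    by (rule matrix_eqI) (simp add: c_def mat_def one_pCons)
  define X :: "complex poly^3^3" where "X = mat [:0, 1:]"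
  have X: "X ** A = A ** X" for A
    by (rule matrix_eqI) (simp add: X_def matrix_matrix_mult_def mat_def mult_delta_left mult_delta_right sum.delta mult.commute)
  have sub: "A ** (B - C) = A ** B - A ** C" "(B - C) ** A = B ** A - C ** A" for A B C :: "complex poly^3^3"
    by (rule matrix_eqI, simp add: matrix_matrix_mult_def sum_subtractf algebra_simps)+
  have U: "c U ** c (conj_transpose U) = mat 1"
    using assms by (simp add: unitary_def one flip: mult)
  have "X - c (U ** M ** conj_transpose U) = c U ** (X - c M) ** c (conj_transpose U)"
    by (simp add: sub mult X[symmetric]) (simp add: U flip: matrix_mul_assoc)
  then have "charpoly (U ** M ** conj_transpose U) = det (c U) * det (X - c M) * det (c (conj_transpose U))"
    by (simp add: charpoly_def X_def c_def det_mul)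
  also have "\<dots> = det (c U ** c (conj_transpose U)) * det (X - c M)"
    by (simp add: det_mul mult_ac)
  finally show ?thesis
    unfolding U by (simp add: charpoly_def X_def c_def)
qed

lemma eigenvalue_vector_diag:
  assumes "descending d"
  shows "eigenvalue_vector (diag d) = d"
proof -
  have "charpoly (diag d) = [:- of_real (d$1), 1:] * [:- of_real (d$2), 1:] * [:- of_real (d$3), 1:]"
    by (simp add: charpoly_def det_3 mat_def diag_nth)
  then have "proots (charpoly (diag d)) = {#of_real (d$1), of_real (d$2), of_real (d$3)#}"
    by (simp only: proots_mult) (simp add: proots_mult del: mult_pCons_left mult_pCons_right)
  then have "sorted_list_of_multiset (image_mset Re (proots (charpoly (diag d)))) = [d$3, d$2, d$1]"
    using assms by (simp add: descending_def)
  then show ?thesis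
    by (simp add: eigenvalue_vector_def vec_eq_iff forall_3)
qed

text \<open>The entries of U H U^* are the values of this form on the rows of U, so the effect of
  rotating two rows is explicit. For the identity matrix in place of H it expresses
  unitarity.\<close>

definition sesq :: "complex^3^3 \<Rightarrow> complex^3 \<Rightarrow> complex^3 \<Rightarrow> complex" where
  "sesq H x y = (\<Sum>a\<in>UNIV. \<Sum>b\<in>UNIV. x$a * H$a$b * cnj (y$b))"

lemma sesq_linear:
  "sesq H (x + y) z = sesq H x z + sesq H y z"
  "sesq H (x - y) z = sesq H x z - sesq H y z"
  "sesq H (c *s x) z = c * sesq H x z"
  "sesq H z (x + y) = sesq H z x + sesq H z y"
  "sesq H z (x - y) = sesq H z x - sesq H z y"
  "sesq H z (c *s x) = cnj c * sesq H z x"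
  by (simp_all add: sesq_def sum.distrib sum_subtractf sum_distrib_left algebra_simps)

lemma sesq_hermitian:
  assumes "\<And>i j. cnj (H$i$j) = H$j$i"
  shows "cnj (sesq H x y) = sesq H y x"
proof -
  have "cnj (sesq H x y) = (\<Sum>a\<in>UNIV. \<Sum>b\<in>UNIV. y$b * H$b$a * cnj (x$a))"
    by (simp add: sesq_def assms mult_ac)
  then show ?thesis by (simp only: sesq_def) (rule sum.swap)
qed

lemma sesq_rows: "(U ** H ** conj_transpose U)$i$j = sesq H (U$i) (U$j)"
proof -
  have "(U ** H ** conj_transpose U)$i$j = (\<Sum>b\<in>UNIV. \<Sum>a\<in>UNIV. U$i$a * H$a$b * cnj (U$j$b))"
    by (simp add: matrix_matrix_mult_def sum_distrib_right)
  then show ?thesis by (simp only: sesq_def) (rule sum.swap)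
qed

lemma unitary_sesq: "unitary U \<longleftrightarrow> (\<forall>i j. sesq (mat 1) (U$i) (U$j) = (if i = j then 1 else 0))"
proof -
  have "sesq (mat 1) (U$i) (U$j) = (\<Sum>a\<in>UNIV. U$i$a * cnj (U$j$a))" for i j
    by (simp add: sesq_def mat_def mult_delta_left mult_delta_right sum.delta)
  then show ?thesis by (simp add: unitary_rows)
qed

lemma norm_matrix: "(norm (U::complex^3^3))\<^sup>2 = (\<Sum>i\<in>UNIV. \<Sum>j\<in>UNIV. (cmod (U$i$j))\<^sup>2)"
  by (simp add: norm_vec_def L2_set_def sum_nonneg)

lemma unitary_row_norm: "unitary U \<Longrightarrow> (\<Sum>a\<in>UNIV. (cmod (U$i$a))\<^sup>2) = 1"
proof -
  assume "unitary U"
  then have "complex_of_real (\<Sum>a\<in>UNIV. (cmod (U$i$a))\<^sup>2) = 1"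
    by (simp add: unitary_rows complex_norm_square del: of_real_power)
  then show ?thesis using of_real_eq_1_iff by blast
qed

lemma compact_unitary: "compact {U. unitary U}"
proof -
  have "closed {U. unitary U}"
    unfolding unitary_rows
    by (intro closed_Collect_all closed_Collect_eq continuous_intros)
  moreover have "norm U \<le> 3" if "unitary U" for U
  proof -
    have "(norm U)\<^sup>2 \<le> 3\<^sup>2"
      unfolding norm_matrix unitary_row_norm[OF that] by (simp add: sum_3)
    then show ?thesis by (rule power2_le_imp_le) simp
  qed
  then have "bounded {U. unitary U}" by (auto simp: bounded_iff)
  ultimately show ?thesis by (simp add: compact_eq_bounded_closed)
qed

text \<open>
  A unitary maximising \<open>3 q\<^sub>1 + 2 q\<^sub>2 + q\<^sub>3\<close>, where \<open>q\<^sub>i\<close> are the diagonal entries of the conjugated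
  matrix, diagonalises it and sorts the eigenvalues at the same time, because no rotation of two
  rows can increase this quantity.
\<close>

lemma hermitian_diagonalise:
  fixes H :: "complex^3^3"
  assumes H: "\<And>i j. cnj (H$i$j) = H$j$i"
  obtains U d where "unitary U" "descending d" "U ** H ** conj_transpose U = diag d"
proof -
  \<comment> \<open>The weights 3, 2, 1 matter only through being strictly decreasing: shifting an
    amount D from row j to row i < j changes f by a positive multiple of D.\<close>
  define f where "f U = 3 * Re (sesq H (U$1) (U$1)) + 2 * Re (sesq H (U$2) (U$2)) + Re (sesq H (U$3) (U$3))"
    for U :: "complex^3^3"
  have "continuous_on {U. unitary U} f"
    unfolding f_def sesq_def by (intro continuous_intros)
  moreover have "mat 1 \<in> {U. unitary U}" by simp
  ultimately obtain U where U: "unitary U" and max: "\<And>V. unitary V \<Longrightarrow> f V \<le> f U"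
    using continuous_attains_sup[OF compact_unitary, of f] by blast
  define q where "q i j = sesq H (U$i) (U$j)" for i j
  have qh: "cnj (q i j) = q j i" for i j
    unfolding q_def by (rule sesq_hermitian[OF H])
  have orth: "sesq (mat 1) (U$i) (U$j) = (if i = j then 1 else 0)" for i j
    using U unfolding unitary_sesq by blast
  define c where "c r = complex_of_real (1 / sqrt (1 + r\<^sup>2))" for r :: real
  have c_cnj [simp]: "cnj (c r) = c r" for r by (simp add: c_def)
  \<comment> \<open>A rotation of rows i and j: \<open>r\<close> is the tangent of the angle and
    \<open>e\<close> a phase. This parametrisation keeps the change of f polynomial in r, up to the
    factor 1 + r^2.\<close>
  define rot where "rot i j r e = (\<chi> k. if k = i then c r *s (U$i + (of_real r * e) *s U$j)
    else if k = j then c r *s (U$j + (- of_real r * cnj e) *s U$i) else U$k)" for i j :: 3 and r e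
  have c2: "c r * (c r * x) = x / (1 + (of_real r)\<^sup>2)" for r x
  proof -
    have "(1 / sqrt (1 + r\<^sup>2)) * (1 / sqrt (1 + r\<^sup>2)) = 1 / (1 + r\<^sup>2)"
      by (simp add: add_nonneg_nonneg)
    then have "complex_of_real (1 / sqrt (1 + r\<^sup>2)) * complex_of_real (1 / sqrt (1 + r\<^sup>2)) = 1 / (1 + (of_real r)\<^sup>2)"
      by (metis of_real_1 of_real_add of_real_divide of_real_mult of_real_power)
    then have "c r * c r = 1 / (1 + (of_real r)\<^sup>2)" by (simp only: c_def)
    then show ?thesis by (simp add: mult.assoc[symmetric])
  qed
  have nz: "1 + (complex_of_real r)\<^sup>2 \<noteq> 0" for r
  proof -
    have "1 + r\<^sup>2 \<noteq> 0" by (metis add_nonneg_eq_0_iff zero_le_one zero_le_power2 zero_neq_one)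
    then have "complex_of_real (1 + r\<^sup>2) \<noteq> 0" by (simp only: of_real_eq_0_iff) simp
    then show ?thesis by simp
  qed
  have ri_nth: "rot i j r e$i = c r *s (U$i + (of_real r * e) *s U$j)" for i j r e
    by (simp add: rot_def)
  have rj_nth: "rot i j r e$j = c r *s (U$j + (- of_real r * cnj e) *s U$i)" if "i \<noteq> j" for i j r e
    using that by (simp add: rot_def)
  have rot_i: "sesq K (rot i j r e$i) (rot i j r e$i) = (sesq K (U$i) (U$i) + of_real (r\<^sup>2) * (e * cnj e) * sesq K (U$j) (U$j)
      + of_real r * (cnj e * sesq K (U$i) (U$j) + e * sesq K (U$j) (U$i))) / (1 + (of_real r)\<^sup>2)" for K i j r e
    unfolding ri_nth sesq_linear by (simp add: algebra_simps c2 power2_eq_square add_divide_distrib diff_divide_distrib)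
  have rot_j: "sesq K (rot i j r e$j) (rot i j r e$j) = (sesq K (U$j) (U$j) + of_real (r\<^sup>2) * (e * cnj e) * sesq K (U$i) (U$i)
      - of_real r * (cnj e * sesq K (U$i) (U$j) + e * sesq K (U$j) (U$i))) / (1 + (of_real r)\<^sup>2)" if "i \<noteq> j" for K i j r e
    unfolding rj_nth[OF that] sesq_linear by (simp add: algebra_simps c2 power2_eq_square add_divide_distrib diff_divide_distrib)
  have rot_k: "rot i j r e$k = U$k" if "k \<noteq> i" "k \<noteq> j" for i j r e k
    using that by (simp add: rot_def)
  have rot_unitary: "unitary (rot i j r e)" if "i \<noteq> j" "e * cnj e = 1" for i j r e
  proof -
    have "sesq (mat 1) (rot i j r e$k) (rot i j r e$l) = (if k = l then 1 else 0)" for k l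
    proof -
      have e: "cnj e * e = 1" using that(2) by (simp add: mult.commute)
      consider "k = l" "k = i" | "k = l" "k = j" | "k = l" "k \<noteq> i" "k \<noteq> j" | "k \<noteq> l" by blast
      then show ?thesis
      proof cases
        case 1 then show ?thesis
          using that nz[of r] by (simp add: rot_i orth)
      next
        case 2 then show ?thesis
          using that nz[of r] by (simp add: rot_j orth)
      next
        case 3 then show ?thesis
          by (simp add: rot_k orth)
      next
        case 4 then show ?thesis
          using that(1) e
          by (cases "k = i"; cases "k = j"; cases "l = i"; cases "l = j")
            (simp_all add: ri_nth rj_nth rot_k orth sesq_linear)
      qed
    qed
    then show ?thesis unfolding unitary_sesq by blast
  qed
  \<comment> \<open>The gain of a rotation, cleared of its denominator. The linear term in r will
    force the off-diagonal entry to vanish, after which the quadratic term gives the order of the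
    diagonal entries.\<close>
  have key: "r\<^sup>2 * (Re (q j j) - Re (q i i)) + 2 * r * Re (cnj e * q i j) \<le> 0"
    if ij: "(i, j) \<in> {(1,2),(1,3),(2,3)}" and e: "e * cnj e = 1" for i j r e
  proof -
    have ne: "i \<noteq> j" using ij by auto
    define D where "D = (r\<^sup>2 * (Re (q j j) - Re (q i i)) + 2 * r * Re (cnj e * q i j)) / (1 + r\<^sup>2)"
    have pos: "1 + r\<^sup>2 > 0" by (simp add: add_pos_nonneg)
    have re: "Re (x / (1 + (complex_of_real r)\<^sup>2)) = Re x / (1 + r\<^sup>2)" for x
      by (metis Re_divide_of_real of_real_1 of_real_add of_real_power)
    have sym: "Re (e * q j i) = Re (cnj e * q i j)"
      by (metis complex_cnj_mult complex_cnj_cnj qh cnj.simps(1))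
    have ri: "Re (sesq H (rot i j r e$i) (rot i j r e$i)) = Re (q i i) + D"
      unfolding rot_i e re q_def[symmetric] D_def using pos sym by (simp add: field_simps power2_eq_square)
    have rj: "Re (sesq H (rot i j r e$j) (rot i j r e$j)) = Re (q j j) - D"
      unfolding rot_j[OF ne] e re q_def[symmetric] D_def using pos sym by (simp add: field_simps power2_eq_square)
    have rk: "sesq H (rot i j r e$k) (rot i j r e$k) = q k k" if "k \<noteq> i" "k \<noteq> j" for k
      using that by (simp add: rot_k q_def)
    have "f (rot i j r e) \<le> f U" by (rule max[OF rot_unitary[OF ne e]])
    then have "D \<le> 0"
      using ij ri rj rk unfolding f_def q_def[symmetric] by auto
    then show ?thesis using pos unfolding D_def by (simp add: divide_le_0_iff)
  qed
  have zero: "q i j = 0" if ij: "(i, j) \<in> {(1,2),(1,3),(2,3)}" for i j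
  proof (rule ccontr)
    assume "q i j \<noteq> 0"
    \<comment> \<open>This phase makes the linear term equal to 2 r |q i j|, which dominates the
      quadratic term for small positive r.\<close>
    define e where "e = q i j / of_real (cmod (q i j))"
    have e: "e * cnj e = 1" using \<open>q i j \<noteq> 0\<close>
      by (simp add: e_def complex_norm_square[symmetric] power2_eq_square flip: of_real_mult)
    have "cnj e * q i j = of_real (cmod (q i j))" using \<open>q i j \<noteq> 0\<close>
      by (simp add: e_def complex_norm_square[symmetric] power2_eq_square mult.commute)
    then have k: "r\<^sup>2 * (Re (q j j) - Re (q i i)) + 2 * r * cmod (q i j) \<le> 0" for r
      using key[OF ij e, of r] by simp
    define m where "m = Re (q i i) - Re (q j j)"
    have m: "2 * cmod (q i j) \<le> r * m" if "r > 0" for r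
    proof -
      have "r * (2 * cmod (q i j)) \<le> r * (r * m)" using k[of r] by (simp add: m_def algebra_simps power2_eq_square)
      then show ?thesis using that by simp
    qed
    have "m > 0" using m[of 1] \<open>q i j \<noteq> 0\<close> by (smt (verit) zero_less_norm_iff mult_1)
    then have "2 * cmod (q i j) \<le> cmod (q i j)"
      using m[of "cmod (q i j) / m"] \<open>q i j \<noteq> 0\<close> by simp
    then show False using \<open>q i j \<noteq> 0\<close> by simp
  qed
  have desc: "Re (q j j) \<le> Re (q i i)" if "(i, j) \<in> {(1,2),(1,3),(2,3)}" for i j
    using key[OF that, of 1 1] zero[OF that] by simp
  define d where "d = (\<chi> i. Re (q i i))"
  have "q i i = of_real (Re (q i i))" for i
    using qh[of i i] by (simp add: complex_eq_iff)
  moreover have "q i j = 0" if "i \<noteq> j" for i j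
  proof -
    have "(i, j) \<in> {(1,2),(1,3),(2,3)} \<or> (j, i) \<in> {(1,2),(1,3),(2,3)}"
      using that exhaust_3[of i] exhaust_3[of j] by auto
    then show ?thesis using zero qh by (metis complex_cnj_zero)
  qed
  ultimately have "U ** H ** conj_transpose U = diag d"
    by (intro matrix_eqI) (simp add: sesq_rows q_def[symmetric] diag_nth d_def)
  moreover have "descending d"
    using desc by (simp add: descending_def d_def)
  ultimately show thesis using U that by blast
qed

lemma eigenvalue_vector_unitary:
  "unitary U \<Longrightarrow> eigenvalue_vector (U ** M ** conj_transpose U) = eigenvalue_vector M"
  by (simp add: eigenvalue_vector_def charpoly_unitary)

section \<open>Moment polytopes in terms of diagonal marginals\<close>

lemma tendsto_tensor_act [tendsto_intros]:
  assumes "(A \<longlongrightarrow> A') F" "(B \<longlongrightarrow> B') F" "(C \<longlongrightarrow> C') F" "(T \<longlongrightarrow> T') F"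
  shows "((\<lambda>x. tensor_act (A x) (B x) (C x) (T x)) \<longlongrightarrow> tensor_act A' B' C' T') F"
  unfolding tensor_act_def by (intro tendsto_intros assms)

lemma tensor_act_scaleR: "tensor_act (r *\<^sub>R A) B C T = r *\<^sub>R tensor_act A B C T"
  by (rule tensor_eqI) (simp add: tensor_act_nth scaleR_sum_right)

lemma marg_scaleR:
  "marg1 (r *\<^sub>R T) = r\<^sup>2 *\<^sub>R marg1 T" "marg2 (r *\<^sub>R T) = r\<^sup>2 *\<^sub>R marg2 T" "marg3 (r *\<^sub>R T) = r\<^sup>2 *\<^sub>R marg3 T"
  by (rule matrix_eqI, simp add: marg1_nth scaleR_sum_right power2_eq_square)+

lemma invertible_scaleR: "r \<noteq> 0 \<Longrightarrow> invertible A \<Longrightarrow> invertible (r *\<^sub>R (A::complex^3^3))"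
  by (simp add: invertible_det_nz det_3 flip: scaleR_diff_right scaleR_add_right)

lemma tensor_act_mat1 [simp]: "tensor_act (mat 1) (mat 1) (mat 1) T = T"
  by (simp add: tensor_act_eq_act1)

lemma orbit_refl: "T \<in> GL_orbit T"
  unfolding GL_orbit_def using tensor_act_mat1 unitary_invertible[OF unitary_mat1] by (metis (mono_tags, lifting) mem_Collect_eq)

lemma orbit_act:
  "S \<in> GL_orbit T \<Longrightarrow> invertible A \<Longrightarrow> invertible B \<Longrightarrow> invertible C \<Longrightarrow> tensor_act A B C S \<in> GL_orbit T"
  unfolding GL_orbit_def by (auto simp: tensor_act_compose) (metis invertible_mult)

lemma closure_orbit_act:
  assumes "S \<in> closure (GL_orbit T)" "invertible A" "invertible B" "invertible C"
  shows "tensor_act A B C S \<in> closure (GL_orbit T)"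
proof -
  obtain f where f: "\<And>n. f n \<in> GL_orbit T" "f \<longlonglongrightarrow> S"
    using assms(1) by (auto simp: closure_sequential)
  have "(\<lambda>n. tensor_act A B C (f n)) \<longlonglongrightarrow> tensor_act A B C S"
    by (intro tendsto_intros f)
  then show ?thesis
    using orbit_act[OF f(1) assms(2-)] unfolding closure_sequential
    by (intro exI[of _ "\<lambda>n. tensor_act A B C (f n)"]) auto
qed

lemma closure_orbit_subset:
  assumes "S \<in> closure (GL_orbit T)"
  shows "closure (GL_orbit S) \<subseteq> closure (GL_orbit T)"
proof (rule closure_minimal)
  show "GL_orbit S \<subseteq> closure (GL_orbit T)"
    using closure_orbit_act[OF assms] by (auto simp: GL_orbit_def)
qed simp

lemma moment_polytope_mono:
  "S \<in> closure (GL_orbit T) \<Longrightarrow> moment_polytope S \<subseteq> moment_polytope T"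
  using closure_orbit_subset unfolding moment_polytope_def by blast

lemma moment_polytope_orbit:
  assumes "S \<in> GL_orbit T" shows "moment_polytope S = moment_polytope T"
proof
  show "moment_polytope S \<subseteq> moment_polytope T"
    by (rule moment_polytope_mono[OF subsetD[OF closure_subset assms]])
  obtain A B C where inv: "invertible A" "invertible B" "invertible C" and S: "S = tensor_act A B C T"
    using assms by (auto simp: GL_orbit_def)
  obtain A' where A': "A ** A' = mat 1" "A' ** A = mat 1" using inv(1) unfolding invertible_def by blast
  obtain B' where B': "B ** B' = mat 1" "B' ** B = mat 1" using inv(2) unfolding invertible_def by blast
  obtain C' where C': "C ** C' = mat 1" "C' ** C = mat 1" using inv(3) unfolding invertible_def by blast
  have inv': "invertible A'" "invertible B'" "invertible C'"
    using A' B' C' unfolding invertible_def by blast+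
  have "T = tensor_act A' B' C' S"
    by (simp add: S tensor_act_compose A' B' C')
  then have "T \<in> GL_orbit S" using inv' unfolding GL_orbit_def by blast
  then show "moment_polytope T \<subseteq> moment_polytope S"
    by (intro moment_polytope_mono subsetD[OF closure_subset])
qed

text \<open>Unitary changes of basis and a rescaling bring every nonzero tensor into this form
  inside its orbit. From here on spectra are read off as diagonal entries, without characteristic
  polynomials.\<close>

definition standard :: "tensor \<Rightarrow> real^3 \<Rightarrow> real^3 \<Rightarrow> real^3 \<Rightarrow> bool" where
  "standard T a b c \<longleftrightarrow> norm T = 1 \<and> marg1 T = diag a \<and> marg2 T = diag b \<and> marg3 T = diag c \<and>
    descending a \<and> descending b \<and> descending c"

lemma standard_spec: "standard T a b c \<Longrightarrow> spec (moment_map T) = (a, b, c)"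
  by (simp add: standard_def moment_map_marg spec_def eigenvalue_vector_diag)

lemma diag_scaleR: "r *\<^sub>R diag d = diag (r *\<^sub>R d)"
  by (rule matrix_eqI) (simp add: diag_nth scaleR_conv_of_real[of _ "of_real _ :: complex"])

lemma descending_scaleR: "0 \<le> r \<Longrightarrow> descending d \<Longrightarrow> descending (r *\<^sub>R d)"
  by (simp add: descending_def mult_left_mono)

lemma standardise:
  assumes "T \<noteq> 0"
  obtains A B C a b c where "invertible A" "invertible B" "invertible C"
    "standard (tensor_act A B C T) a b c" "spec (moment_map T) = (a, b, c)"
proof -
  have *: "\<exists>U d. unitary U \<and> descending d \<and> U ** marg1 S ** conj_transpose U = diag d" for S
    using hermitian_diagonalise[OF marg1_hermitian] by metis
  obtain U1 a where 1: "unitary U1" "descending a" "U1 ** marg1 T ** conj_transpose U1 = diag a" using * by blast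
  obtain U2 b where 2: "unitary U2" "descending b" "U2 ** marg2 T ** conj_transpose U2 = diag b" using * by blast
  obtain U3 c where 3: "unitary U3" "descending c" "U3 ** marg3 T ** conj_transpose U3 = diag c" using * by blast
  define r where "r = 1 / norm T"
  have r: "r > 0" "1 / (norm T)\<^sup>2 = r\<^sup>2" using assms by (simp_all add: r_def power_divide)
  have cc: "map_matrix cnj (map_matrix cnj U) = U" "transpose (map_matrix cnj U) = conj_transpose U" for U :: "complex^3^3"
    by (rule matrix_eqI, simp add: transpose_def)+
  \<comment> \<open>The unitaries are conjugated because a marginal M becomes conj(A) M A^T, while
    \<open>U1\<close>, \<open>U2\<close>, \<open>U3\<close> diagonalise in the form U M U^*.\<close>
  define S where "S = tensor_act (map_matrix cnj U1) (map_matrix cnj U2) (map_matrix cnj U3) T"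
  have u: "unitary (map_matrix cnj U1)" "unitary (map_matrix cnj U2)" "unitary (map_matrix cnj U3)"
    using 1 2 3 by (simp_all add: unitary_cnj)
  have S: "marg1 S = diag a" "marg2 S = diag b" "marg3 S = diag c" "norm S = norm T"
    using u 1 2 3 by (simp_all add: S_def marg1_tensor_act marg2_tensor_act marg3_tensor_act norm_tensor_act_unitary cc)
  have "standard (r *\<^sub>R S) (r\<^sup>2 *\<^sub>R a) (r\<^sup>2 *\<^sub>R b) (r\<^sup>2 *\<^sub>R c)"
    unfolding standard_def marg_scaleR S diag_scaleR
    using 1 2 3 assms by (simp add: descending_scaleR S r_def)
  then have st: "standard (tensor_act (r *\<^sub>R map_matrix cnj U1) (map_matrix cnj U2) (map_matrix cnj U3) T)
      (r\<^sup>2 *\<^sub>R a) (r\<^sup>2 *\<^sub>R b) (r\<^sup>2 *\<^sub>R c)"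
    by (simp add: tensor_act_scaleR S_def)
  have ev: "eigenvalue_vector (r\<^sup>2 *\<^sub>R M) = r\<^sup>2 *\<^sub>R d"
    if "unitary U" "descending d" "U ** M ** conj_transpose U = diag d" for U M d
  proof -
    have "U ** (r\<^sup>2 *\<^sub>R M) ** conj_transpose U = r\<^sup>2 *\<^sub>R (U ** M ** conj_transpose U)"
      by (rule matrix_eqI) (simp add: matrix_matrix_mult_def scaleR_sum_right[symmetric])
    then have "eigenvalue_vector (r\<^sup>2 *\<^sub>R M) = eigenvalue_vector (diag (r\<^sup>2 *\<^sub>R d))"
      by (metis eigenvalue_vector_unitary[OF that(1)] that(3) diag_scaleR)
    then show ?thesis by (simp add: eigenvalue_vector_diag descending_scaleR that(2))
  qed
  have "spec (moment_map T) = (r\<^sup>2 *\<^sub>R a, r\<^sup>2 *\<^sub>R b, r\<^sup>2 *\<^sub>R c)"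
    unfolding moment_map_marg r(2) spec_def by (simp add: ev[OF 1] ev[OF 2] ev[OF 3])
  moreover have "invertible (r *\<^sub>R map_matrix cnj U1)"
    using r by (intro invertible_scaleR unitary_invertible u) auto
  ultimately show thesis using st u unitary_invertible that by blast
qed

lemma moment_polytope_iff:
  "(a, b, c) \<in> moment_polytope T \<longleftrightarrow> (\<exists>S\<in>closure (GL_orbit T). standard S a b c)"
proof
  assume "(a, b, c) \<in> moment_polytope T"
  then obtain S where S: "S \<in> closure (GL_orbit T)" "S \<noteq> 0" "spec (moment_map S) = (a, b, c)"
    by (auto simp: moment_polytope_def)
  then show "\<exists>S\<in>closure (GL_orbit T). standard S a b c"
    using standardise[OF S(2)] closure_orbit_act by (metis fst_conv snd_conv)
next
  assume "\<exists>S\<in>closure (GL_orbit T). standard S a b c"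
  then obtain S where S: "S \<in> closure (GL_orbit T)" "standard S a b c" by blast
  then have "S \<noteq> 0" by (auto simp: standard_def)
  then show "(a, b, c) \<in> moment_polytope T"
    using S standard_spec unfolding moment_polytope_def by (metis (mono_tags, lifting) Diff_iff mem_Collect_eq singletonD)
qed

lemma kronecker_polytope_iff: "(a, b, c) \<in> kronecker_polytope \<longleftrightarrow> (\<exists>S. standard S a b c)"
proof
  assume "(a, b, c) \<in> kronecker_polytope"
  then obtain S where "S \<noteq> 0" "spec (moment_map S) = (a, b, c)"
    by (auto simp: kronecker_polytope_def)
  then show "\<exists>S. standard S a b c"
    using standardise[of S] by (metis fst_conv snd_conv)
next
  assume "\<exists>S. standard S a b c"
  then obtain S where S: "standard S a b c" by blast
  then have "S \<noteq> 0" by (auto simp: standard_def)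
  then show "(a, b, c) \<in> kronecker_polytope"
    using standard_spec[OF S] unfolding kronecker_polytope_def by (metis (mono_tags, lifting) mem_Collect_eq)
qed

lemma moment_polytope_subset_kronecker: "moment_polytope T \<subseteq> kronecker_polytope"
  by (auto simp: moment_polytope_def kronecker_polytope_def)

section \<open>Minimisation over lower triangular matrices\<close>

definition lower_tri :: "complex^3^3 \<Rightarrow> bool" where
  "lower_tri A \<longleftrightarrow> A$1$2 = 0 \<and> A$1$3 = 0 \<and> A$2$3 = 0 \<and> (\<forall>i. A$i$i \<noteq> 0)"

text \<open>The logarithm of the modulus of a character of the triangular group, with real exponents
  allowed. Multiplicativity rests on triangularity: only then do diagonal entries multiply.\<close>

definition log_char :: "real^3 \<Rightarrow> complex^3^3 \<Rightarrow> real" where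
  "log_char x A = (\<Sum>i\<in>UNIV. x$i * ln (cmod (A$i$i)))"

lemma lower_tri_invertible: "lower_tri A \<Longrightarrow> invertible A"
  by (simp add: lower_tri_def invertible_det_nz det_3 forall_3)

lemma lower_tri_mult: "lower_tri A \<Longrightarrow> lower_tri B \<Longrightarrow> lower_tri (A ** B)"
  by (simp add: lower_tri_def forall_3 matrix_matrix_mult_def sum_3)

lemma log_char_mult:
  "lower_tri A \<Longrightarrow> lower_tri B \<Longrightarrow> log_char x (A ** B) = log_char x A + log_char x B"
  by (simp add: lower_tri_def forall_3 log_char_def matrix_matrix_mult_def sum_3 norm_mult ln_mult algebra_simps)

lemma lower_tri_mat1 [simp]: "lower_tri (mat 1)" "log_char x (mat 1) = 0"
  by (simp_all add: lower_tri_def log_char_def mat_def)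

lemma tensor_act_scaleR_right: "tensor_act A B C (r *\<^sub>R T) = r *\<^sub>R tensor_act A B C T"
  by (rule tensor_eqI) (simp add: tensor_act_nth flip: scaleR_sum_right)

lemma tensor_act_nonzero:
  assumes "invertible A" "invertible B" "invertible C" "T \<noteq> 0"
  shows "tensor_act A B C T \<noteq> 0"
proof
  assume 0: "tensor_act A B C T = 0"
  obtain A' where A': "A' ** A = mat 1" using assms(1) unfolding invertible_def by blast
  obtain B' where B': "B' ** B = mat 1" using assms(2) unfolding invertible_def by blast
  obtain C' where C': "C' ** C = mat 1" using assms(3) unfolding invertible_def by blast
  have "T = tensor_act A' B' C' (tensor_act A B C T)"
    by (simp add: tensor_act_compose A' B' C')
  also have "\<dots> = 0" by (rule tensor_eqI) (simp add: 0 tensor_act_nth)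
  finally show False using assms by blast
qed

text \<open>
  Boundedness below on the group of lower triangular matrices of the Kempf--Ness function
  \<open>ln \<parallel>b \<cdot> T\<parallel>\<close> twisted by the character with the given weights.
\<close>

definition log_dominated :: "tensor \<Rightarrow> real^3 \<Rightarrow> real^3 \<Rightarrow> real^3 \<Rightarrow> bool" where
  "log_dominated T a b c \<longleftrightarrow> (\<exists>K. \<forall>A B C. lower_tri A \<longrightarrow> lower_tri B \<longrightarrow> lower_tri C \<longrightarrow>
    log_char a A + log_char b B + log_char c C \<le> (\<Sum>i\<in>UNIV. a$i) * ln (norm (tensor_act A B C T)) + K)"

text \<open>The hypothesis is an equality at the identity. Scaling one basis vector gives the
  derivative 2 (M_ii - a_i) = 0; adding z times the matrix unit at (i, j), i > j, gives 2 Re(z M_ij)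
  + |z|^2 M_jj >= 0, hence M_ij = 0. Hermitian symmetry supplies the entries above the
  diagonal.\<close>

lemma marg1_of_minimal:
  assumes norm: "norm L = 1" and min: "\<And>A. lower_tri A \<Longrightarrow> exp (log_char a A) \<le> norm (act1 A L)"
  shows "marg1 L = diag a"
proof -
  define M where "M = marg1 L"
  have herm: "cnj (M$i$j) = M$j$i" for i j by (simp add: M_def marg1_hermitian)
  have real: "M$i$i = of_real (Re (M$i$i))" for i
    using herm[of i i] by (simp add: complex_eq_iff)
  have tr: "Re (M$1$1) + Re (M$2$2) + Re (M$3$3) = 1"
    using arg_cong[OF norm_marg[of L], of Re] norm by (simp add: M_def sum_3)
  have act: "(norm (act1 A L))\<^sup>2 = Re (\<Sum>i\<in>UNIV. \<Sum>p\<in>UNIV. (\<Sum>q\<in>UNIV. cnj (A$i$q) * M$q$p) * A$i$p)" for A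
    using arg_cong[OF norm_marg[of "act1 A L"], of Re]
    by (simp add: marg1_act1 M_def matrix_matrix_mult_def transpose_def)
  have bound: "exp (2 * log_char a A) \<le> (norm (act1 A L))\<^sup>2" if "lower_tri A" for A
    using power_mono[OF min[OF that], of 2] by (simp add: exp_double)
  have diagonal: "Re (M$i$i) = a$i" for i
  proof -
    define A where "A s = (\<chi> p q. if p = q then if p = i then complex_of_real (1 + s) else 1 else 0)" for s :: real
    define g where "g s = 1 + ((1 + s)\<^sup>2 - 1) * Re (M$i$i) - exp (2 * (a$i * ln (1 + s)))" for s :: real
    have "0 \<le> g s" if s: "\<bar>s\<bar> < 1" for s
    proof -
      have "complex_of_real (1 + s) \<noteq> 0" using s by (simp only: of_real_eq_0_iff)
      then have "lower_tri (A s)" unfolding lower_tri_def A_def by simp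
      moreover have "log_char a (A s) = a$i * ln (1 + s)"
      proof -
        have "cmod (complex_of_real (1 + s)) = 1 + s"
          using s by (simp only: norm_of_real)
        then have "cmod (1 + complex_of_real s) = 1 + s" by simp
        then show ?thesis
          using exhaust_3[of i] by (auto simp: log_char_def A_def sum_3)
      qed
      moreover have "(norm (act1 (A s) L))\<^sup>2 = 1 + ((1 + s)\<^sup>2 - 1) * Re (M$i$i)"
        using exhaust_3[of i] tr unfolding act
        by (elim disjE) (simp_all add: A_def sum_3 algebra_simps power2_eq_square)
      ultimately show ?thesis using bound[of "A s"] by (simp add: g_def)
    qed
    moreover have "g 0 = 0" by (simp add: g_def)
    moreover have "(g has_real_derivative (2 * Re (M$i$i) - 2 * a$i)) (at 0)"
      unfolding g_def by (rule derivative_eq_intros refl | simp)+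
    ultimately have "2 * Re (M$i$i) - 2 * a$i = 0"
      by (intro DERIV_local_min[of g _ 0 1]) auto
    then show ?thesis by simp
  qed
  have off: "M$i$j = 0" if ij: "(i, j) \<in> {(2,1),(3,1),(3,2)}" for i j
  proof (rule ccontr)
    assume nz: "M$i$j \<noteq> 0"
    define m where "m = Re (M$j$j)"
    define A where "A z = (\<chi> p q. if p = q then 1 else if p = i \<and> q = j then z else 0)" for z :: complex
    have pos: "0 \<le> 2 * Re (z * M$i$j) + (cmod z)\<^sup>2 * m" for z
    proof -
      have "lower_tri (A z)" "log_char a (A z) = 0"
        using ij by (elim insertE emptyE; simp add: lower_tri_def A_def log_char_def)+
      then have "1 \<le> (norm (act1 (A z) L))\<^sup>2" using bound[of "A z"] by simp
      also have "\<dots> = 1 + (Re (z * M$i$j) + Re (cnj z * M$j$i)) + Re (z * cnj z * M$j$j)"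
        using ij tr unfolding act by (elim insertE emptyE; simp add: A_def sum_3 algebra_simps)
      also have "Re (cnj z * M$j$i) = Re (z * M$i$j)"
        by (metis herm complex_cnj_mult cnj.simps(1))
      also have "Re (z * cnj z * M$j$j) = (cmod z)\<^sup>2 * m"
        by (subst real) (simp add: m_def complex_norm_square[symmetric] flip: of_real_mult)
      finally show ?thesis by simp
    qed
    define w where "w = (cmod (M$i$j))\<^sup>2"
    have w: "w > 0" using nz by (simp add: w_def)
    \<comment> \<open>The choice z = -t conj(M_ij) makes the linear term negative. Taking t = 1
      shows m to be positive, and then the minimiser t = 1/m violates the inequality.\<close>
    have k: "2 * t * w \<le> t\<^sup>2 * w * m" for t
    proof -
      have "(- of_real t * cnj (M$i$j)) * M$i$j = of_real (- t * w)"
        unfolding w_def of_real_mult complex_norm_square by (simp add: mult_ac)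
      then have "Re ((- of_real t * cnj (M$i$j)) * M$i$j) = - t * w" by (simp only: Re_complex_of_real)
      moreover have "(cmod (- of_real t * cnj (M$i$j)))\<^sup>2 = t\<^sup>2 * w"
        by (simp add: w_def norm_mult power_mult_distrib)
      ultimately show ?thesis using pos[of "- of_real t * cnj (M$i$j)"] by simp
    qed
    have "2 * w \<le> m * w" using k[of 1] by (simp add: mult.commute)
    then have m: "m \<ge> 2" using w by (simp only: mult_le_cancel_right_pos)
    have "2 * (1 / m) * w \<le> (1 / m) * w" using k[of "1 / m"] m by (simp add: power2_eq_square)
    then have "2 * (1 / m) \<le> 1 / m" using w by (simp only: mult_le_cancel_right_pos)
    then show False using m by (simp add: field_simps)
  qed
  have "M$i$j = (if i = j then of_real (a$i) else 0)" for i j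
  proof (cases "i = j")
    case True then show ?thesis using real[of i] diagonal[of i] by simp
  next
    case False
    then have "(i, j) \<in> {(2,1),(3,1),(3,2)} \<or> (j, i) \<in> {(2,1),(3,1),(3,2)}"
      using exhaust_3[of i] exhaust_3[of j] by auto
    then show ?thesis using off herm False by (metis complex_cnj_zero)
  qed
  then show ?thesis by (intro matrix_eqI) (simp add: diag_nth flip: M_def)
qed

text \<open>
  A limit of normalised minimising translates is a minimum of the Kempf--Ness function at the
  identity; the first-order conditions there say that the marginals are diagonal with the
  prescribed entries.
\<close>

theorem moment_polytope_of_log_dominated:
  assumes dom: "log_dominated T a b c" and nz: "T \<noteq> 0"
    and sums: "(\<Sum>i\<in>UNIV. a$i) = 1" "(\<Sum>i\<in>UNIV. b$i) = 1" "(\<Sum>i\<in>UNIV. c$i) = 1"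
    and desc: "descending a" "descending b" "descending c"
  shows "(a, b, c) \<in> moment_polytope T"
proof -
  define V where "V = {(A, B, C). lower_tri A \<and> lower_tri B \<and> lower_tri C}"
  define \<phi> where "\<phi> = (\<lambda>(A, B, C). ln (norm (tensor_act A B C T)) - (log_char a A + log_char b B + log_char c C))"
  obtain K where K: "\<And>A B C. lower_tri A \<Longrightarrow> lower_tri B \<Longrightarrow> lower_tri C \<Longrightarrow>
    log_char a A + log_char b B + log_char c C \<le> ln (norm (tensor_act A B C T)) + K"
    using dom by (auto simp: log_dominated_def sums)
  have bdd: "bdd_below (\<phi> ` V)"
    by (rule bdd_belowI[of _ "- K"]) (use K in \<open>force simp: \<phi>_def V_def\<close>)
  have "(mat 1, mat 1, mat 1) \<in> V" by (simp add: V_def)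
  then have ne: "\<phi> ` V \<noteq> {}" by blast
  define m where "m = Inf (\<phi> ` V)"
  have low: "m \<le> \<phi> v" if "v \<in> V" for v
    unfolding m_def by (rule cInf_lower[OF imageI[OF that] bdd])
  have "\<exists>v\<in>V. \<phi> v < m + 1 / real (Suc n)" for n
    using cInf_lessD[OF ne, of "m + 1 / real (Suc n)"] by (auto simp: m_def)
  then obtain v where v: "\<And>n. v n \<in> V" "\<And>n. \<phi> (v n) < m + 1 / real (Suc n)" by metis
  define A where "A n = fst (v n)" for n
  define B where "B n = fst (snd (v n))" for n
  define C where "C n = snd (snd (v n))" for n
  have tri: "lower_tri (A n)" "lower_tri (B n)" "lower_tri (C n)" for n
    using v(1)[of n] by (auto simp: V_def A_def B_def C_def)
  define N where "N n = norm (tensor_act (A n) (B n) (C n) T)" for n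
  have N: "N n > 0" for n
    unfolding N_def using tri nz by (simp add: tensor_act_nonzero lower_tri_invertible)
  have \<phi>: "\<phi> (v n) = ln (N n) - (log_char a (A n) + log_char b (B n) + log_char c (C n))" for n
    by (simp add: \<phi>_def N_def A_def B_def C_def split_beta)
  \<comment> \<open>The normalisation is absorbed into the first matrix, which keeps
    \<open>S n\<close> in the orbit.\<close>
  define S where "S n = tensor_act ((1 / N n) *\<^sub>R A n) (B n) (C n) T" for n
  have S: "S n = (1 / N n) *\<^sub>R tensor_act (A n) (B n) (C n) T" for n
    by (simp add: S_def tensor_act_scaleR)
  have S_orbit: "S n \<in> GL_orbit T" for n
    unfolding S_def using N[of n] tri
    by (intro orbit_act[OF orbit_refl] invertible_scaleR lower_tri_invertible) auto
  have S_norm: "norm (S n) = 1" for n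
    using N[of n] by (simp add: S flip: N_def)
  \<comment> \<open>Near-minimality at \<open>v n\<close> becomes near-minimality of
    \<open>S n\<close> at the identity, because translating by a further triangular triple adds its
    characters.\<close>
  have S_bound: "exp (log_char a A' + log_char b B' + log_char c C' - 1 / real (Suc n)) \<le> norm (tensor_act A' B' C' (S n))"
    if t: "lower_tri A'" "lower_tri B'" "lower_tri C'" for A' B' C' n
  proof -
    define P where "P = norm (tensor_act A' B' C' (tensor_act (A n) (B n) (C n) T))"
    have P: "P > 0" unfolding P_def using t tri nz by (simp add: tensor_act_nonzero lower_tri_invertible)
    have "m \<le> \<phi> (A' ** A n, B' ** B n, C' ** C n)"
      using t tri by (intro low) (simp add: V_def lower_tri_mult)
    also have "\<dots> = ln P - (log_char a A' + log_char b B' + log_char c C')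
        - (log_char a (A n) + log_char b (B n) + log_char c (C n))"
      using t tri by (simp add: \<phi>_def log_char_mult P_def tensor_act_compose)
    finally have "log_char a A' + log_char b B' + log_char c C' - 1 / real (Suc n) \<le> ln P - ln (N n)"
      using v(2)[of n] \<phi>[of n] by linarith
    also have "\<dots> = ln (P / N n)" using P N[of n] by (simp add: ln_div)
    finally have "exp (log_char a A' + log_char b B' + log_char c C' - 1 / real (Suc n)) \<le> P / N n"
      using P N[of n] by (subst ln_ge_iff[symmetric]) auto
    moreover have "tensor_act A' B' C' (S n) = (1 / N n) *\<^sub>R tensor_act A' B' C' (tensor_act (A n) (B n) (C n) T)"
      by (simp add: S tensor_act_scaleR_right)
    ultimately show ?thesis using N[of n] by (simp add: P_def)
  qed
  \<comment> \<open>The group elements may diverge, but the normalised tensors stay on a compact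
    sphere; the limit therefore lies in the orbit closure and perhaps not in the orbit.\<close>
  have "compact (sphere (0::tensor) 1)" by simp
  moreover have "\<forall>n. S n \<in> sphere 0 1" using S_norm by simp
  ultimately obtain L r where L: "norm L = 1" and r: "strict_mono r" and lim: "(S \<circ> r) \<longlonglongrightarrow> L"
    unfolding compact_def by (metis mem_sphere_0)
  have mem: "L \<in> closure (GL_orbit T)"
    using lim S_orbit unfolding closure_sequential by (intro exI[of _ "S \<circ> r"]) auto
  have L_bound: "exp (log_char a A' + log_char b B' + log_char c C') \<le> norm (tensor_act A' B' C' L)"
    if t: "lower_tri A'" "lower_tri B'" "lower_tri C'" for A' B' C'
  proof (rule LIMSEQ_le)
    have "(\<lambda>n. 1 / real (Suc n)) \<longlonglongrightarrow> 0"
      using LIMSEQ_inverse_real_of_nat by (simp add: inverse_eq_divide)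
    then have "(\<lambda>n. 1 / real (Suc (r n))) \<longlonglongrightarrow> 0"
      using LIMSEQ_subseq_LIMSEQ[OF _ r] by (fastforce simp: o_def)
    then have "(\<lambda>n. exp (log_char a A' + log_char b B' + log_char c C' - 1 / real (Suc (r n))))
        \<longlonglongrightarrow> exp (log_char a A' + log_char b B' + log_char c C' - 0)"
      by (intro tendsto_intros)
    then show "(\<lambda>n. exp (log_char a A' + log_char b B' + log_char c C' - 1 / real (Suc (r n))))
        \<longlonglongrightarrow> exp (log_char a A' + log_char b B' + log_char c C')" by simp
    show "(\<lambda>n. norm (tensor_act A' B' C' ((S \<circ> r) n))) \<longlonglongrightarrow> norm (tensor_act A' B' C' L)"
      by (intro tendsto_intros lim)
    show "\<exists>N. \<forall>n\<ge>N. exp (log_char a A' + log_char b B' + log_char c C' - 1 / real (Suc (r n)))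
        \<le> norm (tensor_act A' B' C' ((S \<circ> r) n))"
      using S_bound[OF t] by simp
  qed
  have "marg1 L = diag a"
  proof (rule marg1_of_minimal[OF L])
    fix A :: "complex^3^3" assume "lower_tri A"
    then show "exp (log_char a A) \<le> norm (act1 A L)"
      using L_bound[of A "mat 1" "mat 1"] by (simp add: tensor_act_eq_act1)
  qed
  moreover have "marg2 L = diag b"
  proof (rule marg1_of_minimal)
    fix B :: "complex^3^3" assume "lower_tri B"
    then show "exp (log_char b B) \<le> norm (act1 B (swap12 L))"
      using L_bound[of "mat 1" B "mat 1"] by (simp add: tensor_act_eq_act1)
  qed (simp add: L)
  moreover have "marg3 L = diag c"
  proof (rule marg1_of_minimal)
    fix C :: "complex^3^3" assume "lower_tri C"
    then show "exp (log_char c C) \<le> norm (act1 C (swap13 L))"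
      using L_bound[of "mat 1" "mat 1" C] by (simp add: tensor_act_eq_act1)
  qed (simp add: L)
  ultimately have "standard L a b c" using L desc by (simp add: standard_def)
  then show ?thesis using mem moment_polytope_iff by blast
qed

section \<open>Covariants\<close>

text \<open>Highest weight vectors with respect to the lower triangular group, one factor at a time,
  so that each identity to be checked involves a single matrix.\<close>

definition semi1 :: "(tensor \<Rightarrow> complex) \<Rightarrow> nat \<Rightarrow> nat \<Rightarrow> nat \<Rightarrow> bool" where
  "semi1 F k l m \<longleftrightarrow> (\<forall>A T. lower_tri A \<longrightarrow> F (act1 A T) = A$1$1 ^ k * A$2$2 ^ l * A$3$3 ^ m * F T)"

abbreviation "semi2 F \<equiv> semi1 (\<lambda>T. F (swap12 T))"
abbreviation "semi3 F \<equiv> semi1 (\<lambda>T. F (swap13 T))"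

lemma vec3_nth [simp]:
  "(vector [x, y, z] :: 'a::zero^3)$1 = x" "(vector [x, y, z] :: 'a::zero^3)$2 = y" "(vector [x, y, z] :: 'a::zero^3)$3 = z"
  by (rule vector_3)+

text \<open>F is homogeneous and bounded on the unit sphere, so |F(b.T)| is at most a constant times
  a power of the norm of b.T. On the other hand |F(b.T)| is |F(T)| times the moduli of the
  characters. Logarithms turn the comparison into domination.\<close>

lemma log_dominated_covariant:
  assumes semi: "semi1 F a1 a2 a3" "semi2 F b1 b2 b3" "semi3 F c1 c2 c3"
    and cont: "continuous_on UNIV F" and nz: "F T \<noteq> 0" "T \<noteq> 0"
  shows "log_dominated T (vector [real a1, real a2, real a3]) (vector [real b1, real b2, real b3])
    (vector [real c1, real c2, real c3])"
proof -
  define N where "N = a1 + a2 + a3"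
  \<comment> \<open>Scalar matrices in the first factor are triangular, so the degree of F is the
    sum of its first weights.\<close>
  have hom: "F (r *\<^sub>R S) = of_real r ^ N * F S" if "r \<noteq> 0" for r S
  proof -
    have "lower_tri (r *\<^sub>R mat 1)" using that by (simp add: lower_tri_def mat_def)
    moreover have "act1 (r *\<^sub>R mat 1) S = r *\<^sub>R S"
      using tensor_act_scaleR[of r "mat 1" "mat 1" "mat 1" S] by (simp add: tensor_act_eq_act1)
    ultimately have "F (r *\<^sub>R S) = (r *\<^sub>R mat 1 :: complex^3^3)$1$1 ^ a1 * (r *\<^sub>R mat 1 :: complex^3^3)$2$2 ^ a2 * (r *\<^sub>R mat 1 :: complex^3^3)$3$3 ^ a3 * F S"
      using semi(1) unfolding semi1_def by metis
    then show ?thesis by (simp add: mat_def N_def power_add scaleR_conv_of_real[of _ "1 :: complex"])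
  qed
  have eq: "F (tensor_act A B C S) = A$1$1 ^ a1 * A$2$2 ^ a2 * A$3$3 ^ a3 * (B$1$1 ^ b1 * B$2$2 ^ b2 * B$3$3 ^ b3 *
      (C$1$1 ^ c1 * C$2$2 ^ c2 * C$3$3 ^ c3 * F S))"
    if "lower_tri A" "lower_tri B" "lower_tri C" for A B C S
    using semi that unfolding semi1_def tensor_act_eq_act1 by simp
  have "compact (F ` sphere 0 1)"
    by (intro compact_continuous_image continuous_on_subset[OF cont]) auto
  then obtain C0 where C0: "\<And>S. norm S = 1 \<Longrightarrow> cmod (F S) \<le> C0" "C0 > 0"
    using compact_imp_bounded bounded_pos by (metis image_eqI mem_sphere_0)
  have bound: "cmod (F S) \<le> norm S ^ N * C0" if "S \<noteq> 0" for S
  proof -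
    have "cmod (F S) = norm S ^ N * cmod (F ((1 / norm S) *\<^sub>R S))"
      using hom[of "norm S" "(1 / norm S) *\<^sub>R S"] that by (simp add: norm_mult norm_power)
    also have "\<dots> \<le> norm S ^ N * C0"
      using that by (intro mult_left_mono C0) auto
    finally show ?thesis .
  qed
  have "log_char (vector [real a1, real a2, real a3]) A + log_char (vector [real b1, real b2, real b3]) B
      + log_char (vector [real c1, real c2, real c3]) C \<le> (\<Sum>i\<in>UNIV. (vector [real a1, real a2, real a3] :: real^3)$i) *
      ln (norm (tensor_act A B C T)) + (ln C0 - ln (cmod (F T)))"
    if t: "lower_tri A" "lower_tri B" "lower_tri C" for A B C
  proof -
    define S where "S = tensor_act A B C T"
    have S: "S \<noteq> 0" unfolding S_def using t nz by (simp add: tensor_act_nonzero lower_tri_invertible)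
    have d: "A$i$i \<noteq> 0" "B$i$i \<noteq> 0" "C$i$i \<noteq> 0" for i using t by (auto simp: lower_tri_def)
    have "F S \<noteq> 0" using eq[OF t, of T] d nz by (simp add: S_def)
    then have "ln (cmod (F S)) \<le> ln (norm S ^ N * C0)"
      using bound[OF S] S C0 by (subst ln_le_cancel_iff) auto
    also have "\<dots> = N * ln (norm S) + ln C0"
      using S C0 by (simp add: ln_mult ln_realpow)
    finally show ?thesis
      using d nz unfolding S_def eq[OF t]
      by (simp add: log_char_def sum_3 norm_mult norm_power ln_mult ln_realpow N_def)
  qed
  then show ?thesis unfolding log_dominated_def by blast
qed

section \<open>Brackets and the explicit covariants built from them\<close>

definition br2 :: "complex^3 \<Rightarrow> complex^3 \<Rightarrow> complex" where
  "br2 u v = u$1 * v$2 - u$2 * v$1"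

definition br3 :: "complex^3 \<Rightarrow> complex^3 \<Rightarrow> complex^3 \<Rightarrow> complex" where
  "br3 u v w = u$1 * (v$2 * w$3 - v$3 * w$2) - u$2 * (v$1 * w$3 - v$3 * w$1) + u$3 * (v$1 * w$2 - v$2 * w$1)"

lemma br2_linear [simp]:
  "br2 (x + y) z = br2 x z + br2 y z" "br2 z (x + y) = br2 z x + br2 z y"
  "br2 (a *s x) y = a * br2 x y" "br2 x (a *s y) = a * br2 x y" "br2 x x = 0"
  by (simp_all add: br2_def algebra_simps)

lemma br3_linear [simp]:
  "br3 (x + y) z w = br3 x z w + br3 y z w" "br3 z (x + y) w = br3 z x w + br3 z y w" "br3 z w (x + y) = br3 z w x + br3 z w y"
  "br3 (a *s x) y z = a * br3 x y z" "br3 x (a *s y) z = a * br3 x y z" "br3 x y (a *s z) = a * br3 x y z"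
  "br3 x x y = 0" "br3 x y x = 0" "br3 y x x = 0"
  by (simp_all add: br3_def algebra_simps)

text \<open>The first two coordinates are transformed by the leading block of \<open>C\<close>
  alone. The first coordinate, this minor and the full determinant are the building blocks for
  semi-invariance in the third factor.\<close>

lemma br2_matrix: "lower_tri C \<Longrightarrow> br2 (C *v x) (C *v y) = C$1$1 * C$2$2 * br2 x y"
  by (simp add: br2_def matrix_vector_mult_def sum_3 lower_tri_def algebra_simps)

lemma br3_matrix: "lower_tri C \<Longrightarrow> br3 (C *v x) (C *v y) (C *v z) = C$1$1 * C$2$2 * C$3$3 * br3 x y z"
  by (simp add: br3_def matrix_vector_mult_def sum_3 lower_tri_def algebra_simps)

lemma matrix_vector_lower: "lower_tri C \<Longrightarrow> (C *v x)$1 = C$1$1 * x$1"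
  by (simp add: matrix_vector_mult_def sum_3 lower_tri_def)

lemma act1_lower:
  assumes "lower_tri A"
  shows "act1 A T$1$j = A$1$1 *s T$1$j" "act1 A T$2$j = A$2$1 *s T$1$j + A$2$2 *s T$2$j"
    "act1 A T$3$j = A$3$1 *s T$1$j + A$3$2 *s T$2$j + A$3$3 *s T$3$j"
  using assms by (simp_all add: vec_eq_iff act1_nth sum_3 lower_tri_def)

lemma act2_lower:
  assumes "lower_tri A"
  shows "swap12 (act1 A T)$j$1 = A$1$1 *s swap12 T$j$1" "swap12 (act1 A T)$j$2 = A$2$1 *s swap12 T$j$1 + A$2$2 *s swap12 T$j$2"
    "swap12 (act1 A T)$j$3 = A$3$1 *s swap12 T$j$1 + A$3$2 *s swap12 T$j$2 + A$3$3 *s swap12 T$j$3"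
  using assms by (simp_all add: vec_eq_iff act1_nth sum_3 lower_tri_def)

lemma act3_vec: "swap13 (act1 A T)$i$j = A *v (swap13 T$i$j)"
  by (simp add: vec_eq_iff act1_nth matrix_vector_mult_def)

text \<open>
  The digits in the name of a covariant are its weights on the three factors. \<open>cov_411_411_330\<close> is the
  determinant of the member of the pencil \<open>T\<^sub>i\<^sub>j\<^sub>1, T\<^sub>i\<^sub>j\<^sub>2\<close> whose first entry vanishes, \<open>cov_220_220_220\<close> is Cayley's
  hyperdeterminant of the leading \<open>2 \<times> 2 \<times> 2\<close> block.
\<close>

definition "cov_100_100_100 T = T$1$1$1" for T :: tensor
definition "cov_200_110_110 T = br2 (T$1$1) (T$1$2)"
definition "cov_300_111_111 T = br3 (T$1$1) (T$1$2) (T$1$3)"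
definition "cov_210_210_111 T = br3 (T$1$1) (T$1$2) (T$2$1)"
definition "cov_310_220_211 T = T$1$2$1 * br3 (T$1$1) (T$1$2) (T$2$1) - T$1$1$1 * br3 (T$1$1) (T$1$2) (T$2$2)"
text \<open>With m_ij = \<open>br3 (T$1$1) (T$1$2) (T$i$j)\<close>, this is the minor of rows 2, 3
  and columns 1, 2. As m_11 = m_12 = 0, adding the first slice to the others leaves it
  unchanged.\<close>

definition "cov_411_330_222 T = br3 (T$1$1) (T$1$2) (T$2$1) * br3 (T$1$1) (T$1$2) (T$3$2)
  - br3 (T$1$1) (T$1$2) (T$2$2) * br3 (T$1$1) (T$1$2) (T$3$1)"
definition "cov_411_411_330 T = br3 (vector [0, br2 (T$1$1) (T$1$2), br2 (T$1$1) (T$1$3)])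
  (vector [br2 (T$1$1) (T$2$1), br2 (T$1$1) (T$2$2), br2 (T$1$1) (T$2$3)])
  (vector [br2 (T$1$1) (T$3$1), br2 (T$1$1) (T$3$2), br2 (T$1$1) (T$3$3)])"
definition "cov_330_330_222 T = br3 (T$1$2) (T$2$1) (T$2$2) * br3 (T$1$1) (T$1$2) (T$2$1)
  - br3 (T$1$1) (T$2$1) (T$2$2) * br3 (T$1$1) (T$1$2) (T$2$2)"
definition "cov_220_220_220 T = (br2 (T$1$1) (T$2$2) + br2 (T$2$1) (T$1$2))\<^sup>2 - 4 * br2 (T$1$1) (T$1$2) * br2 (T$2$1) (T$2$2)"
definition "cubic_disc p q r s = q\<^sup>2 * r\<^sup>2 - 4 * p * r ^ 3 - 4 * q ^ 3 * s - 27 * p\<^sup>2 * s\<^sup>2 + 18 * p * q * r * s" for p :: complex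
text \<open>The discriminant of the binary cubic det(s T_1 + t T_2), where T_1 and T_2 are the first
  two slices.\<close>

definition "cov_660_444_444 T = cubic_disc (br3 (T$1$1) (T$1$2) (T$1$3))
  (br3 (T$2$1) (T$1$2) (T$1$3) + br3 (T$1$1) (T$2$2) (T$1$3) + br3 (T$1$1) (T$1$2) (T$2$3))
  (br3 (T$1$1) (T$2$2) (T$2$3) + br3 (T$2$1) (T$1$2) (T$2$3) + br3 (T$2$1) (T$2$2) (T$1$3))
  (br3 (T$2$1) (T$2$2) (T$2$3))"

lemma semi_111: "semi1 cov_100_100_100 1 0 0" "semi2 cov_100_100_100 1 0 0" "semi3 cov_100_100_100 1 0 0"
  unfolding semi1_def cov_100_100_100_def
  by (auto simp: act1_lower act2_lower act3_vec matrix_vector_lower simp del: swap_nth)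

lemma semi_200: "semi1 cov_200_110_110 2 0 0" "semi2 cov_200_110_110 1 1 0" "semi3 cov_200_110_110 1 1 0"
  unfolding semi1_def cov_200_110_110_def
  by (auto simp: act1_lower act2_lower act3_vec br2_matrix power2_eq_square simp del: swap_nth)

lemma semi_300: "semi1 cov_300_111_111 3 0 0" "semi2 cov_300_111_111 1 1 1" "semi3 cov_300_111_111 1 1 1"
  unfolding semi1_def cov_300_111_111_def
  by (auto simp: act1_lower act2_lower act3_vec br3_matrix power3_eq_cube simp del: swap_nth)

lemma semi_210: "semi1 cov_210_210_111 2 1 0" "semi2 cov_210_210_111 2 1 0" "semi3 cov_210_210_111 1 1 1"
  unfolding semi1_def cov_210_210_111_def
  by (auto simp: act1_lower act2_lower act3_vec br3_matrix power2_eq_square simp del: swap_nth)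

lemma semi_310: "semi1 cov_310_220_211 3 1 0" "semi2 cov_310_220_211 2 2 0" "semi3 cov_310_220_211 2 1 1"
  unfolding semi1_def cov_310_220_211_def
  by (auto simp: act1_lower act2_lower act3_vec br3_matrix matrix_vector_lower power2_eq_square power3_eq_cube algebra_simps simp del: swap_nth)

lemma semi_411_330: "semi1 cov_411_330_222 4 1 1" "semi2 cov_411_330_222 3 3 0" "semi3 cov_411_330_222 2 2 2"
  unfolding semi1_def cov_411_330_222_def
  by (auto simp: act1_lower act2_lower act3_vec br3_matrix power2_eq_square power3_eq_cube power4_eq_xxxx algebra_simps simp del: swap_nth)

lemma semi_411_411: "semi1 cov_411_411_330 4 1 1" "semi2 cov_411_411_330 4 1 1" "semi3 cov_411_411_330 3 3 0"
  unfolding semi1_def cov_411_411_330_def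
  by (auto simp: act1_lower act2_lower act3_vec br2_matrix br3_def power2_eq_square power3_eq_cube power4_eq_xxxx algebra_simps simp del: swap_nth)

lemma br2_swap: "br2 (T$2$1) (T$1$1) = - br2 (T$1$1) (T$2$1)"
  by (simp add: br2_def)

lemma br3_swap:
  "br3 (T$1$2) (T$1$1) x = - br3 (T$1$1) (T$1$2) x"
  "br3 (T$2$1) (T$1$1) x = - br3 (T$1$1) (T$2$1) x"
  "br3 x (T$2$1) (T$1$2) = - br3 x (T$1$2) (T$2$1)"
  by (simp_all add: br3_def algebra_simps)

lemma semi_220: "semi1 cov_220_220_220 2 2 0" "semi2 cov_220_220_220 2 2 0" "semi3 cov_220_220_220 2 2 0"
  unfolding semi1_def cov_220_220_220_def
  by (auto simp: act1_lower act2_lower act3_vec br2_matrix br2_swap power2_eq_square algebra_simps simp del: swap_nth)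

lemma semi_330: "semi1 cov_330_330_222 3 3 0" "semi2 cov_330_330_222 3 3 0" "semi3 cov_330_330_222 2 2 2"
  unfolding semi1_def cov_330_330_222_def
  by (auto simp: act1_lower act2_lower act3_vec br3_matrix br3_swap power2_eq_square power3_eq_cube algebra_simps simp del: swap_nth)

text \<open>On the left stand the coefficients of f(x s + z t, y t) for the binary cubic f with
  coefficients p, q, r, s. The discriminant has degree 4 and is invariant under SL_2, so it picks up
  the sixth power of the determinant x y.\<close>

lemma cubic_disc_shift:
  "cubic_disc (x ^ 3 * p) (x\<^sup>2 * (3 * z * p + y * q)) (x * (3 * z\<^sup>2 * p + 2 * z * y * q + y\<^sup>2 * r))
    (z ^ 3 * p + z\<^sup>2 * y * q + z * y\<^sup>2 * r + y ^ 3 * s) = x ^ 6 * y ^ 6 * cubic_disc p q r s"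
  unfolding cubic_disc_def by algebra

lemma cubic_disc_scale: "cubic_disc (x * p) (x * q) (x * r) (x * s) = x ^ 4 * cubic_disc p q r s"
  unfolding cubic_disc_def by algebra

lemma semi_660:
  "semi1 cov_660_444_444 6 6 0" "semi2 cov_660_444_444 4 4 4" "semi3 cov_660_444_444 4 4 4"
proof -
  show "semi1 cov_660_444_444 6 6 0"
    unfolding semi1_def
  proof (intro allI impI)
    fix A T assume A: "lower_tri A"
    show "cov_660_444_444 (act1 A T) = A$1$1 ^ 6 * A$2$2 ^ 6 * A$3$3 ^ 0 * cov_660_444_444 T"
      unfolding cov_660_444_444_def act1_lower[OF A] power_0 mult_1_right
      by (subst cubic_disc_shift[symmetric, where z = "A$2$1"], rule arg_cong4[where f = cubic_disc])
        (simp_all add: algebra_simps power2_eq_square power3_eq_cube)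
  qed
  have scale: "A$1$1 ^ 4 * A$2$2 ^ 4 * A$3$3 ^ 4 * cubic_disc p q r s =
      cubic_disc (A$1$1 * A$2$2 * A$3$3 * p) (A$1$1 * A$2$2 * A$3$3 * q) (A$1$1 * A$2$2 * A$3$3 * r) (A$1$1 * A$2$2 * A$3$3 * s)"
    for A :: "complex^3^3" and p q r s
    by (simp add: cubic_disc_scale power_mult_distrib)
  show "semi2 cov_660_444_444 4 4 4"
    unfolding semi1_def
  proof (intro allI impI)
    fix A T assume A: "lower_tri A"
    show "cov_660_444_444 (swap12 (act1 A T)) = A$1$1 ^ 4 * A$2$2 ^ 4 * A$3$3 ^ 4 * cov_660_444_444 (swap12 T)"
      unfolding cov_660_444_444_def act2_lower[OF A] scale
      by (rule arg_cong4[where f = cubic_disc]; simp del: swap_nth; simp add: br3_def algebra_simps del: swap_nth)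
  qed
  show "semi3 cov_660_444_444 4 4 4"
    unfolding semi1_def
  proof (intro allI impI)
    fix A T assume A: "lower_tri A"
    show "cov_660_444_444 (swap13 (act1 A T)) = A$1$1 ^ 4 * A$2$2 ^ 4 * A$3$3 ^ 4 * cov_660_444_444 (swap13 T)"
      unfolding cov_660_444_444_def act3_vec br3_matrix[OF A] scale
      by (rule arg_cong4[where f = cubic_disc]; simp add: algebra_simps del: swap_nth)
  qed
qed

section \<open>Triangular nine by nine matrices and Strassen's invariant\<close>

lemma tensor_D_nth:
  "tensor_D$i$j$k = (if (i, j, k) \<in> {(1,2,3),(2,3,1),(3,1,2)} then 1 else if (i, j, k) \<in> {(1,3,2),(2,1,3),(3,2,1)} then -1 else 0)"
  using exhaust_3[of i] exhaust_3[of j] exhaust_3[of k]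
  by (elim disjE) (simp_all add: tensor_D_def ee_def tensor_prod_def axis_def)

text \<open>A permutation that never raises the rank preserves the sum of all ranks, hence every
  single rank, and by injectivity it is the identity. So only the diagonal product survives in the
  Leibniz formula.\<close>

lemma det_lower_rank:
  fixes A :: "'a::comm_ring_1^'n^'n" and r :: "'n \<Rightarrow> nat"
  assumes inj: "inj r" and lower: "\<And>i j. r i < r j \<Longrightarrow> A$i$j = 0"
  shows "det A = (\<Prod>i\<in>UNIV. A$i$i)"
proof -
  have "(\<Prod>i\<in>UNIV. A$i$p i) = 0" if p: "p permutes UNIV" "p \<noteq> id" for p
  proof -
    have "\<exists>i. r i < r (p i)"
    proof (rule ccontr)
      assume "\<nexists>i. r i < r (p i)"
      then have le: "r (p i) \<le> r i" for i by (simp add: not_less)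
      have "(\<Sum>i\<in>UNIV. r (p i)) = (\<Sum>i\<in>UNIV. r i)"
        using sum.permute[OF p(1), of r] by (simp add: o_def)
      then have "r (p i) = r i" for i
        using sum_mono_inv[of "\<lambda>i. r (p i)" UNIV r i] le by simp
      then have "p = id" using inj by (auto simp: inj_def)
      then show False using p(2) by simp
    qed
    then show ?thesis using lower by (metis finite UNIV_I prod_zero)
  qed
  then have "det A = (\<Sum>p\<in>{id}. of_int (sign p) * (\<Prod>i\<in>UNIV. A$i$p i))"
    unfolding det_def by (intro sum.mono_neutral_right) (auto simp: permutes_id)
  then show ?thesis by (simp add: sign_id)
qed

definition kron_left :: "complex^3^3 \<Rightarrow> complex^(3 \<times> 3)^(3 \<times> 3)" where
  "kron_left M = (\<chi> p q. if snd p = snd q then M$fst p$fst q else 0)"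

definition kron_right :: "complex^3^3 \<Rightarrow> complex^(3 \<times> 3)^(3 \<times> 3)" where
  "kron_right M = (\<chi> p q. if fst p = fst q then M$snd p$snd q else 0)"

text \<open>The Koszul flattening, whose determinant is Strassen's invariant of degree 9.\<close>

definition koszul :: "tensor \<Rightarrow> complex^(3 \<times> 3)^(3 \<times> 3)" where
  "koszul T = (\<chi> p q. \<Sum>a\<in>UNIV. tensor_D$fst p$fst q$a * T$a$snd q$snd p)"

lemma sum_pairs: "(\<Sum>p\<in>UNIV. f p) = (\<Sum>j\<in>UNIV. \<Sum>k\<in>UNIV. f (j, k))" for f :: "3 \<times> 3 \<Rightarrow> complex"
  by (simp add: sum.cartesian_product)

text \<open>In the index type 3 equals 0; the order 1, 2, 3 behind \<open>lower_tri\<close> is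
  therefore fixed explicitly.\<close>

definition rank3 :: "3 \<Rightarrow> nat" where
  "rank3 i = (if i = 1 then 0 else if i = 2 then 1 else 2)"

definition pair_rank :: "3 \<times> 3 \<Rightarrow> nat" where
  "pair_rank p = 3 * rank3 (fst p) + rank3 (snd p)"

lemma inj_pair_rank: "inj pair_rank"
proof (rule injI)
  fix p q :: "3 \<times> 3" assume "pair_rank p = pair_rank q"
  then have "rank3 (fst p) = rank3 (fst q)" "rank3 (snd p) = rank3 (snd q)"
    unfolding pair_rank_def rank3_def by (auto split: if_splits)
  moreover have "i = j" if "rank3 i = rank3 j" for i j
    using that exhaust_3[of i] exhaust_3[of j] by (auto simp: rank3_def split: if_splits)
  ultimately show "p = q" by (simp add: prod_eq_iff)
qed

lemma det_kron:
  assumes "lower_tri M"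
  shows "det (kron_left M) = (M$1$1 * M$2$2 * M$3$3) ^ 3" "det (kron_right M) = (M$1$1 * M$2$2 * M$3$3) ^ 3"
proof -
  have zero: "M$i$j = 0" if "rank3 i < rank3 j" for i j
    using assms that exhaust_3[of i] exhaust_3[of j] by (auto simp: lower_tri_def rank3_def split: if_splits)
  have P: "(\<Prod>p\<in>UNIV. f p) = (\<Prod>j\<in>UNIV. \<Prod>k\<in>UNIV. f (j, k))" for f :: "3 \<times> 3 \<Rightarrow> complex"
    by (simp add: prod.cartesian_product)
  have p3: "prod f UNIV = f 1 * f 2 * f 3" for f :: "3 \<Rightarrow> complex"
    unfolding UNIV_3 by (simp add: mult.assoc)
  have "kron_left M$p$q = 0" "kron_right M$p$q = 0" if "pair_rank p < pair_rank q" for p q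
    using that by (auto intro!: zero simp: pair_rank_def kron_left_def kron_right_def)
  then have "det (kron_left M) = (\<Prod>p\<in>UNIV. kron_left M$p$p)" "det (kron_right M) = (\<Prod>p\<in>UNIV. kron_right M$p$p)"
    by (auto intro!: det_lower_rank[OF inj_pair_rank])
  then show "det (kron_left M) = (M$1$1 * M$2$2 * M$3$3) ^ 3" "det (kron_right M) = (M$1$1 * M$2$2 * M$3$3) ^ 3"
    unfolding P p3 kron_left_def kron_right_def by (simp_all add: power3_eq_cube)
qed

lemma kron_right_mult: "(kron_right M ** X)$p$q = (\<Sum>k\<in>UNIV. M$snd p$k * X$(fst p, k)$q)"
  unfolding matrix_matrix_mult_def vec_lambda_beta sum_pairs
  by (subst sum.swap) (simp add: kron_right_def mult_delta_left sum.delta)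

lemma mult_kron_right: "(X ** transpose (kron_right M))$p$q = (\<Sum>k\<in>UNIV. M$snd q$k * X$p$(fst q, k))"
  unfolding matrix_matrix_mult_def vec_lambda_beta sum_pairs transpose_def
  by (subst sum.swap) (simp add: kron_right_def mult_delta_right sum.delta mult.commute)

lemma kron_left_mult: "(transpose (kron_left M) ** X)$p$q = (\<Sum>k\<in>UNIV. M$k$fst p * X$(k, snd p)$q)"
  unfolding matrix_matrix_mult_def vec_lambda_beta sum_pairs transpose_def
  by (simp add: kron_left_def mult_delta_left sum.delta)

lemma mult_kron_left: "(X ** kron_left M)$p$q = (\<Sum>k\<in>UNIV. M$k$fst q * X$p$(k, snd q))"
  unfolding matrix_matrix_mult_def vec_lambda_beta sum_pairs
  by (simp add: kron_left_def mult_delta_right sum.delta mult.commute)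

lemma tensor_act_D: "tensor_act A A A tensor_D = det A \<cdot>\<^sub>T tensor_D"
proof (rule tensor_eqI)
  fix i j k
  show "tensor_act A A A tensor_D$i$j$k = (det A \<cdot>\<^sub>T tensor_D)$i$j$k"
    using exhaust_3[of i] exhaust_3[of j] exhaust_3[of k]
    by (elim disjE; simp add: tensor_act_nth tensor_scale_def sum_3 tensor_D_nth det_3 algebra_simps)
qed

lemma koszul_act3: "koszul (swap13 (act1 C T)) = kron_right C ** koszul (swap13 T)"
proof (rule matrix_eqI)
  fix p q
  show "koszul (swap13 (act1 C T))$p$q = (kron_right C ** koszul (swap13 T))$p$q"
    unfolding kron_right_mult by (simp add: koszul_def act1_nth sum_distrib_left, subst sum.swap, simp add: mult_ac)
qed

lemma koszul_act2: "koszul (swap12 (act1 B T)) = koszul (swap12 T) ** transpose (kron_right B)"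
proof (rule matrix_eqI)
  fix p q
  show "koszul (swap12 (act1 B T))$p$q = (koszul (swap12 T) ** transpose (kron_right B))$p$q"
    unfolding mult_kron_right by (simp add: koszul_def act1_nth sum_distrib_left, subst sum.swap, simp add: mult_ac)
qed

text \<open>Contracting both Koszul indices with A, together with the copy of A from the action on
  T, completes the action of (A^T, A^T, A^T) on D, which multiplies D by det A.\<close>

lemma koszul_act1:
  "transpose (kron_left A) ** koszul (act1 A T) ** kron_left A = (\<chi> p q. det A * koszul T$p$q)"
proof (rule matrix_eqI)
  fix p q
  have "(transpose (kron_left A) ** koszul (act1 A T) ** kron_left A)$p$q =
     (\<Sum>c\<in>UNIV. tensor_act (transpose A) (transpose A) (transpose A) tensor_D$fst p$fst q$c * T$c$snd q$snd p)"
    unfolding mult_kron_left kron_left_mult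
    by (simp add: koszul_def act1_nth tensor_act_nth transpose_def sum_3 algebra_simps)
  then show "(transpose (kron_left A) ** koszul (act1 A T) ** kron_left A)$p$q = (\<chi> p q. det A * koszul T$p$q)$p$q"
    by (simp add: tensor_act_D tensor_scale_def koszul_def sum_distrib_left mult.assoc det_transpose)
qed

definition "cov_333_333_333 T = det (koszul T)"

lemma semi_333: "semi1 cov_333_333_333 3 3 3" "semi2 cov_333_333_333 3 3 3" "semi3 cov_333_333_333 3 3 3"
proof -
  show "semi1 cov_333_333_333 3 3 3"
    unfolding semi1_def
  proof (intro allI impI)
    fix A T assume A: "lower_tri A"
    define d where "d = A$1$1 * A$2$2 * A$3$3"
    have d: "d \<noteq> 0" "det A = d" using A by (auto simp: d_def lower_tri_def det_3)
    \<comment> \<open>Each Kronecker factor contributes d^3, the nine rows scaled by det A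
      contribute d^9; what is left is d^3.\<close>
    have "d ^ 3 * det (koszul (act1 A T)) * d ^ 3 = det (\<chi> p q. det A * koszul T$p$q)"
      unfolding koszul_act1[symmetric] det_mul det_transpose det_kron[OF A] d_def ..
    also have "\<dots> = d ^ 9 * det (koszul T)"
      using det_rows_mul[of "\<lambda>_. d" "\<lambda>p. koszul T$p"] d by (simp add: vector_scalar_mult_def)
    finally have "d ^ 6 * det (koszul (act1 A T)) = d ^ 6 * (d ^ 3 * det (koszul T))"
      by (simp add: algebra_simps flip: power_add)
    then have "det (koszul (act1 A T)) = d ^ 3 * det (koszul T)"
      using d(1) by (simp only: mult_cancel_left power_eq_0_iff) simp
    then show "cov_333_333_333 (act1 A T) = A$1$1 ^ 3 * A$2$2 ^ 3 * A$3$3 ^ 3 * cov_333_333_333 T"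
      by (simp add: cov_333_333_333_def d_def power_mult_distrib)
  qed
  show "semi2 cov_333_333_333 3 3 3" "semi3 cov_333_333_333 3 3 3"
    unfolding semi1_def cov_333_333_333_def
    by (simp_all add: koszul_act2 koszul_act3 det_mul det_transpose det_kron power_mult_distrib mult_ac)
qed

text \<open>
  A representative of the orbit of \<open>\<epsilon> D + e\<^sub>1\<^sub>1\<^sub>1 + e\<^sub>2\<^sub>2\<^sub>2\<close> at which none of the covariants vanishes.
\<close>

definition base :: "complex \<Rightarrow> tensor" where
  "base e = e \<cdot>\<^sub>T tensor_D + tensor_prod (vector [2,1,0]) (vector [2,1,0]) (vector [2,1,0]) + ee 1 1 1"

lemma base_nth: "base e$i$j$k = e * tensor_D$i$j$k + (if i = 3 \<or> j = 3 \<or> k = 3 then 0 else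
    (if i = 1 then 2 else 1) * (if j = 1 then 2 else 1) * (if k = 1 then 2 else 1)) + (if i = 1 \<and> j = 1 \<and> k = 1 then 1 else 0)"
  using exhaust_3[of i] exhaust_3[of j] exhaust_3[of k]
  by (elim disjE; simp add: base_def tensor_scale_def tensor_prod_def ee_def axis_def)

lemma base_swap: "swap12 (base e) = base (- e)" "swap13 (base e) = base (- e)"
proof -
  have "swap12 (base e)$i$j$k = base (- e)$i$j$k \<and> swap13 (base e)$i$j$k = base (- e)$i$j$k" for i j k
    using exhaust_3[of i] exhaust_3[of j] exhaust_3[of k]
    by (elim disjE; simp add: base_nth tensor_D_nth)
  then show "swap12 (base e) = base (- e)" "swap13 (base e) = base (- e)"
    by (intro tensor_eqI; blast)+
qed

lemma base_nonzero: "base e \<noteq> 0"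
proof
  assume "base e = 0"
  then have "base e$1$1$1 = 0" by simp
  then show False by (simp add: base_nth tensor_D_nth)
qed

lemma det_nonzero_ker:
  fixes A :: "'a::field^'n^'n"
  assumes "\<And>x. A *v x = 0 \<Longrightarrow> x = 0"
  shows "det A \<noteq> 0"
  using assms by (metis invertible_det_nz invertible_left_inverse matrix_left_invertible_ker)

text \<open>The nine equations for a kernel vector are sparse enough to be solved one after another,
  which replaces the expansion of the determinant. The diagonal unknowns appear through their
  pairwise sums.\<close>

lemma koszul_base:
  assumes "e = 1 \<or> e = - 1"
  shows "det (koszul (base e)) \<noteq> 0"
proof (rule det_nonzero_ker)
  fix x assume "koszul (base e) *v x = 0"
  then have eq: "(\<Sum>s\<in>UNIV. \<Sum>b\<in>UNIV. (\<Sum>a\<in>UNIV. tensor_D$r$s$a * base e$a$b$c) * x$(s, b)) = 0" for r c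
    by (simp add: vec_eq_iff matrix_vector_mult_def sum_pairs koszul_def)
  have e: "e \<noteq> 0" using assms by auto
  note [simp] = sum_3 base_nth tensor_D_nth
  have 1: "x$(3,1) = 0" "x$(3,2) = 0" using eq[of 1 3] eq[of 2 3] e by simp_all
  have 2: "x$(2,1) = 0" "x$(1,2) = 0" using eq[of 1 2] eq[of 2 1] e 1 by simp_all
  have 3: "x$(2,2) + x$(3,3) = 0" "x$(1,1) + x$(3,3) = 0" "x$(1,1) + x$(2,2) = 0"
    using eq[of 1 1] eq[of 2 2] eq[of 3 3] assms 1 2 by (auto simp: algebra_simps)
  have "x$(1,1) = (x$(1,1) + x$(3,3) + (x$(1,1) + x$(2,2)) - (x$(2,2) + x$(3,3))) / 2" by simp
  then have 4: "x$(1,1) = 0" unfolding 3 by simp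
  then have 5: "x$(2,2) = 0" "x$(3,3) = 0" using 3 by simp_all
  have 6: "x$(1,3) = 0" "x$(2,3) = 0" using eq[of 3 1] eq[of 3 2] e 1 2 4 5 by simp_all
  have "x$(i, j) = 0" for i j
    using exhaust_3[of i] exhaust_3[of j] 1 2 4 5 6 by (elim disjE) simp_all
  then show "x = 0" by (simp add: vec_eq_iff)
qed

lemma continuous_covariants:
  "continuous_on UNIV cov_100_100_100" "continuous_on UNIV cov_200_110_110" "continuous_on UNIV cov_300_111_111"
  "continuous_on UNIV cov_210_210_111" "continuous_on UNIV cov_310_220_211" "continuous_on UNIV cov_411_330_222"
  "continuous_on UNIV cov_411_411_330" "continuous_on UNIV cov_330_330_222" "continuous_on UNIV cov_220_220_220"
  "continuous_on UNIV cov_660_444_444" "continuous_on UNIV cov_333_333_333"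
  unfolding cov_100_100_100_def cov_200_110_110_def cov_300_111_111_def cov_210_210_111_def cov_310_220_211_def
    cov_411_330_222_def cov_411_411_330_def cov_330_330_222_def cov_220_220_220_def cov_660_444_444_def
    cov_333_333_333_def cubic_disc_def det_def koszul_def br2_def br3_def vec3_nth vec_lambda_beta
  by (intro continuous_intros)+

text \<open>A transposition of the factors exchanges \<open>base 1\<close> and
  \<open>base (- 1)\<close>. Asking for both makes the condition stable under permutations, so each
  covariant yields all permutations of its weight.\<close>

definition dominated_at_base :: "(real^3) \<times> (real^3) \<times> (real^3) \<Rightarrow> bool" where
  "dominated_at_base = (\<lambda>(a, b, c). log_dominated (base 1) a b c \<and> log_dominated (base (- 1)) a b c)"

lemma dominated_at_base_covariant:
  assumes "semi1 F a1 a2 a3" "semi2 F b1 b2 b3" "semi3 F c1 c2 c3" "continuous_on UNIV F"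
    and "F (base 1) \<noteq> 0" "F (base (- 1)) \<noteq> 0"
  shows "dominated_at_base (vector [real a1, real a2, real a3], vector [real b1, real b2, real b3], vector [real c1, real c2, real c3])"
  using log_dominated_covariant[OF assms(1-4)] assms(5,6) base_nonzero by (simp add: dominated_at_base_def)

lemma dominated_at_base_rays:
  "dominated_at_base (vector [1,0,0], vector [1,0,0], vector [1,0,0])"
  "dominated_at_base (vector [2,2,0], vector [2,2,0], vector [2,2,0])"
  "dominated_at_base (vector [3,3,3], vector [3,3,3], vector [3,3,3])"
  "dominated_at_base (vector [2,0,0], vector [1,1,0], vector [1,1,0])"
  "dominated_at_base (vector [2,1,0], vector [2,1,0], vector [1,1,1])"
  "dominated_at_base (vector [3,0,0], vector [1,1,1], vector [1,1,1])"
  "dominated_at_base (vector [3,1,0], vector [2,2,0], vector [2,1,1])"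
  "dominated_at_base (vector [6,6,0], vector [4,4,4], vector [4,4,4])"
  "dominated_at_base (vector [3,3,0], vector [3,3,0], vector [2,2,2])"
  "dominated_at_base (vector [4,1,1], vector [3,3,0], vector [2,2,2])"
  "dominated_at_base (vector [4,1,1], vector [4,1,1], vector [3,3,0])"
proof -
  note eval = base_nth tensor_D_nth br2_def br3_def
  show "dominated_at_base (vector [1,0,0], vector [1,0,0], vector [1,0,0])"
    using dominated_at_base_covariant[OF semi_111 continuous_covariants(1)] by (simp add: cov_100_100_100_def eval)
  show "dominated_at_base (vector [2,2,0], vector [2,2,0], vector [2,2,0])"
    using dominated_at_base_covariant[OF semi_220 continuous_covariants(9)] by (simp add: cov_220_220_220_def eval)
  show "dominated_at_base (vector [3,3,3], vector [3,3,3], vector [3,3,3])"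
    using dominated_at_base_covariant[OF semi_333 continuous_covariants(11)] by (simp add: cov_333_333_333_def koszul_base)
  show "dominated_at_base (vector [2,0,0], vector [1,1,0], vector [1,1,0])"
    using dominated_at_base_covariant[OF semi_200 continuous_covariants(2)] by (simp add: cov_200_110_110_def eval)
  show "dominated_at_base (vector [2,1,0], vector [2,1,0], vector [1,1,1])"
    using dominated_at_base_covariant[OF semi_210 continuous_covariants(4)] by (simp add: cov_210_210_111_def eval)
  show "dominated_at_base (vector [3,0,0], vector [1,1,1], vector [1,1,1])"
    using dominated_at_base_covariant[OF semi_300 continuous_covariants(3)] by (simp add: cov_300_111_111_def eval)
  show "dominated_at_base (vector [3,1,0], vector [2,2,0], vector [2,1,1])"
    using dominated_at_base_covariant[OF semi_310 continuous_covariants(5)] by (simp add: cov_310_220_211_def eval)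
  show "dominated_at_base (vector [6,6,0], vector [4,4,4], vector [4,4,4])"
    using dominated_at_base_covariant[OF semi_660 continuous_covariants(10)] by (simp add: cov_660_444_444_def cubic_disc_def eval)
  show "dominated_at_base (vector [3,3,0], vector [3,3,0], vector [2,2,2])"
    using dominated_at_base_covariant[OF semi_330 continuous_covariants(8)] by (simp add: cov_330_330_222_def eval)
  show "dominated_at_base (vector [4,1,1], vector [3,3,0], vector [2,2,2])"
    using dominated_at_base_covariant[OF semi_411_330 continuous_covariants(6)] by (simp add: cov_411_330_222_def eval)
  show "dominated_at_base (vector [4,1,1], vector [4,1,1], vector [3,3,0])"
    using dominated_at_base_covariant[OF semi_411_411 continuous_covariants(7)] by (simp add: cov_411_411_330_def eval)
qed

section \<open>The convex cone of dominated weights and its symmetries\<close>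

lemma log_dominated_add:
  assumes "log_dominated T a b c" "log_dominated T a' b' c'"
  shows "log_dominated T (a + a') (b + b') (c + c')"
proof -
  obtain K K' where *: "\<And>A B C. lower_tri A \<Longrightarrow> lower_tri B \<Longrightarrow> lower_tri C \<Longrightarrow>
    log_char a A + log_char b B + log_char c C \<le> (\<Sum>i\<in>UNIV. a$i) * ln (norm (tensor_act A B C T)) + K"
    "\<And>A B C. lower_tri A \<Longrightarrow> lower_tri B \<Longrightarrow> lower_tri C \<Longrightarrow>
    log_char a' A + log_char b' B + log_char c' C \<le> (\<Sum>i\<in>UNIV. a'$i) * ln (norm (tensor_act A B C T)) + K'"
    using assms unfolding log_dominated_def by blast
  have add: "log_char (x + y) A = log_char x A + log_char y A" for x y A
    by (simp add: log_char_def sum.distrib distrib_right)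
  have "log_char (a + a') A + log_char (b + b') B + log_char (c + c') C \<le>
      (\<Sum>i\<in>UNIV. (a + a')$i) * ln (norm (tensor_act A B C T)) + (K + K')"
    if "lower_tri A" "lower_tri B" "lower_tri C" for A B C
    using *(1)[OF that] *(2)[OF that] by (simp add: add sum.distrib distrib_right)
  then show ?thesis unfolding log_dominated_def by blast
qed

text \<open>The degree stands in front of the logarithm of the norm, so the estimate is homogeneous
  in the weights. This allows covariants of different degrees to be combined before the sums are
  normalised to 1.\<close>

lemma log_dominated_scaleR:
  assumes "log_dominated T a b c" "0 \<le> t"
  shows "log_dominated T (t *\<^sub>R a) (t *\<^sub>R b) (t *\<^sub>R c)"
proof -
  obtain K where *: "\<And>A B C. lower_tri A \<Longrightarrow> lower_tri B \<Longrightarrow> lower_tri C \<Longrightarrow>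
    log_char a A + log_char b B + log_char c C \<le> (\<Sum>i\<in>UNIV. a$i) * ln (norm (tensor_act A B C T)) + K"
    using assms unfolding log_dominated_def by blast
  have scale: "log_char (t *\<^sub>R x) A = t * log_char x A" for x A
    by (simp add: log_char_def sum_distrib_left mult.assoc)
  have "log_char (t *\<^sub>R a) A + log_char (t *\<^sub>R b) B + log_char (t *\<^sub>R c) C \<le>
      (\<Sum>i\<in>UNIV. (t *\<^sub>R a)$i) * ln (norm (tensor_act A B C T)) + t * K"
    if "lower_tri A" "lower_tri B" "lower_tri C" for A B C
    using mult_left_mono[OF *[OF that] assms(2)] by (simp add: scale algebra_simps flip: sum_distrib_left)
  then show ?thesis unfolding log_dominated_def by blast
qed

text \<open>The definition reads the degree off the first weight; the hypothesis on the sums lets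
  the second weight take over this role.\<close>

lemma log_dominated_swap12:
  assumes "log_dominated T a b c" "(\<Sum>i\<in>UNIV. a$i) = (\<Sum>i\<in>UNIV. b$i)"
  shows "log_dominated (swap12 T) b a c"
proof -
  obtain K where *: "\<And>A B C. lower_tri A \<Longrightarrow> lower_tri B \<Longrightarrow> lower_tri C \<Longrightarrow>
    log_char a A + log_char b B + log_char c C \<le> (\<Sum>i\<in>UNIV. a$i) * ln (norm (tensor_act A B C T)) + K"
    using assms unfolding log_dominated_def by blast
  have "log_char b A + log_char a B + log_char c C \<le> (\<Sum>i\<in>UNIV. b$i) * ln (norm (tensor_act A B C (swap12 T))) + K"
    if "lower_tri A" "lower_tri B" "lower_tri C" for A B C
    using *[OF that(2,1,3)] assms(2) by (simp add: tensor_act_swap12)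
  then show ?thesis unfolding log_dominated_def by blast
qed

lemma log_dominated_swap13:
  assumes "log_dominated T a b c" "(\<Sum>i\<in>UNIV. a$i) = (\<Sum>i\<in>UNIV. c$i)"
  shows "log_dominated (swap13 T) c b a"
proof -
  obtain K where *: "\<And>A B C. lower_tri A \<Longrightarrow> lower_tri B \<Longrightarrow> lower_tri C \<Longrightarrow>
    log_char a A + log_char b B + log_char c C \<le> (\<Sum>i\<in>UNIV. a$i) * ln (norm (tensor_act A B C T)) + K"
    using assms unfolding log_dominated_def by blast
  have "log_char c A + log_char b B + log_char a C \<le> (\<Sum>i\<in>UNIV. c$i) * ln (norm (tensor_act A B C (swap13 T))) + K"
    if "lower_tri A" "lower_tri B" "lower_tri C" for A B C
    using *[OF that(3,2,1)] assms(2) by (simp add: tensor_act_swap13)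
  then show ?thesis unfolding log_dominated_def by blast
qed

section \<open>Inequalities for the spectra of the marginals\<close>

definition cdot :: "complex^3 \<Rightarrow> complex^3 \<Rightarrow> complex" where
  "cdot x y = (\<Sum>i\<in>UNIV. x$i * y$i)"

definition cnj_vec :: "complex^3 \<Rightarrow> complex^3" where
  "cnj_vec x = (\<chi> i. cnj (x$i))"

text \<open>The Rayleigh quotient of the diagonal matrix with entries a at a unit vector; for a
  standard tensor it is the squared norm of the slice in direction x.\<close>

definition occupation :: "complex^3 \<Rightarrow> real^3 \<Rightarrow> real" where
  "occupation x a = (\<Sum>l\<in>UNIV. (cmod (x$l))\<^sup>2 * a$l)"

definition orthonormal :: "complex^3 \<Rightarrow> complex^3 \<Rightarrow> complex^3 \<Rightarrow> bool" where
  "orthonormal u v w \<longleftrightarrow> cdot u (cnj_vec u) = 1 \<and> cdot v (cnj_vec v) = 1 \<and> cdot w (cnj_vec w) = 1 \<and>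
    cdot u (cnj_vec v) = 0 \<and> cdot u (cnj_vec w) = 0 \<and> cdot v (cnj_vec w) = 0"

lemma cdot_cnj_vec_commute: "cdot x (cnj_vec y) = cnj (cdot y (cnj_vec x))"
  by (simp add: cdot_def cnj_vec_def mult.commute)

lemma cdot_cnj_eq_0: "cdot x (cnj_vec y) = 0 \<longleftrightarrow> cdot y (cnj_vec x) = 0"
  by (metis cdot_cnj_vec_commute complex_cnj_zero_iff)

lemma orthonormal_unitary: "orthonormal u v w \<longleftrightarrow> unitary (vector [u, v, w])"
proof -
  have "cdot x (cnj_vec y) = (\<Sum>a\<in>UNIV. x$a * cnj (y$a))" for x y
    by (simp add: cdot_def cnj_vec_def)
  then show ?thesis
    unfolding unitary_rows orthonormal_def
    by (simp add: forall_3 flip: cdot_def) (metis cdot_cnj_eq_0 cdot_cnj_vec_commute)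
qed

lemma norm_cnj_vec: "cdot z (cnj_vec z) = of_real ((norm z)\<^sup>2)"
  by (simp add: cdot_def cnj_vec_def norm_vec_def L2_set_def sum_nonneg complex_norm_square del: of_real_power)

lemma det_zero_unit_kernel:
  assumes "det (M::complex^3^3) = 0"
  obtains z where "cdot z (cnj_vec z) = 1" "\<And>j. (\<Sum>k\<in>UNIV. M$j$k * z$k) = 0"
proof -
  obtain z where z: "M *v z = 0" "z \<noteq> 0" using assms det_nonzero_ker by blast
  define u where "u = (1 / norm z) *\<^sub>R z"
  have "norm u = 1" using z(2) by (simp add: u_def)
  moreover have "(\<Sum>k\<in>UNIV. M$j$k * u$k) = 0" for j
    using arg_cong[OF z(1), of "\<lambda>v. v$j"] by (simp add: u_def matrix_vector_mult_def flip: scaleR_sum_right)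
  ultimately show thesis using that[of u] by (simp add: norm_cnj_vec)
qed

text \<open>Two linear conditions on three unknowns. As \<open>cdot\<close> is bilinear, a condition
  can be orthogonality to u (with \<open>cnj_vec u\<close> as argument) or the vanishing of a
  trilinear coefficient (with a contraction of the tensor); nearly all basis vectors below arise
  this way.\<close>

lemma exists_annihilator: "\<exists>z. cdot z (cnj_vec z) = 1 \<and> cdot z x = 0 \<and> cdot z y = 0"
proof -
  define M :: "complex^3^3" where "M = vector [x, y, 0]"
  have "det M = 0" by (simp add: M_def det_3)
  then obtain z where z: "cdot z (cnj_vec z) = 1" "\<And>j. (\<Sum>k\<in>UNIV. M$j$k * z$k) = 0"
    by (rule det_zero_unit_kernel) blast
  have "cdot z x = 0" "cdot z y = 0"
    using z(2)[of 1] z(2)[of 2] by (simp_all add: M_def cdot_def mult.commute)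
  then show ?thesis using z(1) by blast
qed

lemma orthonormal_completion:
  assumes "cdot u (cnj_vec u) = 1" "cdot v (cnj_vec v) = 1" "cdot v (cnj_vec u) = 0"
  obtains w where "orthonormal u v w"
  using exists_annihilator[of "cnj_vec u" "cnj_vec v"] assms cdot_cnj_eq_0 unfolding orthonormal_def by metis

lemma orthonormal_rotate: "orthonormal u v w \<Longrightarrow> orthonormal v w u" "orthonormal u v w \<Longrightarrow> orthonormal v u w"
  unfolding orthonormal_def using cdot_cnj_eq_0 by metis+

abbreviation "ax i \<equiv> axis i 1"

lemma cdot_axis: "cdot x (cnj_vec (ax i)) = x$i" "cdot (ax i) x = x$i"
  by (simp_all add: cdot_def cnj_vec_def axis_def mult_delta_left mult_delta_right if_distrib[of cnj] sum.delta cong: if_cong)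

lemma orthonormal_axis: "orthonormal (ax 1) (ax 2) (ax 3)"
  by (simp add: orthonormal_def cdot_axis) (simp add: axis_def)

lemma occupation_axis: "occupation (ax i) a = a$i"
  by (simp add: occupation_def axis_def if_distrib[of cmod] if_distrib[of "\<lambda>x. x\<^sup>2"] mult_delta_left sum.delta cong: if_cong)

lemma unit_occupation:
  assumes "cdot u (cnj_vec u) = 1" shows "(cmod (u$1))\<^sup>2 + (cmod (u$2))\<^sup>2 + (cmod (u$3))\<^sup>2 = 1"
proof -
  have "complex_of_real ((cmod (u$1))\<^sup>2 + (cmod (u$2))\<^sup>2 + (cmod (u$3))\<^sup>2) = 1"
    using assms by (simp add: cdot_def cnj_vec_def sum_3 complex_norm_square del: of_real_power)
  then show ?thesis by (simp only: of_real_eq_1_iff)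
qed

lemma occupation_bounds:
  assumes a: "descending a" and u: "cdot u (cnj_vec u) = 1"
  shows "a$3 \<le> occupation u a" "occupation u a \<le> a$1" "u$1 = 0 \<Longrightarrow> occupation u a \<le> a$2" "u$3 = 0 \<Longrightarrow> a$2 \<le> occupation u a"
proof -
  define p q r where "p = (cmod (u$1))\<^sup>2" and "q = (cmod (u$2))\<^sup>2" and "r = (cmod (u$3))\<^sup>2"
  have nn: "0 \<le> p" "0 \<le> q" "0 \<le> r" and 1: "p + q + r = 1"
    using unit_occupation[OF u] by (simp_all add: p_def q_def r_def)
  have o: "occupation u a = p * a$1 + q * a$2 + r * a$3" by (simp add: occupation_def sum_3 p_def q_def r_def)
  have d: "a$1 \<ge> a$2" "a$2 \<ge> a$3" using a by (simp_all add: descending_def)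
  have split: "x = p * x + q * x + r * x" for x :: real using 1 by (metis distrib_right mult_1)
  have l: "p * a$3 \<le> p * a$1" "q * a$3 \<le> q * a$2" "p * a$2 \<le> p * a$1" "q * a$2 \<le> q * a$1" "r * a$3 \<le> r * a$1" "r * a$3 \<le> r * a$2"
    using nn d by (auto intro!: mult_left_mono)
  show "a$3 \<le> occupation u a" "occupation u a \<le> a$1"
    using o l split[of "a$3"] split[of "a$1"] by linarith+
  show "occupation u a \<le> a$2" if "u$1 = 0"
    using o l split[of "a$2"] that by (simp add: p_def)
  show "a$2 \<le> occupation u a" if "u$3 = 0"
    using o l split[of "a$2"] that by (simp add: r_def)
qed

lemma occupation_sum:
  assumes "orthonormal u v w"
  shows "occupation u a + occupation v a + occupation w a = a$1 + a$2 + a$3"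
proof -
  define U where "U = (vector [u, v, w] :: complex^3^3)"
  have U: "unitary U" using assms by (simp add: U_def orthonormal_unitary)
  have "(cmod (u$l))\<^sup>2 + (cmod (v$l))\<^sup>2 + (cmod (w$l))\<^sup>2 = 1" for l
  proof -
    have "complex_of_real ((cmod (u$l))\<^sup>2 + (cmod (v$l))\<^sup>2 + (cmod (w$l))\<^sup>2) = 1"
      using unitary_columns[OF U, of l l] by (simp add: U_def sum_3 complex_norm_square mult.commute del: of_real_power)
    then show ?thesis by (simp only: of_real_eq_1_iff)
  qed
  then have "(cmod (u$l))\<^sup>2 * x + (cmod (v$l))\<^sup>2 * x + (cmod (w$l))\<^sup>2 * x = x" for l x
    by (metis distrib_right mult_1)
  from this[of 1 "a$1"] this[of 2 "a$2"] this[of 3 "a$3"] show ?thesis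
    by (simp add: occupation_def sum_3)
qed

definition contract1 :: "tensor \<Rightarrow> complex^3 \<Rightarrow> complex^3 \<Rightarrow> complex^3" where
  "contract1 S y z = (\<chi> a. \<Sum>b\<in>UNIV. y$b * (\<Sum>c\<in>UNIV. z$c * S$a$b$c))"

definition contract2 :: "tensor \<Rightarrow> complex^3 \<Rightarrow> complex^3 \<Rightarrow> complex^3" where
  "contract2 S x z = contract1 (swap12 S) x z"

definition contract3 :: "tensor \<Rightarrow> complex^3 \<Rightarrow> complex^3 \<Rightarrow> complex^3" where
  "contract3 S x y = contract1 (swap13 S) y x"

definition trilinear :: "tensor \<Rightarrow> complex^3 \<Rightarrow> complex^3 \<Rightarrow> complex^3 \<Rightarrow> complex" where
  "trilinear S x y z = (\<Sum>a\<in>UNIV. x$a * (\<Sum>b\<in>UNIV. y$b * (\<Sum>c\<in>UNIV. z$c * S$a$b$c)))"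

lemma trilinear_contract:
  "trilinear S x y z = cdot x (contract1 S y z)" "trilinear S x y z = cdot y (contract2 S x z)" "trilinear S x y z = cdot z (contract3 S x y)"
  by (simp_all add: trilinear_def cdot_def contract1_def contract2_def contract3_def sum_3 algebra_simps)

lemma marginal_weights:
  assumes S: "standard S a b c" and U: "unitary A" "unitary B" "unitary C"
  shows "(\<Sum>j\<in>UNIV. \<Sum>k\<in>UNIV. (cmod (trilinear S (A$i) (B$j) (C$k)))\<^sup>2) = occupation (A$i) a"
    "(\<Sum>i\<in>UNIV. \<Sum>k\<in>UNIV. (cmod (trilinear S (A$i) (B$j) (C$k)))\<^sup>2) = occupation (B$j) b"
    "(\<Sum>i\<in>UNIV. \<Sum>j\<in>UNIV. (cmod (trilinear S (A$i) (B$j) (C$k)))\<^sup>2) = occupation (C$k) c"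
proof -
  have diag_conj: "(map_matrix cnj A ** diag d ** transpose A)$i$i = of_real (occupation (A$i) d)" for A i d
    by (simp add: matrix_matrix_mult_def diag_nth transpose_def occupation_def mult_delta_right sum.delta complex_norm_square mult_ac
        del: of_real_power)
  have re: "marg1 T$i$i = of_real (\<Sum>j\<in>UNIV. \<Sum>k\<in>UNIV. (cmod (T$i$j$k))\<^sup>2)" for T i
    by (simp add: marg1_nth complex_norm_square mult.commute del: of_real_power)
  have t: "trilinear S (A$i) (B$j) (C$k) = tensor_act A B C S$i$j$k" for i j k
    by (simp add: tensor_act_nth trilinear_def)
  have m: "marg1 S = diag a" "marg2 S = diag b" "marg3 S = diag c" using S by (auto simp: standard_def)
  show "(\<Sum>j\<in>UNIV. \<Sum>k\<in>UNIV. (cmod (trilinear S (A$i) (B$j) (C$k)))\<^sup>2) = occupation (A$i) a"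
    using re[of "tensor_act A B C S" i] marg1_tensor_act[OF U(2,3), of A S] diag_conj[of A a i]
    unfolding t m by (simp only: of_real_eq_iff)
  show "(\<Sum>i\<in>UNIV. \<Sum>k\<in>UNIV. (cmod (trilinear S (A$i) (B$j) (C$k)))\<^sup>2) = occupation (B$j) b"
    using re[of "swap12 (tensor_act A B C S)" j] marg2_tensor_act[OF U(1,3), of B S] diag_conj[of B b j]
    unfolding t m by (simp only: of_real_eq_iff swap_nth)
  show "(\<Sum>i\<in>UNIV. \<Sum>j\<in>UNIV. (cmod (trilinear S (A$i) (B$j) (C$k)))\<^sup>2) = occupation (C$k) c"
    using re[of "swap13 (tensor_act A B C S)" k] marg3_tensor_act[OF U(1,2), of C S] diag_conj[of C c k]
    unfolding t m swap_nth by (subst sum.swap) (simp only: of_real_eq_iff)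
qed

text \<open>
  All inequalities for the spectra come from this one: bases are chosen such that the coefficients
  of negative weight vanish.
\<close>

lemma weighted_occupation_nonneg:
  assumes S: "standard S a b c" and on: "orthonormal e1 e2 e3" "orthonormal f1 f2 f3" "orthonormal g1 g2 g3"
    and zero: "\<forall>i j k. (vector [x1,x2,x3] :: real^3)$i + (vector [y1,y2,y3] :: real^3)$j + (vector [z1,z2,z3] :: real^3)$k < 0 \<longrightarrow>
      trilinear S ((vector [e1,e2,e3] :: complex^3^3)$i) ((vector [f1,f2,f3] :: complex^3^3)$j) ((vector [g1,g2,g3] :: complex^3^3)$k) = 0"
  shows "0 \<le> x1 * occupation e1 a + x2 * occupation e2 a + x3 * occupation e3 a + (y1 * occupation f1 b + y2 * occupation f2 b + y3 * occupation f3 b)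
    + (z1 * occupation g1 c + z2 * occupation g2 c + z3 * occupation g3 c)"
proof -
  define A B C where "A = (vector [e1,e2,e3] :: complex^3^3)" and "B = (vector [f1,f2,f3] :: complex^3^3)"
    and "C = (vector [g1,g2,g3] :: complex^3^3)"
  define x y z where "x = (vector [x1,x2,x3] :: real^3)" and "y = (vector [y1,y2,y3] :: real^3)"
    and "z = (vector [z1,z2,z3] :: real^3)"
  define w where "w i j k = (cmod (trilinear S (A$i) (B$j) (C$k)))\<^sup>2" for i j k
  have U: "unitary A" "unitary B" "unitary C" using on by (simp_all add: A_def B_def C_def orthonormal_unitary)
  note m = marginal_weights[OF S U, folded w_def]
  have "0 \<le> (x$i + y$j + z$k) * w i j k" for i j k
    using zero[rule_format, of i j k] unfolding A_def[symmetric] B_def[symmetric] C_def[symmetric] x_def[symmetric] y_def[symmetric] z_def[symmetric]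
    by (cases "x$i + y$j + z$k < 0") (simp_all add: w_def)
  then have "0 \<le> (\<Sum>i\<in>UNIV. \<Sum>j\<in>UNIV. \<Sum>k\<in>UNIV. (x$i + y$j + z$k) * w i j k)"
    by (simp add: sum_nonneg)
  also have "\<dots> = (\<Sum>i\<in>UNIV. x$i * (\<Sum>j\<in>UNIV. \<Sum>k\<in>UNIV. w i j k)) + (\<Sum>j\<in>UNIV. y$j * (\<Sum>i\<in>UNIV. \<Sum>k\<in>UNIV. w i j k))
      + (\<Sum>k\<in>UNIV. z$k * (\<Sum>i\<in>UNIV. \<Sum>j\<in>UNIV. w i j k))"
    unfolding sum_3 by (simp only: distrib_left distrib_right)
  finally show ?thesis
    unfolding m by (simp add: sum_3 A_def B_def C_def x_def y_def z_def)
qed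

lemma standard_descending: "standard S a b c \<Longrightarrow> descending a \<and> descending b \<and> descending c"
  by (simp add: standard_def)

lemma orthonormal_axis_nth: "orthonormal (ax i) u v \<Longrightarrow> u$i = 0 \<and> v$i = 0"
  unfolding orthonormal_def by (metis cdot_axis(1) cdot_cnj_eq_0)

lemma orthonormal_unit: "orthonormal u v w \<Longrightarrow> cdot u (cnj_vec u) = 1 \<and> cdot v (cnj_vec v) = 1 \<and> cdot w (cnj_vec w) = 1"
  by (simp add: orthonormal_def)

lemma axis_unit: "cdot (ax i) (cnj_vec (ax i)) = 1"
  by (simp add: cdot_axis)

lemma cdot_axis_right: "cdot x (ax i) = x$i"
  by (simp add: cdot_def axis_def mult_delta_right sum.delta)

text \<open>Vanishing on two axes passes to their whole plane, which leaves the basis of the plane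
  free to meet further conditions.\<close>

lemma trilinear_span: "trilinear S (ax 1) y z = 0 \<Longrightarrow> trilinear S (ax 2) y z = 0 \<Longrightarrow> x$3 = 0 \<Longrightarrow> trilinear S x y z = 0"
  by (simp add: trilinear_contract(1) cdot_axis) (simp add: cdot_def sum_3)

text \<open>The test weights (0,-1,-1), (0,1,1), (0,1,1) are negative only at (2,1,1) and (3,1,1),
  so \<open>e2\<close> and \<open>e3\<close> are taken in the annihilator of S(.,1,1). The trace
  replaces their occupations by that of \<open>e1\<close>, which is at most a_1. The following six
  proofs have the same shape.\<close>

lemma kronecker_ineq1:
  assumes S: "standard S a b c"
  shows "a$2 + a$3 \<le> (b$2 + b$3) + (c$2 + c$3)"
proof -
  define t where "t = contract1 S (ax 1) (ax 1)"
  obtain e2 where e2: "cdot e2 (cnj_vec e2) = 1" "cdot e2 t = 0" using exists_annihilator[of t t] by blast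
  obtain e3 where e3: "cdot e3 (cnj_vec e3) = 1" "cdot e3 t = 0" "cdot e3 (cnj_vec e2) = 0"
    using exists_annihilator[of t "cnj_vec e2"] by blast
  obtain e1 where "orthonormal e2 e3 e1" using orthonormal_completion[OF e2(1) e3(1,3)] by blast
  then have on: "orthonormal e1 e2 e3" by (meson orthonormal_rotate)
  have "trilinear S e2 (ax 1) (ax 1) = 0" "trilinear S e3 (ax 1) (ax 1) = 0"
    using e2 e3 by (simp_all add: trilinear_contract(1) t_def)
  then have "0 \<le> 0 * occupation e1 a + (-1) * occupation e2 a + (-1) * occupation e3 a
      + (0 * occupation (ax 1) b + 1 * occupation (ax 2) b + 1 * occupation (ax 3) b) + (0 * occupation (ax 1) c + 1 * occupation (ax 2) c + 1 * occupation (ax 3) c)"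
    by (intro weighted_occupation_nonneg[OF S on orthonormal_axis orthonormal_axis]) (simp add: forall_3)
  then show ?thesis
    using occupation_sum[OF on, of a] occupation_bounds(2)[of a e1] standard_descending[OF S] orthonormal_unit[OF on]
    by (simp add: occupation_axis)
qed

text \<open>Zeros are needed at (1,1,2) and (3,1,2). The final estimate requires occupation at least
  c_2 for \<open>g2\<close> and at most a_2 for \<open>e2\<close>; so \<open>g2\<close> is confined
  to the first two axes and \<open>e2\<close> is orthogonal to the first axis.\<close>

lemma kronecker_ineq2:
  assumes S: "standard S a b c"
  shows "a$1 + a$3 \<le> (b$2 + b$3) + (c$1 + c$3)"
proof -
  obtain g2 where g2: "cdot g2 (cnj_vec g2) = 1" "cdot g2 (ax 3) = 0" "cdot g2 (contract3 S (ax 1) (ax 1)) = 0"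
    using exists_annihilator by blast
  obtain g3 where g3: "cdot g3 (cnj_vec g3) = 1" "cdot g3 (cnj_vec g2) = 0" using exists_annihilator by blast
  obtain g1 where "orthonormal g2 g3 g1" using orthonormal_completion[OF g2(1) g3] by blast
  then have g: "orthonormal g1 g2 g3" by (meson orthonormal_rotate)
  obtain e3 where e3: "cdot e3 (cnj_vec e3) = 1" "cdot e3 (cnj_vec (ax 1)) = 0" "cdot e3 (contract1 S (ax 1) g2) = 0"
    using exists_annihilator by blast
  obtain e2 where "orthonormal (ax 1) e3 e2" using orthonormal_completion[OF axis_unit e3(1,2)] by blast
  then have e: "orthonormal (ax 1) e2 e3"
    by (meson orthonormal_rotate)
  have "trilinear S (ax 1) (ax 1) g2 = 0" "trilinear S e3 (ax 1) g2 = 0"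
    using g2 e3 by (simp add: trilinear_contract(3), simp add: trilinear_contract(1))
  then have "0 \<le> (-1) * occupation (ax 1) a + 0 * occupation e2 a + (-1) * occupation e3 a
      + (0 * occupation (ax 1) b + 1 * occupation (ax 2) b + 1 * occupation (ax 3) b) + (1 * occupation g1 c + 0 * occupation g2 c + 1 * occupation g3 c)"
    by (intro weighted_occupation_nonneg[OF S e orthonormal_axis g]) (simp add: forall_3)
  then show ?thesis
    using occupation_sum[OF e, of a] occupation_sum[OF g, of c] occupation_bounds(3)[of a e2] occupation_bounds(4)[of c g2] g2(2)
      standard_descending[OF S] orthonormal_unit[OF e] orthonormal_unit[OF g] orthonormal_axis_nth[OF e]
    by (simp add: occupation_axis cdot_axis_right)
qed

lemma kronecker_ineq3:
  assumes S: "standard S a b c"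
  shows "a$1 + a$2 \<le> (b$2 + b$3) + (c$1 + c$2)"
proof -
  obtain g3 where g3: "cdot g3 (cnj_vec g3) = 1" "cdot g3 (contract3 S (ax 1) (ax 1)) = 0" "cdot g3 (contract3 S (ax 2) (ax 1)) = 0"
    using exists_annihilator by blast
  obtain g1 where g1: "cdot g1 (cnj_vec g1) = 1" "cdot g1 (cnj_vec g3) = 0" using exists_annihilator by blast
  obtain g2 where "orthonormal g3 g1 g2" using orthonormal_completion[OF g3(1) g1] by blast
  then have g: "orthonormal g1 g2 g3" by (meson orthonormal_rotate)
  have "trilinear S (ax 1) (ax 1) g3 = 0" "trilinear S (ax 2) (ax 1) g3 = 0"
    using g3 by (simp_all add: trilinear_contract(3))
  then have "0 \<le> (-1) * occupation (ax 1) a + (-1) * occupation (ax 2) a + 0 * occupation (ax 3) a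
      + (0 * occupation (ax 1) b + 1 * occupation (ax 2) b + 1 * occupation (ax 3) b) + (1 * occupation g1 c + 1 * occupation g2 c + 0 * occupation g3 c)"
    by (intro weighted_occupation_nonneg[OF S orthonormal_axis orthonormal_axis g]) (simp add: forall_3)
  then show ?thesis
    using occupation_sum[OF g, of c] occupation_bounds(1)[of c g3] standard_descending[OF S] orthonormal_unit[OF g]
    by (simp add: occupation_axis)
qed

lemma axis_completion:
  obtains f2 f3 where "orthonormal (ax 1) f2 f3" "cdot f3 t = 0"
proof -
  obtain f3 where f3: "cdot f3 (cnj_vec f3) = 1" "cdot f3 (cnj_vec (ax 1)) = 0" "cdot f3 t = 0"
    using exists_annihilator by blast
  obtain f2 where "orthonormal (ax 1) f3 f2" using orthonormal_completion[OF axis_unit f3(1,2)] by blast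
  then have "orthonormal (ax 1) f2 f3" by (meson orthonormal_rotate)
  then show thesis using that f3 by blast
qed

text \<open>Zeros are needed at (2,1,1), (3,1,1), (2,3,1) and (2,1,3). The conditions on
  \<open>f3\<close> and \<open>g3\<close> refer to \<open>e2\<close>, which is therefore fixed
  first, within the first two axes so that its occupation is at least a_2.\<close>

lemma kronecker_ineq4:
  assumes S: "standard S a b c"
  shows "2 * a$2 + a$3 \<le> (2 * b$2 + b$3) + (2 * c$2 + c$3)"
proof -
  obtain e2 where e2: "cdot e2 (cnj_vec e2) = 1" "cdot e2 (contract1 S (ax 1) (ax 1)) = 0" "cdot e2 (ax 3) = 0"
    using exists_annihilator by blast
  obtain e3 where e3: "cdot e3 (cnj_vec e3) = 1" "cdot e3 (contract1 S (ax 1) (ax 1)) = 0" "cdot e3 (cnj_vec e2) = 0"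
    using exists_annihilator by blast
  obtain e1 where "orthonormal e2 e3 e1" using orthonormal_completion[OF e2(1) e3(1,3)] by blast
  then have e: "orthonormal e1 e2 e3" by (meson orthonormal_rotate)
  obtain f2 f3 where f: "orthonormal (ax 1) f2 f3" "cdot f3 (contract2 S e2 (ax 1)) = 0" by (rule axis_completion)
  obtain g2 g3 where g: "orthonormal (ax 1) g2 g3" "cdot g3 (contract3 S e2 (ax 1)) = 0" by (rule axis_completion)
  have "trilinear S e2 (ax 1) (ax 1) = 0" "trilinear S e3 (ax 1) (ax 1) = 0" "trilinear S e2 f3 (ax 1) = 0" "trilinear S e2 (ax 1) g3 = 0"
    using e2 e3 f g by (simp add: trilinear_contract(1), simp add: trilinear_contract(1), simp add: trilinear_contract(2), simp add: trilinear_contract(3))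
  then have "0 \<le> 0 * occupation e1 a + (-2) * occupation e2 a + (-1) * occupation e3 a
      + (0 * occupation (ax 1) b + 2 * occupation f2 b + 1 * occupation f3 b) + (0 * occupation (ax 1) c + 2 * occupation g2 c + 1 * occupation g3 c)"
    by (intro weighted_occupation_nonneg[OF S e f(1) g(1)]) (simp add: forall_3)
  then show ?thesis
    using occupation_sum[OF e, of a] occupation_sum[OF f(1), of b] occupation_sum[OF g(1), of c] occupation_bounds(2)[of a e1] occupation_bounds(4)[of a e2] e2(3)
      occupation_bounds(3)[of b f2] occupation_bounds(3)[of c g2] orthonormal_axis_nth[OF f(1)] orthonormal_axis_nth[OF g(1)]
      standard_descending[OF S] orthonormal_unit[OF e] orthonormal_unit[OF f(1)] orthonormal_unit[OF g(1)]
    by (simp add: occupation_axis cdot_axis_right)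
qed

lemma kronecker_ineq5:
  assumes S: "standard S a b c"
  shows "2 * a$3 + a$2 \<le> (2 * b$2 + b$3) + (2 * c$3 + c$2)"
proof -
  obtain e3 where e3: "cdot e3 (cnj_vec e3) = 1" "cdot e3 (contract1 S (ax 1) (ax 1)) = 0" "cdot e3 (contract1 S (ax 1) (ax 2)) = 0"
    using exists_annihilator by blast
  obtain e2 where e2: "cdot e2 (cnj_vec e2) = 1" "cdot e2 (contract1 S (ax 1) (ax 1)) = 0" "cdot e2 (cnj_vec e3) = 0"
    using exists_annihilator by blast
  obtain e1 where "orthonormal e3 e2 e1" using orthonormal_completion[OF e3(1) e2(1,3)] by blast
  then have e: "orthonormal e1 e2 e3" by (meson orthonormal_rotate)
  obtain f2 f3 where f: "orthonormal (ax 1) f2 f3" "cdot f3 (contract2 S e3 (ax 1)) = 0" by (rule axis_completion)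
  have "trilinear S e2 (ax 1) (ax 1) = 0" "trilinear S e3 (ax 1) (ax 1) = 0" "trilinear S e3 (ax 1) (ax 2) = 0" "trilinear S e3 f3 (ax 1) = 0"
    using e2 e3 f by (simp add: trilinear_contract(1), simp add: trilinear_contract(1), simp add: trilinear_contract(1), simp add: trilinear_contract(2))
  then have "0 \<le> 0 * occupation e1 a + (-1) * occupation e2 a + (-2) * occupation e3 a
      + (0 * occupation (ax 1) b + 2 * occupation f2 b + 1 * occupation f3 b) + (0 * occupation (ax 1) c + 1 * occupation (ax 2) c + 2 * occupation (ax 3) c)"
    by (intro weighted_occupation_nonneg[OF S e f(1) orthonormal_axis]) (simp add: forall_3)
  then show ?thesis
    using occupation_sum[OF e, of a] occupation_sum[OF f(1), of b] occupation_bounds(2)[of a e1] occupation_bounds(1)[of a e3]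
      occupation_bounds(3)[of b f2] orthonormal_axis_nth[OF f(1)]
      standard_descending[OF S] orthonormal_unit[OF e] orthonormal_unit[OF f(1)]
    by (simp add: occupation_axis)
qed

text \<open>Zeros are needed at (1,1,3), (2,1,3), (2,1,1) and (2,3,3). \<open>g3\<close> settles the
  first two for the whole plane of the first two axes, so \<open>e2\<close> can still be turned
  within this plane to achieve the third; \<open>f3\<close> handles the last.\<close>

lemma kronecker_ineq6:
  assumes S: "standard S a b c"
  shows "2 * a$2 + a$1 \<le> (2 * b$2 + b$3) + (2 * c$2 + c$1)"
proof -
  obtain g3 where g3: "cdot g3 (cnj_vec g3) = 1" "cdot g3 (contract3 S (ax 1) (ax 1)) = 0" "cdot g3 (contract3 S (ax 2) (ax 1)) = 0"
    using exists_annihilator by blast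
  obtain g2 where g2: "cdot g2 (cnj_vec g2) = 1" "cdot g2 (ax 1) = 0" "cdot g2 (cnj_vec g3) = 0"
    using exists_annihilator by blast
  obtain g1 where "orthonormal g3 g2 g1" using orthonormal_completion[OF g3(1) g2(1,3)] by blast
  then have g: "orthonormal g1 g2 g3" by (meson orthonormal_rotate)
  obtain e2 where e2: "cdot e2 (cnj_vec e2) = 1" "cdot e2 (cnj_vec (ax 3)) = 0" "cdot e2 (contract1 S (ax 1) g1) = 0"
    using exists_annihilator by blast
  obtain e1 where e': "orthonormal (ax 3) e2 e1" using orthonormal_completion[OF axis_unit e2(1,2)] by blast
  then have e: "orthonormal e1 e2 (ax 3)" by (meson orthonormal_rotate)
  obtain f2 f3 where f: "orthonormal (ax 1) f2 f3" "cdot f3 (contract2 S e2 g3) = 0" by (rule axis_completion)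
  have "trilinear S (ax 1) (ax 1) g3 = 0" "trilinear S (ax 2) (ax 1) g3 = 0"
    using g3 by (simp_all add: trilinear_contract(3))
  then have "trilinear S e1 (ax 1) g3 = 0" "trilinear S e2 (ax 1) g3 = 0"
    using orthonormal_axis_nth[OF e'] by (auto intro: trilinear_span)
  moreover have "trilinear S e2 (ax 1) g1 = 0" "trilinear S e2 f3 g3 = 0"
    using e2 f by (simp add: trilinear_contract(1), simp add: trilinear_contract(2))
  ultimately have "0 \<le> (-1) * occupation e1 a + (-2) * occupation e2 a + 0 * occupation (ax 3) a
      + (0 * occupation (ax 1) b + 2 * occupation f2 b + 1 * occupation f3 b) + (1 * occupation g1 c + 2 * occupation g2 c + 0 * occupation g3 c)"
    by (intro weighted_occupation_nonneg[OF S e f(1) g]) (simp add: forall_3)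
  then show ?thesis
    using occupation_sum[OF e, of a] occupation_sum[OF f(1), of b] occupation_sum[OF g, of c] occupation_bounds(4)[of a e2] orthonormal_axis_nth[OF e']
      occupation_bounds(3)[of b f2] orthonormal_axis_nth[OF f(1)] occupation_bounds(3)[of c g2] g2(2) occupation_bounds(1)[of c g3]
      standard_descending[OF S] orthonormal_unit[OF e] orthonormal_unit[OF f(1)] orthonormal_unit[OF g]
    by (simp add: occupation_axis cdot_axis_right)
qed

text \<open>Zeros are needed at (1,1,3), (2,1,3), (2,2,3) and (2,1,2). After \<open>g3\<close> has
  annihilated the plane of the first two axes, \<open>e2\<close> is turned in this plane for the
  third condition and \<open>g2\<close> is chosen for the fourth.\<close>

lemma kronecker_ineq7:
  assumes S: "standard S a b c"
  shows "2 * a$2 + a$1 \<le> (2 * b$3 + b$2) + (2 * c$1 + c$2)"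
proof -
  obtain g3 where g3: "cdot g3 (cnj_vec g3) = 1" "cdot g3 (contract3 S (ax 1) (ax 1)) = 0" "cdot g3 (contract3 S (ax 2) (ax 1)) = 0"
    using exists_annihilator by blast
  obtain e2 where e2: "cdot e2 (cnj_vec e2) = 1" "cdot e2 (cnj_vec (ax 3)) = 0" "cdot e2 (contract1 S (ax 2) g3) = 0"
    using exists_annihilator by blast
  obtain e1 where e': "orthonormal (ax 3) e2 e1" using orthonormal_completion[OF axis_unit e2(1,2)] by blast
  then have e: "orthonormal e1 e2 (ax 3)" by (meson orthonormal_rotate)
  obtain g2 where g2: "cdot g2 (cnj_vec g2) = 1" "cdot g2 (contract3 S e2 (ax 1)) = 0" "cdot g2 (cnj_vec g3) = 0"
    using exists_annihilator by blast
  obtain g1 where "orthonormal g3 g2 g1" using orthonormal_completion[OF g3(1) g2(1,3)] by blast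
  then have g: "orthonormal g1 g2 g3" by (meson orthonormal_rotate)
  have "trilinear S (ax 1) (ax 1) g3 = 0" "trilinear S (ax 2) (ax 1) g3 = 0"
    using g3 by (simp_all add: trilinear_contract(3))
  then have "trilinear S e1 (ax 1) g3 = 0" "trilinear S e2 (ax 1) g3 = 0"
    using orthonormal_axis_nth[OF e'] by (auto intro: trilinear_span)
  moreover have "trilinear S e2 (ax 2) g3 = 0" "trilinear S e2 (ax 1) g2 = 0"
    using e2 g2 by (simp add: trilinear_contract(1), simp add: trilinear_contract(3))
  ultimately have "0 \<le> (-1) * occupation e1 a + (-2) * occupation e2 a + 0 * occupation (ax 3) a
      + (0 * occupation (ax 1) b + 1 * occupation (ax 2) b + 2 * occupation (ax 3) b) + (2 * occupation g1 c + 1 * occupation g2 c + 0 * occupation g3 c)"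
    by (intro weighted_occupation_nonneg[OF S e orthonormal_axis g]) (simp add: forall_3)
  then show ?thesis
    using occupation_sum[OF e, of a] occupation_sum[OF g, of c] occupation_bounds(4)[of a e2] orthonormal_axis_nth[OF e']
      occupation_bounds(2)[of c g1] occupation_bounds(1)[of c g3]
      standard_descending[OF S] orthonormal_unit[OF e] orthonormal_unit[OF g]
    by (simp add: occupation_axis)
qed

lemma standard_swap: "standard S a b c \<Longrightarrow> standard (swap12 S) b a c" "standard S a b c \<Longrightarrow> standard (swap13 S) c b a"
proof -
  assume S: "standard S a b c"
  have *: "marg1 (swap12 (swap13 T)) = marg2 T" "marg1 (swap13 (swap12 T)) = marg3 T" for T
  proof -
    show "marg1 (swap12 (swap13 T)) = marg2 T"
      by (rule matrix_eqI) (simp add: marg1_nth, rule sum.swap)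
    show "marg1 (swap13 (swap12 T)) = marg3 T"
      by (rule matrix_eqI) (simp add: marg1_nth, rule sum.swap)
  qed
  show "standard (swap12 S) b a c" "standard (swap13 S) c b a"
    using S by (simp_all add: standard_def *)
qed

lemma standard_sum:
  assumes S: "standard S a b c"
  shows "(\<Sum>i\<in>UNIV. a$i) = 1" "(\<Sum>i\<in>UNIV. b$i) = 1" "(\<Sum>i\<in>UNIV. c$i) = 1"
proof -
  have *: "(\<Sum>i\<in>UNIV. a$i) = 1" if "standard S a b c" for S a b c
  proof -
    have "complex_of_real (\<Sum>i\<in>UNIV. a$i) = 1"
      using norm_marg[of S] that by (simp add: standard_def diag_nth)
    then show ?thesis by (simp only: of_real_eq_1_iff)
  qed
  show "(\<Sum>i\<in>UNIV. a$i) = 1" "(\<Sum>i\<in>UNIV. b$i) = 1" "(\<Sum>i\<in>UNIV. c$i) = 1"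
    using *[OF S] *[OF standard_swap(1)[OF S]] *[OF standard_swap(2)[OF S]] by simp_all
qed

lemma standard_nonneg: "standard S a b c \<Longrightarrow> 0 \<le> a$i"
proof -
  assume S: "standard S a b c"
  have "marg1 S$i$i = of_real (\<Sum>j\<in>UNIV. \<Sum>k\<in>UNIV. (cmod (S$i$j$k))\<^sup>2)"
    by (simp add: marg1_nth complex_norm_square mult.commute del: of_real_power)
  then have "a$i = (\<Sum>j\<in>UNIV. \<Sum>k\<in>UNIV. (cmod (S$i$j$k))\<^sup>2)"
    using S by (simp add: standard_def diag_nth flip: of_real_sum of_real_power)
  then show ?thesis by (simp add: sum_nonneg)
qed

section \<open>The Kronecker cone is generated by the weights of the covariants\<close>

type_synonym weights = "(real^3) \<times> (real^3) \<times> (real^3)"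

text \<open>Indices 0 to 6 are the seven spectral inequalities in the order of their proofs, 7 to 9
  the conditions that c is sorted and nonnegative. Permutations of the factors supply all the
  others.\<close>

definition facet :: "nat \<Rightarrow> weights \<Rightarrow> real" where
  "facet n = (\<lambda>(a, b, c).
    [(b$2 + b$3) + (c$2 + c$3) - (a$2 + a$3),
     (b$2 + b$3) + (c$1 + c$3) - (a$1 + a$3),
     (b$2 + b$3) + (c$1 + c$2) - (a$1 + a$2),
     (2 * b$2 + b$3) + (2 * c$2 + c$3) - (2 * a$2 + a$3),
     (2 * b$2 + b$3) + (2 * c$3 + c$2) - (2 * a$3 + a$2),
     (2 * b$2 + b$3) + (2 * c$2 + c$1) - (2 * a$2 + a$1),
     (2 * b$3 + b$2) + (2 * c$1 + c$2) - (2 * a$2 + a$1),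
     c$2 - c$3, c$3, c$1 - c$2] ! n)"

definition perms :: "(weights \<Rightarrow> weights) set" where
  "perms = {\<lambda>(a, b, c). (a, b, c), \<lambda>(a, b, c). (a, c, b), \<lambda>(a, b, c). (b, a, c),
    \<lambda>(a, b, c). (b, c, a), \<lambda>(a, b, c). (c, a, b), \<lambda>(a, b, c). (c, b, a)}"

definition balanced :: "weights \<Rightarrow> bool" where
  "balanced = (\<lambda>(a, b, c). (\<Sum>i\<in>UNIV. a$i) = (\<Sum>i\<in>UNIV. b$i) \<and> (\<Sum>i\<in>UNIV. b$i) = (\<Sum>i\<in>UNIV. c$i))"

definition kronecker_cone :: "weights \<Rightarrow> bool" where
  "kronecker_cone x \<longleftrightarrow> balanced x \<and> (\<forall>k<10. \<forall>\<sigma>\<in>perms. 0 \<le> facet k (\<sigma> x))"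

definition attainable :: "weights \<Rightarrow> bool" where
  "attainable x \<longleftrightarrow> balanced x \<and> dominated_at_base x"

lemma less_10: "(k::nat) < 10 \<longleftrightarrow> k \<in> {0,1,2,3,4,5,6,7,8,9}"
  by auto

lemma facet_linear:
  assumes "k < 10" "\<sigma> \<in> perms"
  shows "facet k (\<sigma> (x - t *\<^sub>R v)) = facet k (\<sigma> x) - t * facet k (\<sigma> v)"
proof -
  obtain a b c where x: "x = (a, b, c)" by (cases x) blast
  obtain a' b' c' where v: "v = (a', b', c')" by (cases v) blast
  have lin: "facet k ((p, q, r) - t *\<^sub>R (p', q', r')) = facet k (p, q, r) - t * facet k (p', q', r')" for p q r p' q' r'
    using assms(1) unfolding less_10 by (elim insertE emptyE; simp add: facet_def algebra_simps)
  show ?thesis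
    using assms(2) lin unfolding x v perms_def by auto
qed

lemma balanced_diff: "balanced x \<Longrightarrow> balanced v \<Longrightarrow> balanced (x - t *\<^sub>R v)"
  by (auto simp: balanced_def sum_subtractf simp flip: sum_distrib_left)

lemma kronecker_coneD:
  assumes "kronecker_cone (a, b, c)" "k < 10"
  shows "0 \<le> facet k (a, b, c)" "0 \<le> facet k (a, c, b)" "0 \<le> facet k (b, a, c)" "0 \<le> facet k (b, c, a)"
    "0 \<le> facet k (c, a, b)" "0 \<le> facet k (c, b, a)"
  using assms by (auto simp: kronecker_cone_def perms_def)

lemma kronecker_cone_sums:
  assumes "kronecker_cone (a, b, c)"
  shows "a$1 + a$2 + a$3 = b$1 + b$2 + b$3" "b$1 + b$2 + b$3 = c$1 + c$2 + c$3"
  using assms by (auto simp: kronecker_cone_def balanced_def sum_3)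

lemma kronecker_cone_perm: "\<sigma> \<in> perms \<Longrightarrow> kronecker_cone x \<Longrightarrow> kronecker_cone (\<sigma> x)"
  by (cases x) (auto simp: kronecker_cone_def perms_def balanced_def)

lemma attainable_swap:
  assumes "attainable (a, b, c)"
  shows "attainable (b, a, c)" "attainable (c, b, a)"
proof -
  have s: "(\<Sum>i\<in>UNIV. a$i) = (\<Sum>i\<in>UNIV. b$i)" "(\<Sum>i\<in>UNIV. a$i) = (\<Sum>i\<in>UNIV. c$i)"
    and d: "log_dominated (base 1) a b c" "log_dominated (base (- 1)) a b c"
    using assms by (auto simp: attainable_def dominated_at_base_def balanced_def)
  show "attainable (b, a, c)"
    using s log_dominated_swap12[OF d(1) s(1)] log_dominated_swap12[OF d(2) s(1)]
    by (simp add: attainable_def dominated_at_base_def balanced_def base_swap)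
  show "attainable (c, b, a)"
    using s log_dominated_swap13[OF d(1) s(2)] log_dominated_swap13[OF d(2) s(2)]
    by (simp add: attainable_def dominated_at_base_def balanced_def base_swap)
qed

lemma attainable_perm:
  assumes "attainable (a, b, c)"
  shows "attainable (a, c, b)" "attainable (b, a, c)" "attainable (b, c, a)" "attainable (c, a, b)" "attainable (c, b, a)"
  using assms attainable_swap by meson+

lemma attainable_unperm: "\<sigma> \<in> perms \<Longrightarrow> attainable (\<sigma> x) \<Longrightarrow> attainable x"
  by (cases x) (auto simp: perms_def dest: attainable_perm)

lemma attainable_add: "attainable x \<Longrightarrow> attainable y \<Longrightarrow> attainable (x + y)"
  by (cases x; cases y) (auto simp: attainable_def balanced_def dominated_at_base_def sum.distrib intro: log_dominated_add)

lemma attainable_scaleR: "0 \<le> t \<Longrightarrow> attainable x \<Longrightarrow> attainable (t *\<^sub>R x)"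
  by (cases x) (auto simp: attainable_def balanced_def dominated_at_base_def log_dominated_scaleR simp flip: sum_distrib_left)

lemma attainable_rays:
  "attainable (vector [1,0,0], vector [1,0,0], vector [1,0,0])"
  "attainable (vector [1,1,0], vector [1,1,0], vector [1,1,0])"
  "attainable (vector [1,1,1], vector [1,1,1], vector [1,1,1])"
  "attainable (vector [2,0,0], vector [1,1,0], vector [1,1,0])"
  "attainable (vector [2,1,0], vector [2,1,0], vector [1,1,1])"
  "attainable (vector [3,0,0], vector [1,1,1], vector [1,1,1])"
  "attainable (vector [3,1,0], vector [2,2,0], vector [2,1,1])"
  "attainable (vector [3,3,0], vector [2,2,2], vector [2,2,2])"
  "attainable (vector [3,3,0], vector [3,3,0], vector [2,2,2])"
  "attainable (vector [4,1,1], vector [3,3,0], vector [2,2,2])"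
  "attainable (vector [4,1,1], vector [4,1,1], vector [3,3,0])"
proof -
  have attainable: "attainable x" if "dominated_at_base y" "balanced y" "x = t *\<^sub>R y" "0 \<le> t" for x y t
    using that by (simp add: attainable_scaleR attainable_def[of y])
  note [simp] = balanced_def sum_3 vec_eq_iff forall_3
  show "attainable (vector [1,0,0], vector [1,0,0], vector [1,0,0])" by (rule attainable[OF dominated_at_base_rays(1), where t = 1]) simp_all
  show "attainable (vector [1,1,0], vector [1,1,0], vector [1,1,0])" by (rule attainable[OF dominated_at_base_rays(2), where t = "1/2"]) simp_all
  show "attainable (vector [1,1,1], vector [1,1,1], vector [1,1,1])" by (rule attainable[OF dominated_at_base_rays(3), where t = "1/3"]) simp_all
  show "attainable (vector [2,0,0], vector [1,1,0], vector [1,1,0])" by (rule attainable[OF dominated_at_base_rays(4), where t = 1]) simp_all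
  show "attainable (vector [2,1,0], vector [2,1,0], vector [1,1,1])" by (rule attainable[OF dominated_at_base_rays(5), where t = 1]) simp_all
  show "attainable (vector [3,0,0], vector [1,1,1], vector [1,1,1])" by (rule attainable[OF dominated_at_base_rays(6), where t = 1]) simp_all
  show "attainable (vector [3,1,0], vector [2,2,0], vector [2,1,1])" by (rule attainable[OF dominated_at_base_rays(7), where t = 1]) simp_all
  show "attainable (vector [3,3,0], vector [2,2,2], vector [2,2,2])" by (rule attainable[OF dominated_at_base_rays(8), where t = "1/2"]) simp_all
  show "attainable (vector [3,3,0], vector [3,3,0], vector [2,2,2])" by (rule attainable[OF dominated_at_base_rays(9), where t = 1]) simp_all
  show "attainable (vector [4,1,1], vector [3,3,0], vector [2,2,2])" by (rule attainable[OF dominated_at_base_rays(10), where t = 1]) simp_all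
  show "attainable (vector [4,1,1], vector [4,1,1], vector [3,3,0])" by (rule attainable[OF dominated_at_base_rays(11), where t = 1]) simp_all
qed

lemmas all_rays = attainable_rays attainable_rays[THEN attainable_perm(1)] attainable_rays[THEN attainable_perm(2)] attainable_rays[THEN attainable_perm(3)]
  attainable_rays[THEN attainable_perm(4)] attainable_rays[THEN attainable_perm(5)]

text \<open>Balanced triples on this hyperplane form a space of dimension 6, and the six rays are a
  basis of it. Their coefficients are facet functionals of permuted triples: the identity is linear
  algebra, and membership in the cone supplies the signs. The next six lemmas follow the same
  pattern.\<close>

lemma cone_facet0:
  assumes x: "kronecker_cone (a, b, c)" and "facet 0 (a, b, c) = 0"
  shows "attainable (a, b, c)"
proof -
  have eq: "(a, b, c) = facet 8 (a, b, c) *\<^sub>R (vector [1,1,1], vector [3,0,0], vector [1,1,1])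
      + facet 3 (a, b, c) *\<^sub>R (vector [1,1,1], vector [2,1,0], vector [2,1,0])
      + facet 4 (a, c, b) *\<^sub>R (vector [1,1,0], vector [2,0,0], vector [1,1,0])
      + facet 8 (a, c, b) *\<^sub>R (vector [1,1,1], vector [1,1,1], vector [3,0,0])
      + facet 4 (a, b, c) *\<^sub>R (vector [1,1,0], vector [1,1,0], vector [2,0,0])
      + facet 9 (b, c, a) *\<^sub>R (vector [1,0,0], vector [1,0,0], vector [1,0,0])"
    using assms(2) kronecker_cone_sums[OF x] by (simp add: facet_def vec_eq_iff forall_3 algebra_simps)
  show ?thesis
    by (subst eq) (intro attainable_add attainable_scaleR all_rays kronecker_coneD[OF x]; simp)
qed

lemma cone_facet1:
  assumes x: "kronecker_cone (a, b, c)" and "facet 1 (a, b, c) = 0"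
  shows "attainable (a, b, c)"
proof -
  have eq: "(a, b, c) = facet 8 (a, b, c) *\<^sub>R (vector [1,1,1], vector [3,0,0], vector [1,1,1])
      + facet 5 (c, b, a) *\<^sub>R (vector [2,0,0], vector [1,1,0], vector [1,1,0])
      + facet 7 (b, c, a) *\<^sub>R (vector [1,1,0], vector [2,0,0], vector [1,1,0])
      + facet 8 (a, c, b) *\<^sub>R (vector [4,1,1], vector [4,1,1], vector [3,3,0])
      + facet 9 (a, b, c) *\<^sub>R (vector [1,0,0], vector [1,0,0], vector [1,0,0])
      + facet 3 (c, a, b) *\<^sub>R (vector [2,1,1], vector [3,1,0], vector [2,2,0])"
    using assms(2) kronecker_cone_sums[OF x] by (simp add: facet_def vec_eq_iff forall_3 algebra_simps)
  show ?thesis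
    by (subst eq) (intro attainable_add attainable_scaleR all_rays kronecker_coneD[OF x]; simp)
qed

lemma cone_facet2:
  assumes x: "kronecker_cone (a, b, c)" and "facet 2 (a, b, c) = 0"
  shows "attainable (a, b, c)"
proof -
  have eq: "(a, b, c) = facet 5 (a, b, c) *\<^sub>R (vector [2,1,0], vector [2,1,0], vector [1,1,1])
      + facet 8 (b, c, a) *\<^sub>R (vector [1,1,1], vector [3,0,0], vector [1,1,1])
      + facet 4 (c, b, a) *\<^sub>R (vector [2,2,0], vector [3,1,0], vector [2,1,1])
      + facet 8 (a, c, b) *\<^sub>R (vector [3,3,0], vector [4,1,1], vector [2,2,2])
      + facet 7 (a, b, c) *\<^sub>R (vector [1,1,0], vector [2,0,0], vector [1,1,0])
      + facet 6 (a, b, c) *\<^sub>R (vector [1,0,0], vector [1,0,0], vector [1,0,0])"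
    using assms(2) kronecker_cone_sums[OF x] by (simp add: facet_def vec_eq_iff forall_3 algebra_simps)
  show ?thesis
    by (subst eq) (intro attainable_add attainable_scaleR all_rays kronecker_coneD[OF x]; simp)
qed

lemma cone_facet3:
  assumes x: "kronecker_cone (a, b, c)" and "facet 3 (a, b, c) = 0"
  shows "attainable (a, b, c)"
proof -
  have eq: "(a, b, c) = facet 0 (a, b, c) *\<^sub>R (vector [3,3,0], vector [4,1,1], vector [4,1,1])
      + facet 1 (b, c, a) *\<^sub>R (vector [1,1,1], vector [3,0,0], vector [1,1,1])
      + facet 7 (a, b, c) *\<^sub>R (vector [1,1,0], vector [2,0,0], vector [1,1,0])
      + facet 1 (c, b, a) *\<^sub>R (vector [1,1,1], vector [1,1,1], vector [3,0,0])
      + facet 7 (a, c, b) *\<^sub>R (vector [1,1,0], vector [1,1,0], vector [2,0,0])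
      + facet 9 (b, c, a) *\<^sub>R (vector [1,0,0], vector [1,0,0], vector [1,0,0])"
    using assms(2) kronecker_cone_sums[OF x] by (simp add: facet_def vec_eq_iff forall_3 algebra_simps)
  show ?thesis
    by (subst eq) (intro attainable_add attainable_scaleR all_rays kronecker_coneD[OF x]; simp)
qed

lemma cone_facet4:
  assumes x: "kronecker_cone (a, b, c)" and "facet 4 (a, b, c) = 0"
  shows "attainable (a, b, c)"
proof -
  have eq: "(a, b, c) = facet 8 (a, b, c) *\<^sub>R (vector [1,1,1], vector [3,0,0], vector [1,1,1])
      + facet 7 (a, c, b) *\<^sub>R (vector [1,1,1], vector [2,1,0], vector [2,1,0])
      + facet 7 (b, c, a) *\<^sub>R (vector [1,1,0], vector [2,0,0], vector [1,1,0])
      + facet 2 (c, b, a) *\<^sub>R (vector [1,1,1], vector [1,1,1], vector [3,0,0])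
      + facet 9 (b, c, a) *\<^sub>R (vector [1,0,0], vector [1,0,0], vector [1,0,0])
      + facet 0 (a, b, c) *\<^sub>R (vector [2,2,2], vector [4,1,1], vector [3,3,0])"
    using assms(2) kronecker_cone_sums[OF x] by (simp add: facet_def vec_eq_iff forall_3 algebra_simps)
  show ?thesis
    by (subst eq) (intro attainable_add attainable_scaleR all_rays kronecker_coneD[OF x]; simp)
qed

lemma cone_facet5:
  assumes x: "kronecker_cone (a, b, c)" and "facet 5 (a, b, c) = 0"
  shows "attainable (a, b, c)"
proof -
  have eq: "(a, b, c) = facet 2 (a, b, c) *\<^sub>R (vector [3,3,0], vector [4,1,1], vector [4,1,1])
      + facet 8 (b, c, a) *\<^sub>R (vector [1,1,1], vector [3,0,0], vector [1,1,1])
      + facet 7 (a, c, b) *\<^sub>R (vector [2,2,0], vector [3,1,0], vector [2,1,1])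
      + facet 1 (c, b, a) *\<^sub>R (vector [3,3,0], vector [4,1,1], vector [2,2,2])
      + facet 7 (a, b, c) *\<^sub>R (vector [1,1,0], vector [2,0,0], vector [1,1,0])
      + facet 9 (b, c, a) *\<^sub>R (vector [1,0,0], vector [1,0,0], vector [1,0,0])"
    using assms(2) kronecker_cone_sums[OF x] by (simp add: facet_def vec_eq_iff forall_3 algebra_simps)
  show ?thesis
    by (subst eq) (intro attainable_add attainable_scaleR all_rays kronecker_coneD[OF x]; simp)
qed

lemma cone_facet6:
  assumes x: "kronecker_cone (a, b, c)" and "facet 6 (a, b, c) = 0"
  shows "attainable (a, b, c)"
proof -
  have eq: "(a, b, c) = facet 9 (b, c, a) *\<^sub>R (vector [2,1,0], vector [2,1,0], vector [1,1,1])
      + facet 8 (b, c, a) *\<^sub>R (vector [1,1,1], vector [3,0,0], vector [1,1,1])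
      + facet 2 (a, b, c) *\<^sub>R (vector [3,3,0], vector [3,3,0], vector [2,2,2])
      + facet 9 (a, b, c) *\<^sub>R (vector [2,2,0], vector [3,1,0], vector [2,1,1])
      + facet 8 (a, c, b) *\<^sub>R (vector [3,3,0], vector [4,1,1], vector [2,2,2])
      + facet 7 (a, b, c) *\<^sub>R (vector [1,1,0], vector [2,0,0], vector [1,1,0])"
    using assms(2) kronecker_cone_sums[OF x] by (simp add: facet_def vec_eq_iff forall_3 algebra_simps)
  show ?thesis
    by (subst eq) (intro attainable_add attainable_scaleR all_rays kronecker_coneD[OF x]; simp)
qed

text \<open>If the third spectrum is pure, inequalities 0, 1, 2 taken in both orders bound a and b
  by each other, so a = b, as for a pure state of two systems.\<close>

lemma cone_pure:
  assumes x: "kronecker_cone (a, b, c)" and "c$2 = 0" "c$3 = 0"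
  shows "attainable (a, b, c)"
proof -
  have "0 \<le> facet 0 (a, b, c)" "0 \<le> facet 0 (b, a, c)" "0 \<le> facet 1 (a, c, b)" "0 \<le> facet 1 (b, c, a)"
    "0 \<le> facet 2 (a, c, b)" "0 \<le> facet 2 (b, c, a)"
    by (rule kronecker_coneD[OF x]; simp)+
  then have eq: "(a, b, c) = facet 8 (b, c, a) *\<^sub>R (vector [1,1,1], vector [1,1,1], vector [3,0,0])
      + facet 7 (b, c, a) *\<^sub>R (vector [1,1,0], vector [1,1,0], vector [2,0,0])
      + facet 9 (b, c, a) *\<^sub>R (vector [1,0,0], vector [1,0,0], vector [1,0,0])"
    using assms(2,3) kronecker_cone_sums[OF x] by (simp add: facet_def vec_eq_iff forall_3)
  show ?thesis
    by (subst eq) (intro attainable_add attainable_scaleR all_rays kronecker_coneD[OF x]; simp)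
qed

lemma cone_facet:
  assumes "kronecker_cone x" "k < 7" "facet k x = 0"
  shows "attainable x"
proof -
  obtain a b c where x: "x = (a, b, c)" by (cases x) blast
  have "k \<in> {0,1,2,3,4,5,6}" using assms(2) by auto
  then show ?thesis
    using assms(1,3) unfolding x
    by (elim insertE emptyE; hypsubst)
      (erule (1) cone_facet0 cone_facet1 cone_facet2 cone_facet3 cone_facet4 cone_facet5 cone_facet6)+
qed

text \<open>Moving from a point of the cone along a ray, away from the ray, until the first facet is met.\<close>

lemma pull:
  assumes x: "kronecker_cone x" and v: "kronecker_cone v" "attainable v" and pos: "\<exists>k<10. \<exists>\<sigma>\<in>perms. facet k (\<sigma> v) > 0"
    and step: "\<And>y t k \<sigma>. kronecker_cone y \<Longrightarrow> y = x - t *\<^sub>R v \<Longrightarrow> k \<in> {7,8,9} \<Longrightarrow> \<sigma> \<in> perms \<Longrightarrow> facet k (\<sigma> v) > 0 \<Longrightarrow>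
      facet k (\<sigma> y) = 0 \<Longrightarrow> attainable y"
  shows "attainable x"
proof -
  define P where "P = {(k, \<sigma>). k < 10 \<and> \<sigma> \<in> perms \<and> facet k (\<sigma> v) > 0}"
  define q where "q = (\<lambda>(k, \<sigma>). facet k (\<sigma> x) / facet k (\<sigma> v))"
  have "finite ({..<10::nat} \<times> perms)" by (simp add: perms_def)
  then have fin: "finite P" by (rule rev_finite_subset) (auto simp: P_def)
  have ne: "P \<noteq> {}" using pos by (auto simp: P_def)
  define t where "t = Min (q ` P)"
  have "t \<in> q ` P" unfolding t_def using fin ne by (intro Min_in) auto
  then obtain k \<sigma> where k: "k < 10" "\<sigma> \<in> perms" "facet k (\<sigma> v) > 0" and t: "t = facet k (\<sigma> x) / facet k (\<sigma> v)"
    by (auto simp: P_def q_def)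
  have t_le: "t \<le> facet l (\<tau> x) / facet l (\<tau> v)" if "l < 10" "\<tau> \<in> perms" "facet l (\<tau> v) > 0" for l \<tau>
    unfolding t_def using fin that by (intro Min_le) (auto simp: P_def q_def image_iff)
  have "0 \<le> t" using x k by (simp add: t kronecker_cone_def)
  define y where "y = x - t *\<^sub>R v"
  have "0 \<le> facet l (\<tau> y)" if l: "l < 10" "\<tau> \<in> perms" for l \<tau>
  proof (cases "facet l (\<tau> v) > 0")
    case True
    then show ?thesis using t_le[OF l True] by (simp add: y_def facet_linear[OF l] field_simps)
  next
    case False
    then have "facet l (\<tau> v) = 0" using v(1) l by (force simp: kronecker_cone_def)
    then show ?thesis using x l by (simp add: y_def facet_linear[OF l] kronecker_cone_def)
  qed
  then have y: "kronecker_cone y" using x v(1) by (simp add: kronecker_cone_def y_def balanced_diff)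
  have zero: "facet k (\<sigma> y) = 0" using k t by (simp add: y_def facet_linear)
  have "attainable y"
  proof (cases "k < 7")
    case True
    then show ?thesis
      using attainable_unperm[OF k(2)] cone_facet[OF kronecker_cone_perm[OF k(2) y] _ zero] by blast
  next
    case False
    then have "k \<in> {7,8,9}" using k(1) by auto
    then show ?thesis using step[OF y y_def] k zero by blast
  qed
  then have "attainable (y + t *\<^sub>R v)" using v(2) \<open>0 \<le> t\<close> by (intro attainable_add attainable_scaleR)
  then show ?thesis by (simp add: y_def)
qed

text \<open>The possible stopping walls in coordinates: a third entry becomes zero, or two
  neighbouring entries become equal, and only walls that do not contain the ray can be met.\<close>

lemma pullI:
  assumes x: "kronecker_cone (a, b, c)" and v: "kronecker_cone (u, v, w)" "attainable (u, v, w)" and pos: "u$3 > 0 \<or> v$3 > 0 \<or> w$3 > 0 \<or> u$2 > u$3"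
    and thirds: "\<And>a' b' c' t. kronecker_cone (a', b', c') \<Longrightarrow> a' = a - t *\<^sub>R u \<Longrightarrow> b' = b - t *\<^sub>R v \<Longrightarrow> c' = c - t *\<^sub>R w \<Longrightarrow>
      u$3 > 0 \<and> a'$3 = 0 \<or> v$3 > 0 \<and> b'$3 = 0 \<or> w$3 > 0 \<and> c'$3 = 0 \<or>
      u$2 > u$3 \<and> a'$2 = a'$3 \<or> v$2 > v$3 \<and> b'$2 = b'$3 \<or> w$2 > w$3 \<and> c'$2 = c'$3 \<or>
      u$1 > u$2 \<and> a'$1 = a'$2 \<or> v$1 > v$2 \<and> b'$1 = b'$2 \<or> w$1 > w$2 \<and> c'$1 = c'$2 \<Longrightarrow> attainable (a', b', c')"
  shows "attainable (a, b, c)"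
proof (rule pull[OF x v])
  have f: "facet 8 (v, w, u) = u$3" "facet 8 (w, u, v) = v$3" "facet 8 (u, v, w) = w$3" "facet 7 (v, w, u) = u$2 - u$3"
    by (simp_all add: facet_def)
  have p: "(\<lambda>(a, b, c). (b, c, a)) \<in> perms" "(\<lambda>(a, b, c). (c, a, b)) \<in> perms" "(\<lambda>(a, b, c). (a, b, c)) \<in> perms"
    by (simp_all add: perms_def)
  consider "u$3 > 0" | "v$3 > 0" | "w$3 > 0" | "u$2 > u$3" using pos by blast
  then show "\<exists>k<10. \<exists>\<sigma>\<in>perms. 0 < facet k (\<sigma> (u, v, w))"
  proof cases
    case 1 then show ?thesis by (intro exI[of _ 8] conjI bexI[OF _ p(1)]) (simp_all add: f)
  next
    case 2 then show ?thesis by (intro exI[of _ 8] conjI bexI[OF _ p(2)]) (simp_all add: f)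
  next
    case 3 then show ?thesis by (intro exI[of _ 8] conjI bexI[OF _ p(3)]) (simp_all add: f)
  next
    case 4 then show ?thesis by (intro exI[of _ 7] conjI bexI[OF _ p(1)]) (simp_all add: f)
  qed
next
  fix y t k \<sigma>
  assume y: "kronecker_cone y" "y = (a, b, c) - t *\<^sub>R (u, v, w)" and k: "k \<in> {7,8,9}" "\<sigma> \<in> perms" "facet k (\<sigma> (u, v, w)) > 0" "facet k (\<sigma> y) = 0"
  obtain a' b' c' where abc: "y = (a', b', c')" by (cases y) blast
  have "a' = a - t *\<^sub>R u" "b' = b - t *\<^sub>R v" "c' = c - t *\<^sub>R w" using y abc by simp_all
  moreover have "u$3 > 0 \<and> a'$3 = 0 \<or> v$3 > 0 \<and> b'$3 = 0 \<or> w$3 > 0 \<and> c'$3 = 0 \<or>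
      u$2 > u$3 \<and> a'$2 = a'$3 \<or> v$2 > v$3 \<and> b'$2 = b'$3 \<or> w$2 > w$3 \<and> c'$2 = c'$3 \<or>
      u$1 > u$2 \<and> a'$1 = a'$2 \<or> v$1 > v$2 \<and> b'$1 = b'$2 \<or> w$1 > w$2 \<and> c'$1 = c'$2"
    using k unfolding abc perms_def by (elim insertE emptyE; simp add: facet_def)
  ultimately show "attainable y" using thirds y(1) unfolding abc by blast
qed

text \<open>One ray for each number of factors whose third entry is already zero. It has zero third
  entries in exactly those factors, so they stay zero, and it is flat on its support, so the chamber
  walls it can meet either annihilate another third entry or make a spectrum pure.\<close>

lemma kronecker_cone_ray: "kronecker_cone (vector [1,1,0], vector [1,1,0], vector [1,1,0])" "kronecker_cone (vector [1,1,1], vector [1,1,1], vector [1,1,1])"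
  "kronecker_cone (vector [2,2,2], vector [3,3,0], vector [3,3,0])" "kronecker_cone (vector [2,2,2], vector [2,2,2], vector [3,3,0])"
  unfolding kronecker_cone_def less_10 by (auto simp: facet_def perms_def balanced_def sum_3)

lemma kronecker_cone_swap: "kronecker_cone (a, b, c) \<Longrightarrow> kronecker_cone (b, c, a)" "kronecker_cone (a, b, c) \<Longrightarrow> kronecker_cone (c, a, b)" "kronecker_cone (a, b, c) \<Longrightarrow> kronecker_cone (a, c, b)"
  using kronecker_cone_perm[of "\<lambda>(a, b, c). (b, c, a)" "(a, b, c)"] kronecker_cone_perm[of "\<lambda>(a, b, c). (c, a, b)" "(a, b, c)"]
    kronecker_cone_perm[of "\<lambda>(a, b, c). (a, c, b)" "(a, b, c)"]
  by (simp_all add: perms_def)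

lemma cone_some_pure:
  assumes "kronecker_cone (a, b, c)" and "a$2 = 0 \<and> a$3 = 0 \<or> b$2 = 0 \<and> b$3 = 0 \<or> c$2 = 0 \<and> c$3 = 0"
  shows "attainable (a, b, c)"
  using assms cone_pure[of a b c] cone_pure[of b c a] cone_pure[of c a b] kronecker_cone_swap attainable_perm by metis

lemma cone_qubits:
  assumes x: "kronecker_cone (a, b, c)" and "a$3 = 0" "b$3 = 0" "c$3 = 0"
  shows "attainable (a, b, c)"
proof (rule pullI[OF x kronecker_cone_ray(1) attainable_rays(2)], goal_cases)
  case (2 a' b' c' t)
  have "a'$3 = 0" "b'$3 = 0" "c'$3 = 0" using 2 assms by simp_all
  then show ?case using 2 by (intro cone_some_pure) auto
qed simp

lemma cone_two_qubits:
  assumes x: "kronecker_cone (a, b, c)" and "b$3 = 0" "c$3 = 0"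
  shows "attainable (a, b, c)"
proof (rule pullI[OF x kronecker_cone_ray(3) attainable_perm(5)[OF attainable_rays(9)]], goal_cases)
  case (2 a' b' c' t)
  have "b'$3 = 0" "c'$3 = 0" using 2 assms by simp_all
  then show ?case using 2 cone_qubits[of a' b' c'] cone_some_pure[of a' b' c'] by auto
qed simp

lemma cone_qubit:
  assumes x: "kronecker_cone (a, b, c)" and "c$3 = 0"
  shows "attainable (a, b, c)"
proof (rule pullI[OF x kronecker_cone_ray(4) attainable_perm(5)[OF attainable_rays(8)]], goal_cases)
  case (2 a' b' c' t)
  have c: "c'$3 = 0" using 2 assms by simp
  consider "a'$3 = 0" | "b'$3 = 0" | "c'$2 = 0" using 2 c by auto
  then show ?case
  proof cases
    case 1 then show ?thesis using cone_two_qubits[of b' c' a'] kronecker_cone_swap(1)[OF 2(1)] c attainable_perm by blast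
  next
    case 2 then show ?thesis using cone_two_qubits[of a' b' c'] \<open>kronecker_cone (a', b', c')\<close> c by blast
  next
    case 3 then show ?thesis using cone_some_pure[of a' b' c'] \<open>kronecker_cone (a', b', c')\<close> c by blast
  qed
qed simp

theorem kronecker_cone_imp_attainable:
  assumes x: "kronecker_cone (a, b, c)"
  shows "attainable (a, b, c)"
proof (rule pullI[OF x kronecker_cone_ray(2) attainable_rays(3)], goal_cases)
  case (2 a' b' c' t)
  consider "a'$3 = 0" | "b'$3 = 0" | "c'$3 = 0" using 2 by auto
  then show ?case
    using cone_qubit kronecker_cone_swap[OF 2(1)] attainable_perm 2(1) by cases blast+
qed simp

lemma standard_kronecker_cone:
  assumes S: "standard S a b c"
  shows "kronecker_cone (a, b, c)"
proof -
  have base: "0 \<le> facet k (a, b, c)" if S: "standard S a b c" and k: "k < 10" for S a b c k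
  proof -
    have c: "0 \<le> c$3" using standard_nonneg[OF standard_swap(2)[OF S]] .
    have d: "descending c" using standard_descending[OF S] by simp
    show ?thesis
      using k c d kronecker_ineq1[OF S] kronecker_ineq2[OF S] kronecker_ineq3[OF S] kronecker_ineq4[OF S]
        kronecker_ineq5[OF S] kronecker_ineq6[OF S] kronecker_ineq7[OF S]
      unfolding less_10 by (elim insertE emptyE; simp add: facet_def descending_def)
  qed
  have p: "standard (swap12 S) b a c" "standard (swap13 S) c b a"
    using standard_swap[OF S] by simp_all
  have "\<exists>S. standard S a b c" "\<exists>S. standard S b a c" "\<exists>S. standard S c b a" "\<exists>S. standard S c a b" "\<exists>S. standard S b c a"
    "\<exists>S. standard S a c b"
    using S p standard_swap(2)[OF p(1)] standard_swap(1)[OF p(2)] standard_swap(1)[OF standard_swap(2)[OF p(1)]] by blast+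
  then have "0 \<le> facet k (\<sigma> (a, b, c))" if "k < 10" "\<sigma> \<in> perms" for k \<sigma>
    using that base unfolding perms_def by (elim insertE emptyE) (auto simp: base)
  then show ?thesis
    using standard_sum[OF S] by (simp add: kronecker_cone_def balanced_def)
qed

theorem kronecker_polytope_base: "kronecker_polytope \<subseteq> moment_polytope (base 1)"
proof
  fix x assume x: "x \<in> kronecker_polytope"
  obtain a b c where abc: "x = (a, b, c)" by (cases x) blast
  then obtain S where S: "standard S a b c" using x kronecker_polytope_iff by blast
  have "log_dominated (base 1) a b c"
    using kronecker_cone_imp_attainable[OF standard_kronecker_cone[OF S]] by (simp add: attainable_def dominated_at_base_def)
  then show "x \<in> moment_polytope (base 1)"
    using moment_polytope_of_log_dominated base_nonzero standard_sum[OF S] standard_descending[OF S] abc by blast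
qed

section \<open>Degenerations\<close>

lemma tensor_act_add: "tensor_act A B C (S + T) = tensor_act A B C S + tensor_act A B C T"
  by (rule tensor_eqI) (simp add: tensor_act_nth distrib_left sum.distrib)

lemma closure_orbitI:
  fixes h :: "real \<Rightarrow> tensor"
  assumes cont: "isCont h 0" and orbit: "\<And>e. e \<noteq> 0 \<Longrightarrow> h e \<in> GL_orbit T"
  shows "h 0 \<in> closure (GL_orbit T)"
proof -
  have "(\<lambda>n. h (1 / real (Suc n))) \<longlonglongrightarrow> h 0"
    by (rule isCont_tendsto_compose[OF cont]) (use LIMSEQ_inverse_real_of_nat in \<open>simp add: inverse_eq_divide\<close>)
  then show ?thesis
    unfolding closure_sequential using orbit by (intro exI[of _ "\<lambda>n. h (1 / real (Suc n))"]) simp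
qed

definition dmat :: "complex \<Rightarrow> complex \<Rightarrow> complex \<Rightarrow> complex^3^3" where
  "dmat x y z = (\<chi> i j. if i = j then (vector [x, y, z] :: complex^3)$i else 0)"

lemma dmat_mult_vec: "dmat x y z *v axis 1 a = axis 1 (x * a)" "dmat x y z *v axis 2 a = axis 2 (y * a)" "dmat x y z *v axis 3 a = axis 3 (z * a)"
  by (simp_all add: vec_eq_iff forall_3 dmat_def matrix_vector_mult_def axis_def sum_3)

lemma invertible_dmat: "x \<noteq> 0 \<Longrightarrow> y \<noteq> 0 \<Longrightarrow> z \<noteq> 0 \<Longrightarrow> invertible (dmat x y z)"
  by (simp add: invertible_det_nz det_3 dmat_def)

lemma det_dmat: "det (dmat x y z) = x * y * z"
  by (simp add: det_3 dmat_def)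

lemma tensor_act_dmat:
  "tensor_act (dmat x y z) (dmat x' y' z') (dmat x'' y'' z'') T$i$j$k =
    (vector [x, y, z] :: complex^3)$i * (vector [x', y', z'] :: complex^3)$j * (vector [x'', y'', z''] :: complex^3)$k * T$i$j$k"
  by (simp add: tensor_act_nth dmat_def mult_delta_left sum.delta)

lemma ee_nth: "ee a b c$i$j$k = (if i = a \<and> j = b \<and> k = c then 1 else 0)"
  by (auto simp: ee_def tensor_prod_def axis_def)

lemma tensor_scale_nth: "(\<alpha> \<cdot>\<^sub>T T)$i$j$k = \<alpha> * T$i$j$k"
  by (simp add: tensor_scale_def)

lemma in_orbitI: "invertible A \<Longrightarrow> invertible B \<Longrightarrow> invertible C \<Longrightarrow> S = tensor_act A B C T \<Longrightarrow> S \<in> GL_orbit T"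
  unfolding GL_orbit_def by blast

lemma tensor_eq_exhaust:
  assumes "\<And>i. i \<in> {1,2,3} \<Longrightarrow> (\<And>j. j \<in> {1,2,3} \<Longrightarrow> (\<And>k. k \<in> {1,2,3} \<Longrightarrow> S$i$j$k = T$i$j$k))"
  shows "S = (T::tensor)"
  using assms exhaust_3 by (intro tensor_eqI) blast

text \<open>As a ternary cubic this is 3x(xz + y^2), a conic with a tangent line;
  \<open>cuspidal\<close> is the cuspidal cubic 3x^2 z + y^3.\<close>

definition conic_tangent :: tensor where
  "conic_tangent = ee 1 1 3 + ee 1 2 2 + ee 1 3 1 + ee 2 1 2 + ee 2 2 1 + ee 3 1 1"

definition cuspidal :: tensor where
  "cuspidal = ee 1 1 3 + ee 1 3 1 + ee 3 1 1 + ee 2 2 2"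

lemma dmat_orbit_D:
  assumes "tensor_act (dmat x y z) (dmat x y z) (dmat x y z) X = X" "x * y * z = \<alpha>" "\<alpha> \<noteq> 0"
  shows "\<alpha> \<cdot>\<^sub>T tensor_D + X \<in> GL_orbit (tensor_D + X)"
  by (rule in_orbitI[of "dmat x y z" "dmat x y z" "dmat x y z"])
    (use assms in \<open>auto simp: invertible_dmat tensor_act_add tensor_act_D det_dmat\<close>)

text \<open>Each X is stabilised by some diagonal matrix of determinant \<alpha>, and that matrix
  multiplies D by \<alpha>.\<close>

lemma scaled_D_orbit:
  assumes "\<alpha> \<noteq> 0" "X \<in> U4"
  shows "\<alpha> \<cdot>\<^sub>T tensor_D + X \<in> GL_orbit (tensor_D + X)"
proof -
  have "exp (Ln \<alpha> / 3) ^ 3 = \<alpha>"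
    using assms(1) by (simp flip: exp_of_nat_mult)
  then obtain c where c: "c ^ 3 = \<alpha>" by blast
  then have "c \<noteq> 0" using assms(1) by auto
  consider "X = conic_tangent" | "X = cuspidal" | "X \<in> {tensor_W, ee 1 1 1 + ee 2 2 2, ee 1 1 1, 0}"
    using assms(2) unfolding U4_def conic_tangent_def cuspidal_def by blast
  then show ?thesis
  proof cases
    case 1
    \<comment> \<open>Stabilising X means x^2 z = 1 and x y^2 = 1; then x y z = y^3 must be
      \<alpha>, hence the cube root c.\<close>
    show ?thesis
    proof (rule dmat_orbit_D[where x = "1 / c\<^sup>2" and y = c and z = "c ^ 4"])
      show "tensor_act (dmat (1 / c\<^sup>2) c (c ^ 4)) (dmat (1 / c\<^sup>2) c (c ^ 4)) (dmat (1 / c\<^sup>2) c (c ^ 4)) X = X"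
        by (rule tensor_eq_exhaust, elim insertE emptyE)
          (simp_all add: 1 conic_tangent_def tensor_act_dmat ee_nth \<open>c \<noteq> 0\<close> power2_eq_square power4_eq_xxxx)
    qed (use c \<open>c \<noteq> 0\<close> assms(1) in \<open>auto simp: power2_eq_square power4_eq_xxxx power3_eq_cube\<close>)
  next
    case 2
    \<comment> \<open>With y = 1 the conditions x^2 z = 1 and x z = \<alpha> give these
      values.\<close>
    show ?thesis
    proof (rule dmat_orbit_D[where x = "1 / \<alpha>" and y = 1 and z = "\<alpha>\<^sup>2"])
      show "tensor_act (dmat (1 / \<alpha>) 1 (\<alpha>\<^sup>2)) (dmat (1 / \<alpha>) 1 (\<alpha>\<^sup>2)) (dmat (1 / \<alpha>) 1 (\<alpha>\<^sup>2)) X = X"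
        by (rule tensor_eq_exhaust, elim insertE emptyE)
          (simp_all add: 2 cuspidal_def tensor_act_dmat ee_nth assms(1) power2_eq_square)
    qed (use assms(1) in \<open>auto simp: power2_eq_square\<close>)
  next
    case 3
    show ?thesis
    proof (rule dmat_orbit_D[where x = 1 and y = 1 and z = \<alpha>])
      have "X$i$j$k = 0" if "i = 3 \<or> j = 3 \<or> k = 3" for i j k
        using 3 that by (auto simp: tensor_W_def ee_nth)
      then show "tensor_act (dmat 1 1 \<alpha>) (dmat 1 1 \<alpha>) (dmat 1 1 \<alpha>) X = X"
        by (intro tensor_eq_exhaust) (elim insertE emptyE; simp add: tensor_act_dmat)
    qed (use assms(1) in auto)
  qed
qed

lemma base_orbit: "base 1 \<in> GL_orbit (tensor_D + (ee 1 1 1 + ee 2 2 2))"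
proof -
  \<comment> \<open>The symmetric part becomes (2x + y)^3 + x^3. It does not involve the third axis,
    so the entry -1 is free to make the determinant 1.\<close>
  define g :: "complex^3^3" where "g = vector [vector [2,1,0], vector [1,0,0], vector [0,0,-1]]"
  have det: "det g = 1" by (simp add: g_def det_3)
  have vec: "g *v ax 1 = vector [2,1,0]" "g *v ax 2 = ax 1"
    by (simp_all add: g_def vec_eq_iff forall_3 matrix_vector_mult_def sum_3 axis_def)
  have "tensor_act g g g (tensor_D + (ee 1 1 1 + ee 2 2 2)) = base 1"
    unfolding tensor_act_add tensor_act_D det ee_def tensor_act_tensor_prod vec base_def by simp
  then show ?thesis using det by (intro in_orbitI[of g g g]) (simp_all add: invertible_det_nz)
qed

text \<open>The matrix diag(e, 1, 1/e) has determinant 1 and multiplies the cube x^3 by e^3.\<close>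

lemma D_degenerates: "tensor_D \<in> closure (GL_orbit (tensor_D + ee 1 1 1))"
proof -
  define h where "h e = tensor_D + (e ^ 3) *\<^sub>R ee 1 1 1" for e :: real
  have "h 0 \<in> closure (GL_orbit (tensor_D + ee 1 1 1))"
  proof (rule closure_orbitI)
    show "isCont h 0" unfolding h_def by (intro continuous_intros)
    fix e :: real assume e: "e \<noteq> 0"
    show "h e \<in> GL_orbit (tensor_D + ee 1 1 1)"
    proof (rule in_orbitI)
      show "h e = tensor_act (dmat e 1 (1 / e)) (dmat e 1 (1 / e)) (dmat e 1 (1 / e)) (tensor_D + ee 1 1 1)"
        using e by (intro tensor_eq_exhaust) (elim insertE emptyE; simp add: h_def tensor_act_dmat ee_nth tensor_D_nth power3_eq_cube scaleR_conv_of_real[of _ "1::complex"])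
    qed (use e in \<open>simp_all add: invertible_dmat\<close>)
  qed
  then show ?thesis by (simp add: h_def)
qed

lemma W_degenerates: "tensor_D + ee 1 1 1 \<in> closure (GL_orbit (tensor_D + tensor_W))"
proof -
  define h where "h e = tensor_D + ee 1 1 1 + e *\<^sub>R tensor_W" for e :: real
  have "h 0 \<in> closure (GL_orbit (tensor_D + tensor_W))"
  proof (rule closure_orbitI)
    show "isCont h 0" unfolding h_def by (intro continuous_intros)
    fix e :: real assume e: "e \<noteq> 0"
    \<comment> \<open>The cubic 3x^2 y of W becomes 3x^2 (x/3 + e y) = x^3 + 3e x^2 y; the last
      entry restores determinant 1.\<close>
    define g :: "complex^3^3" where "g = vector [vector [1, 1/3, 0], vector [0, of_real e, 0], vector [0, 0, 1 / of_real e]]"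
    have det: "det g = 1" using e by (simp add: g_def det_3)
    have vec: "g *v ax 1 = ax 1" "g *v ax 2 = vector [1/3, of_real e, 0]"
      by (simp_all add: g_def vec_eq_iff forall_3 matrix_vector_mult_def sum_3 axis_def)
    have "h e = tensor_act g g g (tensor_D + tensor_W)"
      unfolding tensor_act_add tensor_act_D det tensor_W_def ee_def tensor_act_tensor_prod vec h_def
      by (intro tensor_eq_exhaust)
        (elim insertE emptyE; simp add: tensor_scale_nth tensor_prod_def axis_def scaleR_conv_of_real[of _ "1::complex"])
    then show "h e \<in> GL_orbit (tensor_D + tensor_W)"
      using det by (intro in_orbitI[of g g g]) (simp_all add: invertible_det_nz)
  qed
  then show ?thesis by (simp add: h_def)
qed

lemma cuspidal_degenerates: "tensor_D + (ee 1 1 1 + ee 2 2 2) \<in> closure (GL_orbit (tensor_D + cuspidal))"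
proof -
  define h where "h e = tensor_D + (ee 1 1 1 + ee 2 2 2) + e *\<^sub>R (ee 1 1 3 + ee 1 3 1 + ee 3 1 1)" for e :: real
  have "h 0 \<in> closure (GL_orbit (tensor_D + cuspidal))"
  proof (rule closure_orbitI)
    show "isCont h 0" unfolding h_def by (intro continuous_intros)
    fix e :: real assume e: "e \<noteq> 0"
    \<comment> \<open>Substituting e x for x and x/(3e^2) + z/e for z turns 3x^2 z + y^3 into x^3 +
      y^3 + 3e x^2 z.\<close>
    define g :: "complex^3^3" where "g = vector [vector [of_real e, 0, 1 / (3 * (of_real e)\<^sup>2)], vector [0, 1, 0], vector [0, 0, 1 / of_real e]]"
    have det: "det g = 1" using e by (simp add: g_def det_3)
    have vec: "g *v ax 1 = vector [of_real e, 0, 0]" "g *v ax 2 = ax 2" "g *v ax 3 = vector [1 / (3 * (of_real e)\<^sup>2), 0, 1 / of_real e]"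
      by (simp_all add: g_def vec_eq_iff forall_3 matrix_vector_mult_def sum_3 axis_def)
    have "h e = tensor_act g g g (tensor_D + cuspidal)"
      unfolding tensor_act_add tensor_act_D det cuspidal_def ee_def tensor_act_tensor_prod vec h_def
      using e by (intro tensor_eq_exhaust)
        (elim insertE emptyE; simp add: tensor_scale_nth tensor_prod_def axis_def power2_eq_square scaleR_conv_of_real[of _ "1::complex"])
    then show "h e \<in> GL_orbit (tensor_D + cuspidal)"
      using det by (intro in_orbitI[of g g g]) (simp_all add: invertible_det_nz)
  qed
  then show ?thesis by (simp add: h_def)
qed

lemma conic_degenerates:
  "tensor_D + (2 *\<^sub>R ee 1 1 1 + 2 *\<^sub>R (ee 1 2 2 + ee 2 1 2 + ee 2 2 1)) \<in> closure (GL_orbit (tensor_D + conic_tangent))"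
proof -
  define h where "h e = tensor_D + (2 *\<^sub>R ee 1 1 1 + 2 *\<^sub>R (ee 1 2 2 + ee 2 1 2 + ee 2 2 1)) + (2 * e ^ 3) *\<^sub>R (ee 1 1 3 + ee 1 3 1 + ee 3 1 1)"
    for e :: real
  have "h 0 \<in> closure (GL_orbit (tensor_D + conic_tangent))"
  proof (rule closure_orbitI)
    show "isCont h 0" unfolding h_def by (intro continuous_intros)
    fix e :: real assume e: "e \<noteq> 0"
    \<comment> \<open>The substitution turns 3x^2 z + 3x y^2 into 2x^3 + 6x y^2 + 6e^3 x^2 z, whose
      limit is a sum of two cubes.\<close>
    define g :: "complex^3^3" where "g = vector [vector [2 * (of_real e)\<^sup>2, 0, 1 / (6 * (of_real e) ^ 4)],
      vector [0, 1 / of_real e, 0], vector [0, 0, 1 / (2 * of_real e)]]"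
    have det: "det g = 1" using e by (simp add: g_def det_3 power2_eq_square)
    have vec: "g *v ax 1 = vector [2 * (of_real e)\<^sup>2, 0, 0]" "g *v ax 2 = vector [0, 1 / of_real e, 0]"
      "g *v ax 3 = vector [1 / (6 * (of_real e) ^ 4), 0, 1 / (2 * of_real e)]"
      by (simp_all add: g_def vec_eq_iff forall_3 matrix_vector_mult_def sum_3 axis_def)
    have "h e = tensor_act g g g (tensor_D + conic_tangent)"
      unfolding tensor_act_add tensor_act_D det conic_tangent_def ee_def tensor_act_tensor_prod vec h_def
      using e by (intro tensor_eq_exhaust)
        (elim insertE emptyE; simp add: tensor_scale_nth tensor_prod_def axis_def power2_eq_square power3_eq_cube power4_eq_xxxx
          scaleR_conv_of_real[of _ "1::complex"])
    then show "h e \<in> GL_orbit (tensor_D + conic_tangent)"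
      using det by (intro in_orbitI[of g g g]) (simp_all add: invertible_det_nz)
  qed
  then show ?thesis by (simp add: h_def)
qed

text \<open>This is (x + y)^3 + (x - y)^3 = 2x^3 + 6x y^2; the entry -1/2 on the third axis makes
  the determinant 1.\<close>

lemma conic_limit_orbit:
  "tensor_D + (2 *\<^sub>R ee 1 1 1 + 2 *\<^sub>R (ee 1 2 2 + ee 2 1 2 + ee 2 2 1)) \<in> GL_orbit (tensor_D + (ee 1 1 1 + ee 2 2 2))"
proof -
  define g :: "complex^3^3" where "g = vector [vector [1,1,0], vector [1,-1,0], vector [0,0,-1/2]]"
  have det: "det g = 1" by (simp add: g_def det_3)
  have vec: "g *v ax 1 = vector [1,1,0]" "g *v ax 2 = vector [1,-1,0]"
    by (simp_all add: g_def vec_eq_iff forall_3 matrix_vector_mult_def sum_3 axis_def)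
  have "tensor_D + (2 *\<^sub>R ee 1 1 1 + 2 *\<^sub>R (ee 1 2 2 + ee 2 1 2 + ee 2 2 1)) = tensor_act g g g (tensor_D + (ee 1 1 1 + ee 2 2 2))"
    unfolding tensor_act_add tensor_act_D det ee_def tensor_act_tensor_prod vec
    by (intro tensor_eq_exhaust)
      (elim insertE emptyE; simp add: tensor_scale_nth tensor_prod_def axis_def scaleR_conv_of_real[of _ "1::complex"])
  then show ?thesis using det by (intro in_orbitI[of g g g]) (simp_all add: invertible_det_nz)
qed

lemma moment_polytope_generic:
  assumes "X \<in> {conic_tangent, cuspidal, ee 1 1 1 + ee 2 2 2}"
  shows "moment_polytope (tensor_D + X) = kronecker_polytope"
proof -
  have "kronecker_polytope \<subseteq> moment_polytope (tensor_D + (ee 1 1 1 + ee 2 2 2))"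
    using kronecker_polytope_base moment_polytope_orbit[OF base_orbit] by simp
  also have "\<dots> \<subseteq> moment_polytope (tensor_D + X)"
    using assms moment_polytope_mono[OF cuspidal_degenerates] moment_polytope_mono[OF conic_degenerates]
      moment_polytope_orbit[OF conic_limit_orbit] by auto
  finally show ?thesis using moment_polytope_subset_kronecker by blast
qed

section \<open>Separating points\<close>

definition slice :: "complex^3 \<Rightarrow> tensor \<Rightarrow> complex^3^3" where
  "slice x T = (\<chi> j k. \<Sum>i\<in>UNIV. x$i * T$i$j$k)"

lemma slice_nth: "slice x T$j$k = (\<Sum>i\<in>UNIV. x$i * T$i$j$k)"
  by (simp add: slice_def)

lemma slice_tensor_act: "slice x (tensor_act A B C T) = B ** slice (x v* A) T ** transpose C"
proof (rule matrix_eqI)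
  fix j k
  show "slice x (tensor_act A B C T)$j$k = (B ** slice (x v* A) T ** transpose C)$j$k"
    by (simp add: slice_nth tensor_act_nth matrix_matrix_mult_def transpose_def vector_matrix_mult_def sum_3 algebra_simps)
qed

lemma det_slice_act: "det (slice x (tensor_act A B C T)) = det B * det C * det (slice (x v* A) T)"
  by (simp add: slice_tensor_act det_mul det_transpose mult_ac)

lemma det_slice_D: "det (slice x tensor_D) = 0"
  by (simp add: det_3 slice_nth sum_3 tensor_D_nth)

lemma det_slice_D_e111: "det (slice x (tensor_D + ee 1 1 1)) = x$1 ^ 3"
  by (simp add: det_3 slice_nth sum_3 tensor_D_nth ee_nth power3_eq_cube)

lemma det_slice_D_W: "det (slice x (tensor_D + tensor_W)) = 3 * (x$1)\<^sup>2 * x$2"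
  by (simp add: det_3 slice_nth sum_3 tensor_D_nth ee_nth tensor_W_def power2_eq_square algebra_simps)

text \<open>The polarised determinant: the coefficient of s^2 t on the pencil through x and y, that
  of s t^2 being \<open>pencil1 T y x\<close>.\<close>

definition pencil1 :: "tensor \<Rightarrow> complex^3 \<Rightarrow> complex^3 \<Rightarrow> complex" where
  "pencil1 T x y = br3 (slice y T$1) (slice x T$2) (slice x T$3) + br3 (slice x T$1) (slice y T$2) (slice x T$3)
    + br3 (slice x T$1) (slice x T$2) (slice y T$3)"

lemma det_br3: "det M = br3 (M$1) (M$2) (M$3)"
  by (simp add: det_3 br3_def algebra_simps)

lemma det_pencil:
  "det (slice (s *s x + t *s y) T) = s ^ 3 * det (slice x T) + s\<^sup>2 * t * pencil1 T x y + s * t\<^sup>2 * pencil1 T y x + t ^ 3 * det (slice y T)"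
proof -
  have "slice (s *s x + t *s y) T$j = s *s slice x T$j + t *s slice y T$j" for j
    by (simp add: vec_eq_iff slice_nth sum.distrib sum_distrib_left algebra_simps)
  then show ?thesis
    unfolding det_br3 pencil1_def by (simp add: power2_eq_square power3_eq_cube algebra_simps)
qed

lemma binary_cubic_coeffs:
  fixes a b c d :: complex
  assumes "\<And>s t. a * s ^ 3 + b * s\<^sup>2 * t + c * s * t\<^sup>2 + d * t ^ 3 = 0"
  shows "a = 0" "b = 0" "c = 0" "d = 0"
proof -
  show "a = 0" "d = 0" using assms[of 1 0] assms[of 0 1] by simp_all
  then show "b = 0" "c = 0" using assms[of 1 1] assms[of 1 "-1"] by (simp_all add: add_eq_0_iff)
qed

text \<open>
  The determinant of the pencil spanned by two slices has a double (or triple) zero. This is a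
  closed condition since the pairs of slices range over a compact set.
\<close>

definition double_zero :: "tensor set" where
  "double_zero = {T. \<exists>x y. orthonormal x y (ax 3) \<and> det (slice x T) = 0 \<and> pencil1 T x y = 0}"

definition triple_zero :: "tensor set" where
  "triple_zero = {T. \<exists>x y. orthonormal x y (ax 3) \<and> det (slice x T) = 0 \<and> pencil1 T x y = 0 \<and> pencil1 T y x = 0}"

lemma orthonormal_norm: "orthonormal x y z \<Longrightarrow> norm x = 1 \<and> norm y = 1"
proof -
  assume "orthonormal x y z"
  then have "complex_of_real ((norm x)\<^sup>2) = 1" "complex_of_real ((norm y)\<^sup>2) = 1"
    unfolding norm_cnj_vec[symmetric] by (simp_all add: orthonormal_def)
  then have "(norm x)\<^sup>2 = 1\<^sup>2" "(norm y)\<^sup>2 = 1\<^sup>2" by (simp_all only: of_real_eq_1_iff power_one)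
  then show ?thesis by (simp add: power2_eq_iff_nonneg del: power_one)
qed

lemma closed_compact_ex:
  fixes P :: "(tensor \<times> (complex^3) \<times> (complex^3)) set"
  assumes P: "closed P" and K: "\<And>T x y. (T, x, y) \<in> P \<Longrightarrow> norm x = 1 \<and> norm y = 1"
  shows "closed {T. \<exists>x y. (T, x, y) \<in> P}"
  unfolding closed_sequential_limits
proof (intro allI impI)
  fix f l assume f: "(\<forall>n. f n \<in> {T. \<exists>x y. (T, x, y) \<in> P}) \<and> f \<longlonglongrightarrow> l"
  then obtain g h where gh: "\<And>n. (f n, g n, h n) \<in> P" by simp metis
  have "seq_compact (sphere (0::complex^3) 1 \<times> sphere (0::complex^3) 1)"
    by (intro compact_imp_seq_compact compact_Times compact_sphere)
  moreover have "\<forall>n. (g n, h n) \<in> sphere 0 1 \<times> sphere 0 1" using K[OF gh] by simp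
  ultimately obtain xy r where r: "strict_mono r" and lim: "((\<lambda>n. (g n, h n)) \<circ> r) \<longlonglongrightarrow> xy"
    by (rule seq_compactE)
  have "(f \<circ> r) \<longlonglongrightarrow> l" using f r LIMSEQ_subseq_LIMSEQ by blast
  then have L: "(\<lambda>n. ((f \<circ> r) n, ((\<lambda>n. (g n, h n)) \<circ> r) n)) \<longlonglongrightarrow> (l, xy)"
    using lim by (rule tendsto_Pair)
  have M: "((f \<circ> r) n, ((\<lambda>n. (g n, h n)) \<circ> r) n) \<in> P" for n using gh by simp
  have "(l, xy) \<in> P" by (rule closed_sequentially[OF P M L])
  then show "l \<in> {T. \<exists>x y. (T, x, y) \<in> P}" by (cases xy) auto
qed

lemma closed_zeros: "closed double_zero" "closed triple_zero"
proof -
  have c: "continuous_on UNIV (\<lambda>(T, x, y). det (slice x T))" "continuous_on UNIV (\<lambda>(T, x, y). pencil1 T x y)"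
    "continuous_on UNIV (\<lambda>(T, x, y). pencil1 T y x)"
    unfolding det_br3 pencil1_def br3_def slice_nth split_beta by (intro continuous_intros)+
  have o: "closed {(T::tensor, x, y). orthonormal x y (ax 3)}"
    unfolding orthonormal_def cdot_def cnj_vec_def split_beta vec_lambda_beta
    by (intro closed_Collect_conj closed_Collect_eq continuous_intros)
  have "closed ({(T, x, y). orthonormal x y (ax 3)} \<inter> {p. (case p of (T, x, y) \<Rightarrow> det (slice x T)) = 0} \<inter>
      {p. (case p of (T, x, y) \<Rightarrow> pencil1 T x y) = 0})"
    by (intro closed_Int o closed_Collect_eq c continuous_intros)
  from closed_compact_ex[OF this] show "closed double_zero"
    unfolding double_zero_def by (auto dest: orthonormal_norm)
  have "closed ({(T, x, y). orthonormal x y (ax 3)} \<inter> {p. (case p of (T, x, y) \<Rightarrow> det (slice x T)) = 0} \<inter>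
      {p. (case p of (T, x, y) \<Rightarrow> pencil1 T x y) = 0} \<inter> {p. (case p of (T, x, y) \<Rightarrow> pencil1 T y x) = 0})"
    by (intro closed_Int o closed_Collect_eq c continuous_intros)
  from closed_compact_ex[OF this] show "closed triple_zero"
    unfolding triple_zero_def by (auto dest: orthonormal_norm)
qed

text \<open>x and y span the plane of the first two axes, and x is a zero in it of the first
  coordinate moved by A. The slice determinants x_1^3 and 3 x_1^2 x_2 contain this coordinate as a
  multiple factor, so their multiple zero on the pencil sits at x.\<close>

lemma orbit_frame:
  obtains x y where "orthonormal x y (ax 3)" "(x v* A)$1 = 0"
proof -
  obtain x where x: "cdot x (cnj_vec x) = 1" "cdot x (cnj_vec (ax 3)) = 0" "cdot x (\<chi> i. A$i$1) = 0"
    using exists_annihilator by blast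
  obtain y where "orthonormal (ax 3) x y" using orthonormal_completion[OF axis_unit x(1,2)] by blast
  then have "orthonormal x y (ax 3)" by (meson orthonormal_rotate)
  moreover have "(x v* A)$1 = 0" using x(3) by (simp add: cdot_def vector_matrix_mult_def mult.commute)
  ultimately show thesis using that by blast
qed

lemma vector_matrix_lin: "(s *s x + t *s y) v* A = s *s (x v* A) + t *s (y v* (A::complex^3^3))"
  by (simp add: vec_eq_iff vector_matrix_mult_def sum_3 algebra_simps)

lemma orbit_W_double_zero: "closure (GL_orbit (tensor_D + tensor_W)) \<subseteq> double_zero"
proof (rule closure_minimal[OF _ closed_zeros(1)], rule subsetI)
  fix T assume "T \<in> GL_orbit (tensor_D + tensor_W)"
  then obtain A B C where T: "T = tensor_act A B C (tensor_D + tensor_W)" by (auto simp: GL_orbit_def)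
  obtain x y where xy: "orthonormal x y (ax 3)" "(x v* A)$1 = 0" by (rule orbit_frame)
  define k where "k = det B * det C * 3 * ((y v* A)$1)\<^sup>2"
  have "det (slice (s *s x + t *s y) T) = k * t\<^sup>2 * (s * (x v* A)$2 + t * (y v* A)$2)" for s t
    unfolding T det_slice_act det_slice_D_W vector_matrix_lin using xy(2)
    by (simp add: k_def power_mult_distrib algebra_simps)
  then have "det (slice x T) * s ^ 3 + pencil1 T x y * s\<^sup>2 * t + (pencil1 T y x - k * (x v* A)$2) * s * t\<^sup>2
      + (det (slice y T) - k * (y v* A)$2) * t ^ 3 = 0" for s t
    using det_pencil[of s x t y T] by (simp add: algebra_simps power2_eq_square power3_eq_cube)
  from binary_cubic_coeffs[OF this] show "T \<in> double_zero"
    using xy(1) by (auto simp: double_zero_def)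
qed

lemma orbit_e111_triple_zero: "closure (GL_orbit (tensor_D + ee 1 1 1)) \<subseteq> triple_zero"
proof (rule closure_minimal[OF _ closed_zeros(2)], rule subsetI)
  fix T assume "T \<in> GL_orbit (tensor_D + ee 1 1 1)"
  then obtain A B C where T: "T = tensor_act A B C (tensor_D + ee 1 1 1)" by (auto simp: GL_orbit_def)
  obtain x y where xy: "orthonormal x y (ax 3)" "(x v* A)$1 = 0" by (rule orbit_frame)
  define k where "k = det B * det C * (y v* A)$1 ^ 3"
  have "det (slice (s *s x + t *s y) T) = k * t ^ 3" for s t
    unfolding T det_slice_act det_slice_D_e111 vector_matrix_lin using xy(2)
    by (simp add: k_def power_mult_distrib algebra_simps)
  then have "det (slice x T) * s ^ 3 + pencil1 T x y * s\<^sup>2 * t + pencil1 T y x * s * t\<^sup>2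
      + (det (slice y T) - k) * t ^ 3 = 0" for s t
    using det_pencil[of s x t y T] by (simp add: algebra_simps power2_eq_square power3_eq_cube)
  from binary_cubic_coeffs[OF this] show "T \<in> triple_zero"
    using xy(1) by (auto simp: triple_zero_def)
qed

section \<open>Tensors whose second and third marginals are flat\<close>

definition flat :: "real^3" where "flat = vector [1/3, 1/3, 1/3]"

lemma flat_nth [simp]: "flat$i = 1/3"
  using exhaust_3[of i] by (auto simp: flat_def)

lemma occupation_flat: "cdot u (cnj_vec u) = 1 \<Longrightarrow> occupation u flat = 1/3"
  using unit_occupation[of u] by (simp add: occupation_def sum_3 flip: add_divide_distrib)

lemma unitary_det_norm: "unitary U \<Longrightarrow> cmod (det U) = 1"
proof -
  assume U: "unitary U"
  have "det (conj_transpose U) = cnj (det U)"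
    by (simp add: det_3)
  then have "det U * cnj (det U) = 1" using U det_mul[of U "conj_transpose U"] by (simp add: unitary_def)
  then have "(cmod (det U))\<^sup>2 = 1\<^sup>2" by (metis complex_norm_square of_real_eq_1_iff power_one)
  then show ?thesis by (simp add: power2_eq_iff_nonneg del: power_one)
qed

lemma lagrange2:
  fixes a b c d :: complex
  shows "(cmod (cnj a * c + cnj b * d))\<^sup>2 = ((cmod a)\<^sup>2 + (cmod b)\<^sup>2) * ((cmod c)\<^sup>2 + (cmod d)\<^sup>2) - (cmod (a * d - b * c))\<^sup>2"
proof -
  have "complex_of_real ((cmod (cnj a * c + cnj b * d))\<^sup>2) =
      complex_of_real (((cmod a)\<^sup>2 + (cmod b)\<^sup>2) * ((cmod c)\<^sup>2 + (cmod d)\<^sup>2) - (cmod (a * d - b * c))\<^sup>2)"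
    unfolding of_real_diff of_real_mult of_real_add complex_norm_square by (simp add: algebra_simps)
  then show ?thesis by (simp only: of_real_eq_iff)
qed

lemma standard_slice_zero:
  assumes "standard S a b c" "a$i = 0" shows "S$i$j$k = 0"
proof -
  have "complex_of_real (\<Sum>j\<in>UNIV. \<Sum>k\<in>UNIV. (cmod (S$i$j$k))\<^sup>2) = marg1 S$i$i"
    by (simp add: marg1_nth complex_norm_square mult.commute del: of_real_power)
  also have "\<dots> = 0" using assms by (simp add: standard_def diag_nth)
  finally have "(\<Sum>j\<in>UNIV. \<Sum>k\<in>UNIV. (cmod (S$i$j$k))\<^sup>2) = 0" by (simp only: of_real_eq_0_iff)
  then show ?thesis by (simp add: sum_nonneg_eq_0_iff sum_nonneg)
qed

lemma unitary_flat: "unitary U \<Longrightarrow> map_matrix cnj U ** diag flat ** transpose U = diag flat"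
proof (rule matrix_eqI)
  fix i j assume "unitary U"
  then have "(\<Sum>a\<in>UNIV. U$j$a * cnj (U$i$a)) = (if j = i then 1 else 0)" unfolding unitary_rows by blast
  then show "(map_matrix cnj U ** diag flat ** transpose U)$i$j = diag flat$i$j"
    by (simp add: matrix_matrix_mult_def diag_nth transpose_def mult_delta_right sum.delta mult_ac flip: sum_divide_distrib)
qed

text \<open>
  If the marginals of the second and third factor are flat and \<open>u\<close> is in the kernel of the slice \<open>N\<close>
  at \<open>x\<close>, then the slice \<open>P\<close> at \<open>y\<close> splits off the line of \<open>u\<close>. The remaining blocks are \<open>2 \<times> 2\<close>
  matrices \<open>N'\<close>, \<open>P'\<close> with \<open>N' N'\<^sup>* + P' P'\<^sup>* = 1/3\<close> and \<open>det N' = 0\<close>, whence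
  \<open>\<bar>det P'\<bar>\<^sup>2 = (1 - 3 \<parallel>N'\<parallel>\<^sup>2) / 9\<close>.
\<close>

lemma pencil_bound:
  assumes S: "standard S a flat flat" "a$3 = 0" and on: "orthonormal x y (ax 3)"
    and det: "\<And>s t. det (slice (s *s x + t *s y) S) = \<alpha> * s * t\<^sup>2 + \<beta> * t ^ 3"
  shows "occupation x a \<le> 1/3" "occupation x a = 1/3 \<Longrightarrow> \<beta> = 0"
proof -
  have "det (slice x S) = 0" using det[of 1 0] by simp
  then obtain g1 where g1: "cdot g1 (cnj_vec g1) = 1" "\<And>j. (\<Sum>k\<in>UNIV. slice x S$j$k * g1$k) = 0"
    by (rule det_zero_unit_kernel) blast
  obtain g2 where g2: "cdot g2 (cnj_vec g2) = 1" "cdot g2 (cnj_vec g1) = 0" using exists_annihilator by blast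
  obtain g3 where g: "orthonormal g1 g2 g3" using orthonormal_completion[OF g1(1) g2] by blast
  \<comment> \<open>The image of the kernel vector under the slice at y. With \<open>f2\<close> and
    \<open>f3\<close> in its annihilator, T_211 is the only entry with third index 1 that can be
    nonzero.\<close>
  define w where "w = contract2 S y g1"
  obtain f2 where f2: "cdot f2 (cnj_vec f2) = 1" "cdot f2 w = 0" using exists_annihilator by blast
  obtain f3 where f3: "cdot f3 (cnj_vec f3) = 1" "cdot f3 w = 0" "cdot f3 (cnj_vec f2) = 0" using exists_annihilator by blast
  obtain f1 where "orthonormal f2 f3 f1" using orthonormal_completion[OF f2(1) f3(1,3)] by blast
  then have f: "orthonormal f1 f2 f3" by (meson orthonormal_rotate)
  define E F G where "E = (vector [x, y, ax 3] :: complex^3^3)" and "F = (vector [f1, f2, f3] :: complex^3^3)"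
    and "G = (vector [g1, g2, g3] :: complex^3^3)"
  have U: "unitary E" "unitary F" "unitary G" using on f g by (simp_all add: E_def F_def G_def orthonormal_unitary)
  define T where "T = tensor_act E F G S"
  have T_trilinear: "T$i$j$k = trilinear S (E$i) (F$j) (G$k)" for i j k by (simp add: T_def tensor_act_nth trilinear_def)
  have T3: "T$3$j$k = 0" for j k
    using standard_slice_zero[OF S] by (simp add: T_trilinear trilinear_contract(1) E_def cdot_axis) (simp add: contract1_def)
  have N1: "T$1$j$1 = 0" for j
  proof -
    have "T$1$j$1 = (\<Sum>b\<in>UNIV. F$j$b * (\<Sum>k\<in>UNIV. slice x S$b$k * g1$k))"
      by (simp add: T_trilinear trilinear_def E_def G_def slice_nth sum_3 algebra_simps)
    then show ?thesis by (simp add: g1(2))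
  qed
  have P1: "T$2$2$1 = 0" "T$2$3$1 = 0"
    using f2(2) f3(2) by (simp_all add: T_trilinear E_def F_def G_def trilinear_contract(2) w_def)
  note weights = marginal_weights[OF S(1) U, folded T_trilinear]
  have F_unit: "cdot (F$j) (cnj_vec (F$j)) = 1" and G_unit: "cdot (G$j) (cnj_vec (G$j)) = 1" for j
    using exhaust_3[of j] f g by (auto simp: F_def G_def orthonormal_def)
  have col1: "(cmod (T$2$1$1))\<^sup>2 = 1/3"
    using weights(3)[of 1] occupation_flat[OF G_unit[of 1]] by (simp add: sum_3 T3 N1 P1)
  \<comment> \<open>Row 1 has total mass 1/3, which T_211 already exhausts; both slices thus split
    into blocks of sizes 1 and 2.\<close>
  have row1: "T$1$1$2 = 0" "T$1$1$3 = 0" "T$2$1$2 = 0" "T$2$1$3 = 0"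
  proof -
    have "(cmod (T$1$1$2))\<^sup>2 + (cmod (T$1$1$3))\<^sup>2 + (cmod (T$2$1$2))\<^sup>2 + (cmod (T$2$1$3))\<^sup>2 = 0"
      using weights(2)[of 1] occupation_flat[OF F_unit[of 1]] col1 by (simp add: sum_3 T3 N1 P1)
    then show "T$1$1$2 = 0" "T$1$1$3 = 0" "T$2$1$2 = 0" "T$2$1$3 = 0"
      by (simp_all add: add_nonneg_eq_0_iff)
  qed
  define R where "R j = (cmod (T$1$j$2))\<^sup>2 + (cmod (T$1$j$3))\<^sup>2" for j
  have Q: "(cmod (T$2$j$2))\<^sup>2 + (cmod (T$2$j$3))\<^sup>2 = 1/3 - R j" if "j = 2 \<or> j = 3" for j
    using that weights(2)[of j] occupation_flat[OF F_unit[of j]] by (auto simp: sum_3 T3 N1 P1 R_def)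
  have occupation: "occupation x a = R 2 + R 3"
    using weights(1)[of 1] by (simp add: sum_3 N1 row1 R_def E_def)
  have "marg2 T = diag flat"
    using S(1) by (simp add: T_def marg2_tensor_act U unitary_flat standard_def)
  then have "marg2 T$2$3 = 0" by (simp add: diag_nth)
  then have off: "cnj (T$2$2$2) * T$2$3$2 + cnj (T$2$2$3) * T$2$3$3 = - (cnj (T$1$2$2) * T$1$3$2 + cnj (T$1$2$3) * T$1$3$3)"
    by (simp add: marg1_nth sum_3 T3 N1 P1 add_eq_0_iff algebra_simps)
  define dN where "dN = T$1$2$2 * T$1$3$3 - T$1$2$3 * T$1$3$2"
  define dP where "dP = T$2$2$2 * T$2$3$3 - T$2$2$3 * T$2$3$2"
  define \<kappa> where "\<kappa> = det F * det G"
  have kappa: "\<kappa> \<noteq> 0" using unitary_det_norm[OF U(2)] unitary_det_norm[OF U(3)] by (auto simp: \<kappa>_def)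
  \<comment> \<open>The assumed determinant has no s^2 t term, which forces det N' = 0; the t^3 term
    identifies det P' with \<beta> up to a nonzero factor.\<close>
  have "0 * s ^ 3 + (T$2$1$1 * dN) * s\<^sup>2 * t
      + (T$2$1$1 * (T$1$2$2 * T$2$3$3 + T$2$2$2 * T$1$3$3 - T$1$2$3 * T$2$3$2 - T$2$2$3 * T$1$3$2) - \<kappa> * \<alpha>) * s * t\<^sup>2
      + (T$2$1$1 * dP - \<kappa> * \<beta>) * t ^ 3 = 0" for s t
  proof -
    have "(s *s ax 1 + t *s ax 2) v* E = s *s x + t *s y"
      by (simp add: vec_eq_iff vector_matrix_mult_def sum_3 axis_def E_def mult.commute)
    then have "det (slice (s *s ax 1 + t *s ax 2) T) = \<kappa> * (\<alpha> * s * t\<^sup>2 + \<beta> * t ^ 3)"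
      by (simp add: T_def det_slice_act det \<kappa>_def)
    moreover have "slice (s *s ax 1 + t *s ax 2) T$j$k = s * T$1$j$k + t * T$2$j$k" for j k
      by (simp add: slice_nth sum_3 axis_def)
    ultimately show ?thesis
      unfolding dN_def dP_def by (simp add: det_3 N1 P1 row1 algebra_simps power2_eq_square power3_eq_cube)
  qed
  note coeffs = binary_cubic_coeffs(2,4)[OF this]
  have "T$2$1$1 \<noteq> 0" using col1 by auto
  then have "dN = 0" and dP: "T$2$1$1 * dP = \<kappa> * \<beta>" using coeffs by simp_all
  \<comment> \<open>Lagrange's identity is applied to the rows of N' and of P'. Their inner products
    are opposite because the second marginal is diagonal, and the squared row lengths add up to
    1/3.\<close>
  have "R 2 * R 3 = (cmod (cnj (T$1$2$2) * T$1$3$2 + cnj (T$1$2$3) * T$1$3$3))\<^sup>2"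
    using \<open>dN = 0\<close> unfolding lagrange2 by (simp add: R_def dN_def)
  also have "\<dots> = (cmod (cnj (T$2$2$2) * T$2$3$2 + cnj (T$2$2$3) * T$2$3$3))\<^sup>2"
    unfolding off by (simp only: norm_minus_cancel)
  also have "\<dots> = (1/3 - R 2) * (1/3 - R 3) - (cmod dP)\<^sup>2"
    unfolding lagrange2 by (simp add: Q dP_def)
  finally have key: "(cmod dP)\<^sup>2 = 1/9 - occupation x a / 3"
    unfolding occupation by (simp add: field_simps)
  show "occupation x a \<le> 1/3" using key zero_le_power2[of "cmod dP"] by linarith
  show "\<beta> = 0" if "occupation x a = 1/3"
    using key dP kappa that by simp
qed

lemma pencil_double_zero:
  assumes "standard S a flat flat" "a$3 = 0" "S \<in> double_zero"
  shows "a$2 \<le> 1/3"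
proof -
  obtain x y where xy: "orthonormal x y (ax 3)" "det (slice x S) = 0" "pencil1 S x y = 0"
    using assms(3) by (auto simp: double_zero_def)
  have "det (slice (s *s x + t *s y) S) = pencil1 S y x * s * t\<^sup>2 + det (slice y S) * t ^ 3" for s t
    by (simp add: det_pencil xy)
  from pencil_bound(1)[OF assms(1,2) xy(1) this] have "occupation x a \<le> 1/3" .
  moreover have "x$3 = 0" using xy(1) by (simp add: orthonormal_def cdot_axis)
  ultimately show ?thesis
    using occupation_bounds(4)[of a x] standard_descending[OF assms(1)] orthonormal_unit[OF xy(1)] by simp
qed

text \<open>If a_2 were at least 1/3, equality would hold in the bound at x and the determinant
  would vanish on the whole pencil. The bound then applies at y too, but the occupations of x and y
  sum to 1.\<close>

lemma pencil_triple_zero: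
  assumes "standard S a flat flat" "a$3 = 0" "S \<in> triple_zero"
  shows "a$2 < 1/3"
proof (rule ccontr)
  assume a2: "\<not> a$2 < 1/3"
  obtain x y where xy: "orthonormal x y (ax 3)" "det (slice x S) = 0" "pencil1 S x y = 0" "pencil1 S y x = 0"
    using assms(3) by (auto simp: triple_zero_def)
  have p: "det (slice (s *s x + t *s y) S) = 0 * s * t\<^sup>2 + det (slice y S) * t ^ 3" for s t
    by (simp add: det_pencil xy)
  have "x$3 = 0" using xy(1) by (simp add: orthonormal_def cdot_axis)
  then have "a$2 \<le> occupation x a"
    using occupation_bounds(4)[of a x] standard_descending[OF assms(1)] orthonormal_unit[OF xy(1)] by simp
  then have x: "occupation x a = 1/3" "det (slice y S) = 0"
    using pencil_bound[OF assms(1,2) xy(1) p] a2 by auto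
  then have q: "det (slice (s *s y + t *s x) S) = 0 * s * t\<^sup>2 + 0 * t ^ 3" for s t
    using p[of t s] by (simp add: add.commute)
  have "orthonormal y x (ax 3)" using xy(1) by (meson orthonormal_rotate)
  from pencil_bound(1)[OF assms(1,2) this q] have "occupation y a \<le> 1/3" .
  then show False
    using x occupation_sum[OF xy(1), of a] standard_sum(1)[OF assms(1)] assms(2) by (simp add: occupation_axis sum_3)
qed

section \<open>Witnesses for the strict inclusions\<close>

lemma standardI:
  assumes "\<And>i j. marg1 S$i$j = diag a$i$j" "\<And>i j. marg2 S$i$j = diag b$i$j" "\<And>i j. marg3 S$i$j = diag c$i$j"
    "a$1 + a$2 + a$3 = 1" "descending a" "descending b" "descending c"
  shows "standard S a b c"
proof -
  have "complex_of_real ((norm S)\<^sup>2) = of_real (a$1 + a$2 + a$3)"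
    unfolding norm_marg by (simp add: assms(1) diag_nth sum_3)
  then have "(norm S)\<^sup>2 = 1\<^sup>2" using assms(4) by (simp only: of_real_eq_iff power_one)
  then have "norm S = 1" by (simp add: power2_eq_iff_nonneg del: power_one)
  then show ?thesis using assms unfolding standard_def by (auto intro: matrix_eqI)
qed

lemma matrix_exhaust:
  assumes "\<And>i. i \<in> {1,2,3} \<Longrightarrow> (\<And>j. j \<in> {1,2,3} \<Longrightarrow> P i j)"
  shows "P (i::3) (j::3)"
  using assms exhaust_3 by blast

lemma tensor_act_diff: "tensor_act A B C (S - T) = tensor_act A B C S - tensor_act A B C T"
  by (rule tensor_eqI) (simp add: tensor_act_nth right_diff_distrib sum_subtractf)

lemma D_strict:
  "(vector [1,0,0], flat, flat) \<notin> moment_polytope tensor_D"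
  "(vector [1,0,0], flat, flat) \<in> moment_polytope (tensor_D + ee 1 1 1)"
proof -
  show "(vector [1,0,0], flat, flat) \<notin> moment_polytope tensor_D"
  proof
    assume "(vector [1,0,0], flat, flat) \<in> moment_polytope tensor_D"
    then obtain S where S: "S \<in> closure (GL_orbit tensor_D)" "standard S (vector [1,0,0]) flat flat"
      using moment_polytope_iff by blast
    have "closed {T. det (slice (ax 1) T) = 0}"
      unfolding det_br3 br3_def slice_nth by (intro closed_Collect_eq continuous_intros)
    moreover have "GL_orbit tensor_D \<subseteq> {T. det (slice (ax 1) T) = 0}"
      by (auto simp: GL_orbit_def det_slice_act det_slice_D)
    ultimately have "det (slice (ax 1) S) = 0" using S(1) closure_minimal by blast
    \<comment> \<open>With first spectrum (1,0,0) only the first slice survives, and the flat second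
      marginal makes it a multiple of a unitary matrix, against the vanishing determinant.\<close>
    moreover have "map_matrix cnj (slice (ax 1) S) ** transpose (slice (ax 1) S) = marg2 S"
      using standard_slice_zero[OF S(2), of 2] standard_slice_zero[OF S(2), of 3]
      by (intro matrix_eqI) (simp add: matrix_matrix_mult_def transpose_def slice_nth marg1_nth sum_3 axis_def)
    ultimately have "det (diag flat) = 0"
      using S(2) by (metis det_mul det_transpose mult_zero_right standard_def)
    then show False by (simp add: det_3 diag_nth)
  qed
  define r where "r = 1 / sqrt 3"
  have r: "r * r = 1/3" "r > 0" by (simp_all add: r_def)
  then have rr: "complex_of_real r * complex_of_real r = 1/3" by (metis of_real_1 of_real_divide of_real_mult of_real_numeral)
  \<comment> \<open>Scaling away the other two slices leaves the first slice of D + e_111, a signed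
    permutation matrix, which has flat marginals.\<close>
  define h where "h e = r *\<^sub>R (ee 1 1 1 + ee 1 2 3 - ee 1 3 2) + e *\<^sub>R (ee 2 3 1 + ee 3 1 2 - ee 2 1 3 - ee 3 2 1)" for e :: real
  have "h 0 \<in> closure (GL_orbit (tensor_D + ee 1 1 1))"
  proof (rule closure_orbitI)
    show "isCont h 0" unfolding h_def by (intro continuous_intros)
    fix e :: real assume e: "e \<noteq> 0"
    show "h e \<in> GL_orbit (tensor_D + ee 1 1 1)"
    proof (rule in_orbitI)
      show "h e = tensor_act (dmat r e e) (dmat 1 1 1) (dmat 1 1 1) (tensor_D + ee 1 1 1)"
        by (intro tensor_eq_exhaust) (elim insertE emptyE; simp add: h_def tensor_act_dmat ee_nth tensor_D_nth scaleR_conv_of_real[of _ "1::complex"])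
    qed (use e r in \<open>simp_all add: invertible_dmat\<close>)
  qed
  moreover have "standard (h 0) (vector [1,0,0]) flat flat"
  proof (rule standardI)
    fix i j
    show "marg1 (h 0)$i$j = diag (vector [1,0,0])$i$j" "marg2 (h 0)$i$j = diag flat$i$j" "marg3 (h 0)$i$j = diag flat$i$j"
      by (rule matrix_exhaust, elim insertE emptyE; simp add: marg1_nth sum_3 h_def ee_nth diag_nth rr scaleR_conv_of_real[of _ "1::complex"])+
  qed (simp_all add: descending_def)
  ultimately show "(vector [1,0,0], flat, flat) \<in> moment_polytope (tensor_D + ee 1 1 1)"
    using moment_polytope_iff by blast
qed

lemma tensor_act_D_W_nth:
  "tensor_act A B C (tensor_D + tensor_W)$i$j$k =
    (let a = \<lambda>n. (A *v ax n)$i; b = \<lambda>n. (B *v ax n)$j; c = \<lambda>n. (C *v ax n)$k in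
      a 1 * b 2 * c 3 + a 2 * b 3 * c 1 + a 3 * b 1 * c 2 - a 1 * b 3 * c 2 - a 2 * b 1 * c 3 - a 3 * b 2 * c 1
      + (a 1 * b 1 * c 2 + a 1 * b 2 * c 1 + a 2 * b 1 * c 1))"
  unfolding tensor_act_add tensor_act_diff tensor_D_def tensor_W_def ee_def tensor_act_tensor_prod
  by (simp add: tensor_prod_def)

lemma e111_strict:
  "(vector [2/3,1/3,0], flat, flat) \<notin> moment_polytope (tensor_D + ee 1 1 1)"
  "(vector [2/3,1/3,0], flat, flat) \<in> moment_polytope (tensor_D + tensor_W)"
proof -
  show "(vector [2/3,1/3,0], flat, flat) \<notin> moment_polytope (tensor_D + ee 1 1 1)"
    using moment_polytope_iff pencil_triple_zero orbit_e111_triple_zero by fastforce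
  define r where "r = 1 / sqrt 3"
  have r: "r * r = 1/3" "r > 0" by (simp_all add: r_def)
  then have rr: "complex_of_real r * complex_of_real r = 1/3" by (metis of_real_1 of_real_divide of_real_mult of_real_numeral)
  \<comment> \<open>At e = 0 the slice pencil is r (s (E_12 + E_21) + t E_33), with determinant -r^3
    s^2 t: a double zero that is not triple, and equality in the bound a_2 <= 1/3.\<close>
  define h where "h e = r *\<^sub>R (ee 1 1 2 + ee 1 2 1 + ee 2 3 3) - (r * e\<^sup>2) *\<^sub>R ee 2 1 1
    + (r / 3) *\<^sub>R (e\<^sup>2 *\<^sub>R (ee 3 1 2 - ee 3 2 1) + e *\<^sub>R (ee 3 3 2 - ee 3 2 3))" for e :: real
  have "h 0 \<in> closure (GL_orbit (tensor_D + tensor_W))"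
  proof (rule closure_orbitI)
    show "isCont h 0" unfolding h_def by (intro continuous_intros)
    fix e :: real assume e: "e \<noteq> 0"
    \<comment> \<open>\<open>B\<close> and \<open>C\<close> diverge as e tends to 0; their entries
      are arranged so that the terms of order 1/e coming from D and from W cancel, which leaves the
      polynomial family h.\<close>
    define B where "B = (vector [vector [of_real e, 0, - 2 * of_real e], vector [0, 1 / of_real e, 0], vector [1, 0, 1]] :: complex^3^3)"
    define C where "C = (vector [vector [of_real e, 0, 2 * of_real e], vector [0, 1 / of_real e, 0], vector [1, 0, -1]] :: complex^3^3)"
    define A where "A = dmat (of_real (r / 3)) (of_real (r / 3)) (of_real (r / 3 * e\<^sup>2))"
    have A: "A *v ax 1 = vector [of_real r / 3, 0, 0]" "A *v ax 2 = vector [0, of_real r / 3, 0]"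
      "A *v ax 3 = vector [0, 0, of_real r / 3 * (of_real e)\<^sup>2]"
      unfolding A_def dmat_mult_vec by (simp_all add: vec_eq_iff forall_3 axis_def)
    have B: "B *v ax 1 = vector [of_real e, 0, 1]" "B *v ax 2 = vector [0, 1 / of_real e, 0]" "B *v ax 3 = vector [- 2 * of_real e, 0, 1]"
      and C: "C *v ax 1 = vector [of_real e, 0, 1]" "C *v ax 2 = vector [0, 1 / of_real e, 0]" "C *v ax 3 = vector [2 * of_real e, 0, -1]"
      by (simp_all add: B_def C_def vec_eq_iff forall_3 matrix_vector_mult_def sum_3 axis_def)
    have "det B \<noteq> 0" "det C \<noteq> 0" using e by (simp_all add: det_3 B_def C_def)
    moreover have "invertible A" using e r by (simp add: A_def invertible_dmat)
    moreover have "h e = tensor_act A B C (tensor_D + tensor_W)"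
    proof (rule tensor_eq_exhaust)
      fix i j k :: 3 assume ijk: "i \<in> {1,2,3}" "j \<in> {1,2,3}" "k \<in> {1,2,3}"
      have h: "h e$i$j$k = of_real r * (ee 1 1 2$i$j$k + ee 1 2 1$i$j$k + ee 2 3 3$i$j$k - (of_real e)\<^sup>2 * ee 2 1 1$i$j$k
          + (of_real e)\<^sup>2 / 3 * (ee 3 1 2$i$j$k - ee 3 2 1$i$j$k) + of_real e / 3 * (ee 3 3 2$i$j$k - ee 3 2 3$i$j$k))"
        unfolding h_def by (simp add: scaleR_conv_of_real[of _ "_ :: complex"] algebra_simps)
      define c q where "c = complex_of_real e" and "q = complex_of_real r"
      have c: "c \<noteq> 0" using e by (simp add: c_def)
      show "h e$i$j$k = tensor_act A B C (tensor_D + tensor_W)$i$j$k"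
        using ijk unfolding h tensor_act_D_W_nth A B C c_def[symmetric] q_def[symmetric] Let_def
        by (elim insertE emptyE; simp add: ee_nth c) (simp_all add: c power2_eq_square field_simps)
    qed
    ultimately show "h e \<in> GL_orbit (tensor_D + tensor_W)"
      by (intro in_orbitI[of A B C]) (simp_all add: invertible_det_nz[of B] invertible_det_nz[of C])
  qed
  moreover have "standard (h 0) (vector [2/3,1/3,0]) flat flat"
  proof (rule standardI)
    fix i j
    show "marg1 (h 0)$i$j = diag (vector [2/3,1/3,0])$i$j" "marg2 (h 0)$i$j = diag flat$i$j" "marg3 (h 0)$i$j = diag flat$i$j"
      by (rule matrix_exhaust, elim insertE emptyE; simp add: marg1_nth sum_3 h_def ee_nth diag_nth rr scaleR_conv_of_real[of _ "1::complex"])+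
  qed (simp_all add: descending_def)
  ultimately show "(vector [2/3,1/3,0], flat, flat) \<in> moment_polytope (tensor_D + tensor_W)"
    using moment_polytope_iff by blast
qed

lemma W_strict:
  "(vector [1/2,1/2,0], flat, flat) \<notin> moment_polytope (tensor_D + tensor_W)"
  "(vector [1/2,1/2,0], flat, flat) \<in> kronecker_polytope"
proof -
  show "(vector [1/2,1/2,0], flat, flat) \<notin> moment_polytope (tensor_D + tensor_W)"
    using moment_polytope_iff pencil_double_zero orbit_W_double_zero by fastforce
  define r where "r = 1 / sqrt 6"
  have r: "r * r = 1/6" by (simp add: r_def)
  then have rr: "complex_of_real r * complex_of_real r = 1/6" by (metis of_real_1 of_real_divide of_real_mult of_real_numeral)
  \<comment> \<open>The first two slices are multiples of the identity and of a cyclic shift, so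
    their pencil has determinant proportional to s^3 + t^3, with three simple zeros.\<close>
  define S where "S = r *\<^sub>R (ee 1 1 1 + ee 1 2 2 + ee 1 3 3 + ee 2 1 2 + ee 2 2 3 + ee 2 3 1)"
  have "standard S (vector [1/2,1/2,0]) flat flat"
  proof (rule standardI)
    fix i j
    show "marg1 S$i$j = diag (vector [1/2,1/2,0])$i$j" "marg2 S$i$j = diag flat$i$j" "marg3 S$i$j = diag flat$i$j"
      by (rule matrix_exhaust, elim insertE emptyE; simp add: marg1_nth sum_3 S_def ee_nth diag_nth rr scaleR_conv_of_real[of _ "1::complex"])+
  qed (simp_all add: descending_def)
  then show "(vector [1/2,1/2,0], flat, flat) \<in> kronecker_polytope"
    using kronecker_polytope_iff by blast
qed

theorem theorem5p22:
  shows "(\<forall>\<alpha> Tu. \<alpha> \<noteq> 0 \<and> Tu \<in> U4 \<longrightarrow>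
            moment_polytope (\<alpha> \<cdot>\<^sub>T tensor_D + Tu) = moment_polytope (tensor_D + Tu))
       \<and> moment_polytope tensor_D \<subset> moment_polytope (tensor_D + ee 1 1 1)
       \<and> moment_polytope (tensor_D + ee 1 1 1) \<subset> moment_polytope (tensor_D + tensor_W)
       \<and> moment_polytope (tensor_D + tensor_W) \<subset> kronecker_polytope
       \<and> (\<forall>Tu \<in> U4 - {0, ee 1 1 1, tensor_W}.
            moment_polytope (tensor_D + Tu) = kronecker_polytope)"
proof (intro conjI allI ballI impI)
  fix \<alpha> :: complex and Tu assume "\<alpha> \<noteq> 0 \<and> Tu \<in> U4"
  then show "moment_polytope (\<alpha> \<cdot>\<^sub>T tensor_D + Tu) = moment_polytope (tensor_D + Tu)"
    by (intro moment_polytope_orbit scaled_D_orbit) auto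
next
  show "moment_polytope tensor_D \<subset> moment_polytope (tensor_D + ee 1 1 1)"
    using moment_polytope_mono[OF D_degenerates] D_strict by blast
  show "moment_polytope (tensor_D + ee 1 1 1) \<subset> moment_polytope (tensor_D + tensor_W)"
    using moment_polytope_mono[OF W_degenerates] e111_strict by blast
  show "moment_polytope (tensor_D + tensor_W) \<subset> kronecker_polytope"
    using moment_polytope_subset_kronecker W_strict by blast
next
  fix Tu assume "Tu \<in> U4 - {0, ee 1 1 1, tensor_W}"
  then have "Tu \<in> {conic_tangent, cuspidal, ee 1 1 1 + ee 2 2 2}"
    unfolding U4_def conic_tangent_def cuspidal_def by blast
  then show "moment_polytope (tensor_D + Tu) = kronecker_polytope"
    by (rule moment_polytope_generic)
qed

end
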